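(* Fix $K>0$. Let $M_i=(X_i,d_i,T_i)$, $i\in\{1,2,\dots,\infty\}$, be $m$-dimensional integral current spaces with $M_i\to M_\infty$ in the intrinsic flat sense, let $W$ be a compact metric space, and let $F_i:X_i\to W$ ($i<\infty$) be Lipschitz maps with $\operatorname{Lip}(F_i)\le K$. Then a subsequence of the $F_i$ converges to a Lipschitz map $F_\infty:X_\infty\to W$ with $\operatorname{Lip}(F_\infty)\le K$. More specifically, there exist, for the subsequence (still indexed by $i$) and for $i=\infty$, isometric embeddings $\varphi_i:X_i\to Z$ into a common complete metric space $Z$ such that $d_F^Z(\varphi_{i\#}T_i,\varphi_{\infty\#}T_\infty)\to0$ and such that for any sequence $p_i\in X_i$ converging to $p\in X_\infty$ in the sense that $$d_Z(\varphi_i(p_i),\varphi_\infty(p))\to0,$$ one has converging images: $$d_W(F_i(p_i),F_\infty(p))\to0.$$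
   Context: **Currents (Ambrosio–Kirchheim).** For a complete metric space $Z$, an $m$-dimensional current $T$ on $Z$ is a real multilinear functional $T(f,\pi_1,\dots,\pi_m)$ on tuples with $f:Z\to\mathbb R$ bounded Lipschitz and $\pi_i:Z\to\mathbb R$ Lipschitz satisfying: locality ($T(f,\pi)=0$ if some $\pi_i$ is constant on a neighborhood of $\{f\ne0\}$); continuity with respect to pointwise convergence of the $\pi_i$ with $\operatorname{Lip}(\pi_i)\le1$; and finite mass (there is a finite Borel measure $\mu$ with $|T(f,\pi)|\le\prod_i\operatorname{Lip}(\pi_i)\int_Z|f|\,d\mu$). The smallest such $\mu$ is the mass measure $\|T\|$, and $\mathbf M(T)=\|T\|(Z)$. $T$ extends to bounded Borel $f$. Push-forward by Lipschitz $\varphi$: $\varphi_\#T(f,\pi)=T(f\circ\varphi,\pi\circ\varphi)$. Restriction to a Borel set: $T\llcorner A(f,\pi)=T(\mathbf 1_A f,\pi)$. Boundary: $\partial T(f,\pi_1,\dots,\pi_{m-1})=T(1,f,\pi_1,\dots,\pi_{m-1})$ (and $\partial T=0$ if $m=0$). $\operatorname{set}(T)=\{p\in Z:\liminf_{r\to0}\|T\|(B(p,r))/(\omega_m r^m)>0\}$, where $\omega_m$ is the volume of the unit ball in $\mathbb R^m$. For $m\ge1$, $T$ is integer rectifiable if $\operatorname{set}(T)$ is countably $\mathcal H^m$-rectifiable, $\|T\|$ vanishes on $\mathcal H^m$-null sets, and for every Lipschitz $\varphi:Z\to\mathbb R^m$ and open $A\subset Z$, $\varphi_\#(T\llcorner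 A)$ is integration against some $\theta\in L^1(\mathbb R^m,\mathbb Z)$; a $0$-dimensional one is a finite sum of signed, positive-integer-weighted point evaluations. $\mathbf I_m(Z)$ is the set of integral currents: integer rectifiable $T$ with $\mathbf M(\partial T)<\infty$. **Integral current spaces.** An $m$-dimensional integral current space is $(X,d,T)$ with $(X,d)$ a metric space, $\bar X$ its metric completion, $T\in\mathbf I_m(\bar X)$ and $\operatorname{set}(T)=X$. Also included is the zero space $\mathbf 0$, with empty metric space and $T=0$. **Intrinsic flat distance.** An isometric embedding is a distance-preserving map; an isometric embedding $X\to Z$ into a complete space extends uniquely to $\bar X$. For $S,T\in\mathbf I_m(Z)$, $d_F^Z(S,T)=\inf\{\mathbf M(U)+\mathbf M(V): S-T=U+\partial V,\ U\in\mathbf I_m(Z),\ V\in\mathbf I_{m+1}(Z)\}$. Then $d_{\mathcal F}((X_1,d_1,T_1),(X_2,d_2,T_2))=\inf d_F^Z(\varphi_{1\#}T_1,\varphi_{2\#}T_2)$ over all complete metric spaces $Z$ and isometric embeddings $\varphi_i:\bar X_i\to Z$ (the push-forward from $\mathbf 0$ is the zero current). Intrinsic flat convergence $M_i\to M_\infty$ means $d_{\mathcal F}(M_i,M_\infty)\to0$. $\operatorname{Lip}(F)$ denotes the Lipschitz constant of $F$. *)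

theory Defs
  imports "HOL-Analysis.Analysis"
begin

text \<open>
  Metric spaces are elements of the library type \<^typ>\<open>'a metric\<close>, i.e. they are given by a carrier
  \<^term>\<open>mspace M\<close>, which may be empty, and a distance \<^term>\<open>mdist M\<close>. Functions on a metric space are
  total functions on the underlying type; only their values on the carrier matter.
\<close>

section \<open>Lipschitz maps, isometric embeddings, completions\<close>

definition Lip :: "'a metric \<Rightarrow> 'b metric \<Rightarrow> ('a \<Rightarrow> 'b) \<Rightarrow> real" where
  "Lip X Y f = Inf {L. 0 \<le> L \<and>
     (\<forall>x\<in>mspace X. \<forall>y\<in>mspace X. mdist Y (f x) (f y) \<le> L * mdist X x y)}"

definition lip_fun :: "'a metric \<Rightarrow> ('a \<Rightarrow> real) \<Rightarrow> bool" where
  "lip_fun Z f \<longleftrightarrow> Lipschitz_continuous_map Z euclidean_metric f"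

definition blip_fun :: "'a metric \<Rightarrow> ('a \<Rightarrow> real) \<Rightarrow> bool" where
  "blip_fun Z f \<longleftrightarrow> lip_fun Z f \<and> bounded (f ` mspace Z)"

definition isometric_embedding :: "'a metric \<Rightarrow> 'b metric \<Rightarrow> ('a \<Rightarrow> 'b) \<Rightarrow> bool" where
  "isometric_embedding X Z \<phi> \<longleftrightarrow> \<phi> \<in> mspace X \<rightarrow> mspace Z \<and>
     (\<forall>x\<in>mspace X. \<forall>y\<in>mspace X. mdist Z (\<phi> x) (\<phi> y) = mdist X x y)"

text \<open>A metric completion is regarded as a superset of the given space, not as a space of Cauchy
  sequences; it is determined up to an isometry fixing the given space.\<close>

definition metric_completion_of :: "'a metric \<Rightarrow> 'a metric \<Rightarrow> bool" where
  "metric_completion_of X Xbar \<longleftrightarrow>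
     mcomplete_of Xbar \<and> mspace X \<subseteq> mspace Xbar \<and>
     (\<forall>x\<in>mspace X. \<forall>y\<in>mspace X. mdist Xbar x y = mdist X x y) \<and>
     mtopology_of Xbar closure_of mspace X = mspace Xbar"

definition borel_metric :: "'a metric \<Rightarrow> 'a measure" where
  "borel_metric Z = sigma (mspace Z) {U. openin (mtopology_of Z) U}"

section \<open>Metric currents\<close>

text \<open>The list of functions \<open>\<pi>\<close> in \<open>T f \<pi>\<close> has length \<open>m\<close> when \<open>T\<close> is \<open>m\<close>-dimensional. Values of \<open>T\<close>
  on tuples that do not satisfy \<open>adm\<close> are irrelevant, so currents are compared on these tuples
  only.\<close>

type_synonym 'a current = "('a \<Rightarrow> real) \<Rightarrow> ('a \<Rightarrow> real) list \<Rightarrow> real"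

definition adm :: "nat \<Rightarrow> 'a metric \<Rightarrow> ('a \<Rightarrow> real) \<Rightarrow> ('a \<Rightarrow> real) list \<Rightarrow> bool" where
  "adm m Z f \<pi> \<longleftrightarrow> blip_fun Z f \<and> length \<pi> = m \<and> (\<forall>p\<in>set \<pi>. lip_fun Z p)"

definition multilinear_functional :: "nat \<Rightarrow> 'a metric \<Rightarrow> 'a current \<Rightarrow> bool" where
  "multilinear_functional m Z T \<longleftrightarrow>
     (\<forall>f g \<pi> a b. adm m Z f \<pi> \<and> adm m Z g \<pi> \<longrightarrow>
        T (\<lambda>x. a * f x + b * g x) \<pi> = a * T f \<pi> + b * T g \<pi>) \<and>
     (\<forall>f \<pi> i p q a b. adm m Z f \<pi> \<and> i < m \<and> lip_fun Z p \<and> lip_fun Z q \<longrightarrow>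
        T f (\<pi>[i := (\<lambda>x. a * p x + b * q x)]) = a * T f (\<pi>[i := p]) + b * T f (\<pi>[i := q]))"

definition local_functional :: "nat \<Rightarrow> 'a metric \<Rightarrow> 'a current \<Rightarrow> bool" where
  "local_functional m Z T \<longleftrightarrow>
     (\<forall>f \<pi>. adm m Z f \<pi> \<and>
        (\<exists>i<m. \<exists>U c. openin (mtopology_of Z) U \<and> {x \<in> mspace Z. f x \<noteq> 0} \<subseteq> U \<and>
           (\<forall>x\<in>U. (\<pi> ! i) x = c)) \<longrightarrow>
        T f \<pi> = 0)"

definition continuous_functional :: "nat \<Rightarrow> 'a metric \<Rightarrow> 'a current \<Rightarrow> bool" where
  "continuous_functional m Z T \<longleftrightarrow>
     (\<forall>f \<pi> \<pi>s. adm m Z f \<pi> \<and>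
        (\<forall>j. adm m Z f (\<pi>s j) \<and> (\<forall>p\<in>set (\<pi>s j). Lip Z euclidean_metric p \<le> 1)) \<and>
        (\<forall>i<m. \<forall>x\<in>mspace Z. (\<lambda>j. (\<pi>s j ! i) x) \<longlonglongrightarrow> (\<pi> ! i) x) \<longrightarrow>
        (\<lambda>j. T f (\<pi>s j)) \<longlonglongrightarrow> T f \<pi>)"

definition mass_bound :: "nat \<Rightarrow> 'a metric \<Rightarrow> 'a current \<Rightarrow> 'a measure \<Rightarrow> bool" where
  "mass_bound m Z T \<mu> \<longleftrightarrow>
     space \<mu> = mspace Z \<and> sets \<mu> = sets (borel_metric Z) \<and> finite_measure \<mu> \<and>
     (\<forall>f \<pi>. adm m Z f \<pi> \<longrightarrow>
        \<bar>T f \<pi>\<bar> \<le> prod_list (map (Lip Z euclidean_metric) \<pi>) * (LINT x|\<mu>. \<bar>f x\<bar>))"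

definition metric_current :: "nat \<Rightarrow> 'a metric \<Rightarrow> 'a current \<Rightarrow> bool" where
  "metric_current m Z T \<longleftrightarrow>
     multilinear_functional m Z T \<and> local_functional m Z T \<and> continuous_functional m Z T \<and>
     (\<exists>\<mu>. mass_bound m Z T \<mu>)"

definition mass_measure :: "nat \<Rightarrow> 'a metric \<Rightarrow> 'a current \<Rightarrow> 'a measure" where
  "mass_measure m Z T =
     (THE \<mu>. mass_bound m Z T \<mu> \<and>
        (\<forall>\<nu>. mass_bound m Z T \<nu> \<longrightarrow> (\<forall>A\<in>sets (borel_metric Z). emeasure \<mu> A \<le> emeasure \<nu> A)))"

text \<open>The mass is infinite for functionals (such as boundaries of currents) without finite mass.\<close>

definition mass :: "nat \<Rightarrow> 'a metric \<Rightarrow> 'a current \<Rightarrow> ennreal" where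
  "mass m Z T =
     (if \<exists>\<mu>. mass_bound m Z T \<mu> then emeasure (mass_measure m Z T) (mspace Z) else \<infinity>)"

text \<open>Value of the extension of \<open>T\<close> at a bounded Borel function \<open>f\<close>: bounded Lipschitz functions
  are dense in \<open>L\<^sup>1(\<parallel>T\<parallel>)\<close>, and \<open>T\<close> is continuous in its first argument for the \<open>L\<^sup>1(\<parallel>T\<parallel>)\<close> seminorm.\<close>

definition borel_extension :: "nat \<Rightarrow> 'a metric \<Rightarrow> 'a current \<Rightarrow> 'a current" where
  "borel_extension m Z T f \<pi> =
     (THE l. \<exists>g. (\<forall>n. blip_fun Z (g n)) \<and>
        (\<lambda>n. LINT x|mass_measure m Z T. \<bar>g n x - f x\<bar>) \<longlonglongrightarrow> 0 \<and>
        (\<lambda>n. T (g n) \<pi>) \<longlonglongrightarrow> l)"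

definition restriction :: "nat \<Rightarrow> 'a metric \<Rightarrow> 'a current \<Rightarrow> 'a set \<Rightarrow> 'a current" where
  "restriction m Z T A f \<pi> = borel_extension m Z T (\<lambda>x. indicator A x * f x) \<pi>"

definition pushforward :: "('a \<Rightarrow> 'b) \<Rightarrow> 'a current \<Rightarrow> 'b current" where
  "pushforward \<phi> T f \<pi> = T (f \<circ> \<phi>) (map (\<lambda>p. p \<circ> \<phi>) \<pi>)"

definition boundary :: "nat \<Rightarrow> 'a current \<Rightarrow> 'a current" where
  "boundary m T f \<pi> = (if m = 0 then 0 else T (\<lambda>_. 1) (f # \<pi>))"

definition current_set :: "nat \<Rightarrow> 'a metric \<Rightarrow> 'a current \<Rightarrow> 'a set" where
  "current_set m Z T =
     {p \<in> mspace Z.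
        Liminf (at_right 0)
          (\<lambda>r. ereal (measure (mass_measure m Z T) (mball_of Z p r) / (unit_ball_vol (real m) * r ^ m))) > 0}"

section \<open>Euclidean space, Hausdorff measure, rectifiability\<close>

text \<open>Since the dimension is a term, Euclidean space consists of the functions on \<open>{..<m}\<close>.\<close>

definition euclidean_dist :: "nat \<Rightarrow> (nat \<Rightarrow> real) \<Rightarrow> (nat \<Rightarrow> real) \<Rightarrow> real" where
  "euclidean_dist m x y = sqrt (\<Sum>i<m. (x i - y i)\<^sup>2)"

definition euclidean_metric_of_dim :: "nat \<Rightarrow> (nat \<Rightarrow> real) metric" where
  "euclidean_metric_of_dim m = metric (PiE {..<m} (\<lambda>_. UNIV), euclidean_dist m)"

lemma Metric_space_euclidean_dist:
  "Metric_space (PiE {..<m} (\<lambda>_. UNIV :: real set)) (euclidean_dist m)"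
proof
  fix x y z :: "nat \<Rightarrow> real"
  show "0 \<le> euclidean_dist m x y"
    by (simp add: euclidean_dist_def sum_nonneg)
  show "euclidean_dist m x y = euclidean_dist m y x"
    by (simp add: euclidean_dist_def power2_commute)
  show "euclidean_dist m x z \<le> euclidean_dist m x y + euclidean_dist m y z"
    using L2_set_triangle_ineq[of "\<lambda>i. x i - y i" "\<lambda>i. y i - z i" "{..<m}"]
    by (simp add: euclidean_dist_def L2_set_def)
  show "(euclidean_dist m x y = 0) = (x = y)"
    if "x \<in> PiE {..<m} (\<lambda>_. UNIV)" "y \<in> PiE {..<m} (\<lambda>_. UNIV)"
    using that PiE_ext[OF that] by (auto simp: euclidean_dist_def sum_nonneg_eq_0_iff)
qed

lemma mspace_euclidean_metric_of_dim [simp]: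
  "mspace (euclidean_metric_of_dim m) = PiE {..<m} (\<lambda>_. UNIV)"
  and mdist_euclidean_metric_of_dim [simp]:
  "mdist (euclidean_metric_of_dim m) = euclidean_dist m"
  using Metric_space_euclidean_dist[of m]
  by (simp_all add: euclidean_metric_of_dim_def Metric_space.mspace_metric Metric_space.mdist_metric)

definition lebesgue_of_dim :: "nat \<Rightarrow> (nat \<Rightarrow> real) measure" where
  "lebesgue_of_dim m = completion (PiM {..<m} (\<lambda>_. lborel))"

definition partial_derivative :: "((nat \<Rightarrow> real) \<Rightarrow> real) \<Rightarrow> nat \<Rightarrow> (nat \<Rightarrow> real) \<Rightarrow> real" where
  "partial_derivative p j x = deriv (\<lambda>t. p (x(j := t))) (x j)"

text \<open>For Lipschitz \<open>\<pi>\<close> the Jacobian is meaningful almost everywhere by Rademacher's theorem.\<close>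

definition jacobian_det :: "nat \<Rightarrow> ((nat \<Rightarrow> real) \<Rightarrow> real) list \<Rightarrow> (nat \<Rightarrow> real) \<Rightarrow> real" where
  "jacobian_det m \<pi> x =
     (\<Sum>\<sigma> | \<sigma> permutes {..<m}.
        of_int (sign \<sigma>) * (\<Prod>i<m. partial_derivative (\<pi> ! i) (\<sigma> i) x))"

definition integration_current :: "nat \<Rightarrow> ((nat \<Rightarrow> real) \<Rightarrow> real) \<Rightarrow> (nat \<Rightarrow> real) current" where
  "integration_current m \<theta> f \<pi> = (LINT x|lebesgue_of_dim m. \<theta> x * f x * jacobian_det m \<pi> x)"

definition metric_diameter :: "'a metric \<Rightarrow> 'a set \<Rightarrow> ennreal" where
  "metric_diameter Z C = (SUP x\<in>C. SUP y\<in>C. ennreal (mdist Z x y))"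

text \<open>The case distinction only matters for \<open>m = 0\<close>, where \<open>0 ^ 0 = 1\<close>.\<close>

definition hausdorff_measure :: "nat \<Rightarrow> 'a metric \<Rightarrow> 'a set \<Rightarrow> ennreal" where
  "hausdorff_measure m Z S =
     (SUP \<delta>\<in>{0<..}.
        INF C\<in>{C :: nat \<Rightarrow> 'a set. S \<subseteq> (\<Union>n. C n) \<and>
            (\<forall>n. C n \<subseteq> mspace Z \<and> metric_diameter Z (C n) \<le> ennreal \<delta>)}.
          (\<Sum>n. if C n = {} then 0
               else ennreal (unit_ball_vol (real m)) * (metric_diameter Z (C n) / 2) ^ m))"

definition countably_rectifiable :: "nat \<Rightarrow> 'a metric \<Rightarrow> 'a set \<Rightarrow> bool" where
  "countably_rectifiable m Z S \<longleftrightarrow> S \<subseteq> mspace Z \<and>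
     (\<exists>(A :: nat \<Rightarrow> (nat \<Rightarrow> real) set) g.
        (\<forall>n. A n \<subseteq> mspace (euclidean_metric_of_dim m) \<and>
             Lipschitz_continuous_map (submetric (euclidean_metric_of_dim m) (A n)) Z (g n)) \<and>
        hausdorff_measure m Z (S - (\<Union>n. g n ` A n)) = 0)"

section \<open>Integral currents and integral current spaces\<close>

definition integer_rectifiable :: "nat \<Rightarrow> 'a metric \<Rightarrow> 'a current \<Rightarrow> bool" where
  "integer_rectifiable m Z T \<longleftrightarrow> metric_current m Z T \<and>
     (if m = 0 then
        \<exists>n (p :: nat \<Rightarrow> 'a) (\<sigma> :: nat \<Rightarrow> real) (\<theta> :: nat \<Rightarrow> nat).
          (\<forall>j<n. p j \<in> mspace Z \<and> \<sigma> j \<in> {1, -1} \<and> \<theta> j > 0) \<and>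
          (\<forall>f. blip_fun Z f \<longrightarrow> T f [] = (\<Sum>j<n. \<sigma> j * real (\<theta> j) * f (p j)))
      else
        countably_rectifiable m Z (current_set m Z T) \<and>
        (\<forall>N\<in>sets (borel_metric Z).
           hausdorff_measure m Z N = 0 \<longrightarrow> emeasure (mass_measure m Z T) N = 0) \<and>
        (\<forall>\<phi> A. Lipschitz_continuous_map Z (euclidean_metric_of_dim m) \<phi> \<and>
               openin (mtopology_of Z) A \<longrightarrow>
           (\<exists>\<theta>. integrable (lebesgue_of_dim m) \<theta> \<and>
                (\<forall>x\<in>mspace (euclidean_metric_of_dim m). \<theta> x \<in> \<int>) \<and>
                (\<forall>f \<pi>. adm m (euclidean_metric_of_dim m) f \<pi> \<longrightarrow>
                   pushforward \<phi> (restriction m Z T A) f \<pi> = integration_current m \<theta> f \<pi>))))"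

definition integral_current :: "nat \<Rightarrow> 'a metric \<Rightarrow> 'a current \<Rightarrow> bool" where
  "integral_current m Z T \<longleftrightarrow>
     integer_rectifiable m Z T \<and> mass (m - 1) Z (boundary m T) < \<infinity>"

text \<open>The zero space is the case \<open>mspace X = {}\<close>: the completion is then empty and a current on the
  empty space vanishes.\<close>

definition integral_current_space :: "nat \<Rightarrow> 'a metric \<Rightarrow> 'a metric \<Rightarrow> 'a current \<Rightarrow> bool" where
  "integral_current_space m X Xbar T \<longleftrightarrow>
     metric_completion_of X Xbar \<and> integral_current m Xbar T \<and> current_set m Xbar T = mspace X"

section \<open>Flat and intrinsic flat distance\<close>

definition flat_dist :: "nat \<Rightarrow> 'a metric \<Rightarrow> 'a current \<Rightarrow> 'a current \<Rightarrow> ennreal" where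
  "flat_dist m Z S T =
     (INF (U, V)\<in>{(U, V). integral_current m Z U \<and> integral_current (Suc m) Z V \<and>
          (\<forall>f \<pi>. adm m Z f \<pi> \<longrightarrow> S f \<pi> - T f \<pi> = U f \<pi> + boundary (Suc m) V f \<pi>)}.
        mass m Z U + mass (Suc m) Z V)"

text \<open>HOL cannot quantify over all metric spaces at once; here \<open>Z\<close> ranges over the complete metric
  spaces whose carrier is a set of elements of the type \<open>'z\<close>. The infimum decreases when \<open>'z\<close> is
  enlarged. For a sequence of pairs of spaces, countably many \<open>Z\<close> approximate all the infima over
  arbitrary complete metric spaces, and these \<open>Z\<close> have copies in one common type. So convergence to
  \<open>0\<close> of the unrestricted distances means convergence to \<open>0\<close> for some type \<open>'z\<close>; a hypothesis of
  this form is expressed by leaving \<open>'z\<close> universally quantified in the theorem.\<close>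

definition intrinsic_flat_dist ::
  "'z itself \<Rightarrow> nat \<Rightarrow> 'a metric \<Rightarrow> 'a current \<Rightarrow> 'b metric \<Rightarrow> 'b current \<Rightarrow> ennreal" where
  "intrinsic_flat_dist _ m X1bar T1 X2bar T2 =
     (INF (Z, \<phi>1, \<phi>2)\<in>{(Z :: 'z metric, \<phi>1, \<phi>2). mcomplete_of Z \<and>
          isometric_embedding X1bar Z \<phi>1 \<and> isometric_embedding X2bar Z \<phi>2}.
        flat_dist m Z (pushforward \<phi>1 T1) (pushforward \<phi>2 T2))"

end

theory Submission
  imports Defs "HOL-Library.Diagonal_Subsequence"
begin

text \<open>
  Three things have to be found: a common space, a subsequence, and a limit map.

  The common space. For each late index there is a complete metric space that contains isometric copies of
  the two given spaces and in which the flat distance is almost the intrinsic flat distance. All these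
  spaces contain a copy of the limit space; gluing them along it gives one complete space
  (\<open>glue_along_common_subspace\<close>). The flat distances do not increase, because isometric push-forward
  maps integral currents to integral currents of the same mass (\<open>integral_current_pushforward\<close>,
  \<open>flat_dist_pushforward\<close>). This is where most of the work lies, since it involves every clause of
  the definition of an integral current. McShane extension makes bounds for the mass of a current and
  of its push-forward correspond to each other, hence also their minima, the mass measures, and then
  the sets, the restrictions and the rectifiability conditions.

  To speak about the mass at all, a least bound must exist (\<open>minimal_mass_bound_exists\<close>). Two bounds can
  be combined along any Borel set (\<open>mass_bound_split\<close>), because indicators of Borel sets are limits
  of Lipschitz functions in \<open>L\<^sup>1\<close>. So bounds are closed under minima, and a bound of
  least total mass is the least bound.

  The limit map. Flat convergence implies weak convergence, and every ball around a point of the set of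
  the limit current has positive mass. Therefore every point of the limit space is a limit of points of
  the approximating spaces (\<open>flat_limit_support_approximated\<close>). Since the mass is finite, the limit space
  is also separable (\<open>current_set_separable\<close>). These two facts are what the proof of the theorem of Arzela
  and Ascoli needs: extract a diagonal subsequence along which the values at points approximating a
  countable dense set converge, and use the common Lipschitz constant to pass to all points
  (\<open>arzela_ascoli_varying_domains\<close>).
\<close>

section \<open>Lipschitz functions and McShane extension\<close>

lemma Lipschitz_continuous_map_iff_nonneg:
  "Lipschitz_continuous_map X Y f \<longleftrightarrow> f \<in> mspace X \<rightarrow> mspace Y \<and>
     (\<exists>L\<ge>0. \<forall>x\<in>mspace X. \<forall>y\<in>mspace X. mdist Y (f x) (f y) \<le> L * mdist X x y)"
  unfolding Lipschitz_continuous_map_pos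
    by (metis Lipschitz_continuous_map_def Lipschitz_continuous_map_pos less_imp_le)

lemma mdist_self [simp]: "x \<in> mspace M \<Longrightarrow> mdist M x x = 0"
  by (rule mdist_zero[THEN iffD2]) auto

lemma Lip_nonneg:
  assumes "Lipschitz_continuous_map X Y f" shows "0 \<le> Lip X Y f"
  unfolding Lip_def
proof (rule cInf_greatest)
  show "{L. 0 \<le> L \<and> (\<forall>x\<in>mspace X. \<forall>y\<in>mspace X. mdist Y (f x) (f y) \<le> L * mdist X x y)} \<noteq> {}"
    using assms unfolding Lipschitz_continuous_map_iff_nonneg by auto
qed auto

lemma Lip_le:
  assumes "0 \<le> L" "\<And>x y. x \<in> mspace X \<Longrightarrow> y \<in> mspace X \<Longrightarrow> mdist Y (f x) (f y) \<le> L * mdist X x y"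
  shows "Lip X Y f \<le> L"
  unfolding Lip_def by (rule cInf_lower) (use assms in \<open>auto intro: bdd_belowI[of _ 0]\<close>)

lemma mdist_le_Lip:
  assumes f: "Lipschitz_continuous_map X Y f" and x: "x \<in> mspace X" and y: "y \<in> mspace X"
  shows "mdist Y (f x) (f y) \<le> Lip X Y f * mdist X x y"
proof (cases "mdist X x y = 0")
  case True
  then have "x = y" using x y by simp
  moreover have "f x \<in> mspace Y" using f x by (auto simp: Lipschitz_continuous_map_def)
  ultimately show ?thesis using \<open>x = y\<close> y by simp
next
  case False
  then have pos: "0 < mdist X x y" by (simp add: order_less_le)
  have "mdist Y (f x) (f y) / mdist X x y \<le> Lip X Y f"
    unfolding Lip_def
  proof (rule cInf_greatest)
    show "{L. 0 \<le> L \<and> (\<forall>x\<in>mspace X. \<forall>y\<in>mspace X. mdist Y (f x) (f y) \<le> L * mdist X x y)} \<noteq> {}"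
      using f unfolding Lipschitz_continuous_map_iff_nonneg by auto
  next
    fix L assume "L \<in> {L. 0 \<le> L \<and> (\<forall>x\<in>mspace X. \<forall>y\<in>mspace X. mdist Y (f x) (f y) \<le> L * mdist X x y)}"
    then show "mdist Y (f x) (f y) / mdist X x y \<le> L"
      using x y pos by (simp add: divide_le_eq)
  qed
  then show ?thesis using pos by (simp add: divide_le_eq)
qed

lemma lip_fun_iff:
  "lip_fun Z f \<longleftrightarrow> (\<exists>L\<ge>0. \<forall>x\<in>mspace Z. \<forall>y\<in>mspace Z. \<bar>f x - f y\<bar> \<le> L * mdist Z x y)"
  unfolding lip_fun_def Lipschitz_continuous_map_iff_nonneg by (simp add: dist_real_def)

lemma lip_funI:
  assumes "0 \<le> L" "\<And>x y. x \<in> mspace Z \<Longrightarrow> y \<in> mspace Z \<Longrightarrow> \<bar>f x - f y\<bar> \<le> L * mdist Z x y"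
  shows "lip_fun Z f"
  using assms unfolding lip_fun_iff by blast

lemma lip_fun_Lip:
  assumes "lip_fun Z f"
  shows "0 \<le> Lip Z euclidean_metric f"
    and "\<And>x y. x \<in> mspace Z \<Longrightarrow> y \<in> mspace Z \<Longrightarrow> \<bar>f x - f y\<bar> \<le> Lip Z euclidean_metric f * mdist Z x y"
  using Lip_nonneg[of Z euclidean_metric f] mdist_le_Lip[of Z euclidean_metric f] assms
  unfolding lip_fun_def by (auto simp: dist_real_def)

lemma Lip_real_le:
  fixes f :: "'a \<Rightarrow> real"
  assumes "0 \<le> L" "\<And>x y. x \<in> mspace Z \<Longrightarrow> y \<in> mspace Z \<Longrightarrow> \<bar>f x - f y\<bar> \<le> L * mdist Z x y"
  shows "Lip Z euclidean_metric f \<le> L"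
  using assms by (intro Lip_le) (auto simp: dist_real_def)

lemma lip_fun_const [simp]: "lip_fun Z (\<lambda>_. c)"
  by (rule lip_funI[of 0]) auto

lemma lip_fun_lincomb:
  assumes "lip_fun Z f" "lip_fun Z g" shows "lip_fun Z (\<lambda>x. a * f x + b * g x)"
proof -
  obtain K L where K: "0 \<le> K" "\<forall>x\<in>mspace Z. \<forall>y\<in>mspace Z. \<bar>f x - f y\<bar> \<le> K * mdist Z x y"
    and L: "0 \<le> L" "\<forall>x\<in>mspace Z. \<forall>y\<in>mspace Z. \<bar>g x - g y\<bar> \<le> L * mdist Z x y"
    using assms unfolding lip_fun_iff by auto
  show ?thesis
  proof (rule lip_funI[of "\<bar>a\<bar> * K + \<bar>b\<bar> * L"])
    fix x y assume xy: "x \<in> mspace Z" "y \<in> mspace Z"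
    have "\<bar>(a * f x + b * g x) - (a * f y + b * g y)\<bar> = \<bar>a * (f x - f y) + b * (g x - g y)\<bar>"
      by (simp add: algebra_simps)
    also have "\<dots> \<le> \<bar>a\<bar> * \<bar>f x - f y\<bar> + \<bar>b\<bar> * \<bar>g x - g y\<bar>"
      by (metis abs_mult abs_triangle_ineq)
    also have "\<dots> \<le> \<bar>a\<bar> * (K * mdist Z x y) + \<bar>b\<bar> * (L * mdist Z x y)"
      using K L xy by (intro add_mono mult_left_mono) auto
    finally show "\<bar>(a * f x + b * g x) - (a * f y + b * g y)\<bar> \<le> (\<bar>a\<bar> * K + \<bar>b\<bar> * L) * mdist Z x y"
      by (simp add: algebra_simps)
  qed (use K L in auto)
qed

lemma blip_fun_iff: "blip_fun Z f \<longleftrightarrow> lip_fun Z f \<and> (\<exists>B\<ge>0. \<forall>x\<in>mspace Z. \<bar>f x\<bar> \<le> B)"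
  unfolding blip_fun_def bounded_iff by simp (metis abs_ge_zero order_trans linorder_le_cases)

lemma blip_fun_const [simp]: "blip_fun Z (\<lambda>_. c)"
  unfolding blip_fun_iff by (auto intro: exI[of _ "\<bar>c\<bar>"])

lemma blip_fun_lincomb:
  assumes "blip_fun Z f" "blip_fun Z g" shows "blip_fun Z (\<lambda>x. a * f x + b * g x)"
proof -
  obtain K L where K: "0 \<le> K" "\<forall>x\<in>mspace Z. \<bar>f x\<bar> \<le> K" and L: "0 \<le> L" "\<forall>x\<in>mspace Z. \<bar>g x\<bar> \<le> L"
    using assms unfolding blip_fun_iff by auto
  have "\<forall>x\<in>mspace Z. \<bar>a * f x + b * g x\<bar> \<le> \<bar>a\<bar> * K + \<bar>b\<bar> * L"
  proof
    fix x assume "x \<in> mspace Z"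
    have "\<bar>a * f x + b * g x\<bar> \<le> \<bar>a\<bar> * \<bar>f x\<bar> + \<bar>b\<bar> * \<bar>g x\<bar>"
      by (metis abs_mult abs_triangle_ineq)
    also have "\<dots> \<le> \<bar>a\<bar> * K + \<bar>b\<bar> * L"
      using K L \<open>x \<in> mspace Z\<close> by (intro add_mono mult_left_mono) auto
    finally show "\<bar>a * f x + b * g x\<bar> \<le> \<bar>a\<bar> * K + \<bar>b\<bar> * L" .
  qed
  moreover have "0 \<le> \<bar>a\<bar> * K + \<bar>b\<bar> * L" using K L by simp
  ultimately show ?thesis
    using lip_fun_lincomb assms unfolding blip_fun_iff by blast
qed

lemma blip_fun_mult:
  assumes "blip_fun Z f" "blip_fun Z g" shows "blip_fun Z (\<lambda>x. f x * g x)"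
proof -
  obtain K L where K: "0 \<le> K" "\<forall>x\<in>mspace Z. \<bar>f x\<bar> \<le> K" and L: "0 \<le> L" "\<forall>x\<in>mspace Z. \<bar>g x\<bar> \<le> L"
    using assms unfolding blip_fun_iff by auto
  obtain K' L' where K': "0 \<le> K'" "\<forall>x\<in>mspace Z. \<forall>y\<in>mspace Z. \<bar>f x - f y\<bar> \<le> K' * mdist Z x y"
    and L': "0 \<le> L'" "\<forall>x\<in>mspace Z. \<forall>y\<in>mspace Z. \<bar>g x - g y\<bar> \<le> L' * mdist Z x y"
    using assms unfolding blip_fun_iff lip_fun_iff by auto
  have "lip_fun Z (\<lambda>x. f x * g x)"
  proof (rule lip_funI[of "K * L' + L * K'"])
    fix x y assume xy: "x \<in> mspace Z" "y \<in> mspace Z"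
    have "f x * g x - f y * g y = f x * (g x - g y) + g y * (f x - f y)" by (simp add: algebra_simps)
    then have "\<bar>f x * g x - f y * g y\<bar> \<le> \<bar>f x\<bar> * \<bar>g x - g y\<bar> + \<bar>g y\<bar> * \<bar>f x - f y\<bar>"
      by (metis abs_mult abs_triangle_ineq)
    also have "\<dots> \<le> K * (L' * mdist Z x y) + L * (K' * mdist Z x y)"
      using K L K' L' xy by (intro add_mono mult_mono) auto
    finally show "\<bar>f x * g x - f y * g y\<bar> \<le> (K * L' + L * K') * mdist Z x y"
      by (simp add: algebra_simps)
  qed (use K L K' L' in auto)
  moreover have "\<forall>x\<in>mspace Z. \<bar>f x * g x\<bar> \<le> K * L"
    using K L by (auto simp: abs_mult intro!: mult_mono)
  ultimately show ?thesis unfolding blip_fun_iff using K L by (meson mult_nonneg_nonneg)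
qed

lemma blip_fun_diff: "blip_fun Z f \<Longrightarrow> blip_fun Z g \<Longrightarrow> blip_fun Z (\<lambda>x. f x - g x)"
  using blip_fun_lincomb[of Z f g 1 "-1"] by simp

lemma lip_fun_clip:
  assumes "lip_fun Z f" shows "lip_fun Z (\<lambda>x. max (-B) (min B (f x)))"
proof -
  obtain L where L: "0 \<le> L" "\<forall>x\<in>mspace Z. \<forall>y\<in>mspace Z. \<bar>f x - f y\<bar> \<le> L * mdist Z x y"
    using assms unfolding lip_fun_iff by auto
  show ?thesis
  proof (rule lip_funI[OF L(1)])
    fix x y assume "x \<in> mspace Z" "y \<in> mspace Z"
    then have "\<bar>f x - f y\<bar> \<le> L * mdist Z x y" using L by auto
    then show "\<bar>max (-B) (min B (f x)) - max (-B) (min B (f y))\<bar> \<le> L * mdist Z x y"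
      by (auto simp: max_def min_def)
  qed
qed

lemma blip_fun_cutoff:
  assumes a: "a \<in> mspace Z" and e: "e > 0"
  obtains g where "blip_fun Z g" "\<And>x. 0 \<le> g x" "\<And>x. g x \<le> 1"
    "\<And>x. x \<in> mspace Z \<Longrightarrow> mdist Z a x \<le> e/2 \<Longrightarrow> g x = 1"
    "\<And>x. x \<in> mspace Z \<Longrightarrow> e \<le> mdist Z a x \<Longrightarrow> g x = 0"
proof -
  define g where "g x = max 0 (min 1 (2 - 2 * mdist Z a x / e))" for x
  have "lip_fun Z g"
  proof (rule lip_funI[of "2/e"])
    fix x y assume "x \<in> mspace Z" "y \<in> mspace Z"
    then have "\<bar>mdist Z a x - mdist Z a y\<bar> \<le> mdist Z x y"
      using a mdist_triangle[of a Z x y] mdist_triangle[of a Z y x] by (auto simp: mdist_commute)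
    then have "2 / e * \<bar>mdist Z a x - mdist Z a y\<bar> \<le> 2 / e * mdist Z x y"
      using e by (intro mult_left_mono) auto
    moreover have "2 / e * \<bar>mdist Z a x - mdist Z a y\<bar> = \<bar>2 * mdist Z a x / e - 2 * mdist Z a y / e\<bar>"
      using e by (subst abs_of_pos[of "2/e", symmetric]) (simp_all only: abs_mult[symmetric], simp_all add: right_diff_distrib)
    ultimately have "\<bar>2 * mdist Z a x / e - 2 * mdist Z a y / e\<bar> \<le> 2 / e * mdist Z x y"
      by linarith
    then show "\<bar>g x - g y\<bar> \<le> 2 / e * mdist Z x y"
      unfolding g_def by (auto simp: max_def min_def)
  qed (use e in auto)
  then have "blip_fun Z g" unfolding blip_fun_iff by (auto intro!: exI[of _ 1] simp: g_def)
  then show ?thesis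
    by (rule that) (use e in \<open>auto simp: g_def field_simps\<close>)
qed

text \<open>
  McShane's formula: the largest extension with the given Lipschitz constant is the infimum of the
  cones \<open>f x + L * d (x, z)\<close> with vertices at the points of the subspace. That the constant does not
  increase is what makes mass invariant under isometric embeddings.
\<close>

lemma mcshane_extension:
  assumes \<iota>: "isometric_embedding X Z \<iota>" and f: "lip_fun X f"
  obtains g where "lip_fun Z g" "\<And>x. x \<in> mspace X \<Longrightarrow> g (\<iota> x) = f x"
    "Lip Z euclidean_metric g \<le> Lip X euclidean_metric f"
proof (cases "mspace X = {}")
  case True
  show ?thesis
  proof (rule that[of "\<lambda>_. 0"])
    show "Lip Z euclidean_metric (\<lambda>_. 0::real) \<le> Lip X euclidean_metric f"
      using Lip_real_le[of 0 Z "\<lambda>_. 0"] lip_fun_Lip(1)[OF f] by simp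
  qed (use True in auto)
next
  case False
  define L where "L = Lip X euclidean_metric f"
  have L: "0 \<le> L" "\<And>x y. x \<in> mspace X \<Longrightarrow> y \<in> mspace X \<Longrightarrow> \<bar>f x - f y\<bar> \<le> L * mdist X x y"
    unfolding L_def using lip_fun_Lip[OF f] by auto
  define g where "g z = (INF x\<in>mspace X. f x + L * mdist Z (\<iota> x) z)" for z
  have \<iota>Z: "\<iota> x \<in> mspace Z" if "x \<in> mspace X" for x using \<iota> that unfolding isometric_embedding_def
    by auto
  have iso: "mdist Z (\<iota> x) (\<iota> y) = mdist X x y" if "x \<in> mspace X" "y \<in> mspace X" for x y
    using \<iota> that unfolding isometric_embedding_def by auto
  obtain x0 where x0: "x0 \<in> mspace X" using False by auto
  have bdd: "bdd_below ((\<lambda>x. f x + L * mdist Z (\<iota> x) z) ` mspace X)" if z: "z \<in> mspace Z" for z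
  proof (rule bdd_belowI2)
    fix x assume x: "x \<in> mspace X"
    have "mdist Z (\<iota> x0) (\<iota> x) \<le> mdist Z (\<iota> x0) z + mdist Z (\<iota> x) z"
      using mdist_triangle[OF \<iota>Z[OF x0] z \<iota>Z[OF x]] by (simp add: mdist_commute)
    then have "L * mdist X x0 x \<le> L * (mdist Z (\<iota> x0) z + mdist Z (\<iota> x) z)"
      using L(1) iso[OF x0 x] by (simp add: mult_left_mono)
    then show "f x0 - L * mdist Z (\<iota> x0) z \<le> f x + L * mdist Z (\<iota> x) z"
      using L(2)[OF x0 x] by (simp add: algebra_simps)
  qed
  have one: "g z - g w \<le> L * mdist Z z w" if z: "z \<in> mspace Z" and w: "w \<in> mspace Z" for z w
  proof -
    have "g z - L * mdist Z z w \<le> g w" unfolding g_def[of w]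
    proof (rule cINF_greatest[OF False])
      fix x assume x: "x \<in> mspace X"
      have "g z \<le> f x + L * mdist Z (\<iota> x) z"
        unfolding g_def by (rule cINF_lower[OF bdd[OF z] x])
      also have "\<dots> \<le> f x + L * (mdist Z (\<iota> x) w + mdist Z z w)"
        using mdist_triangle[OF \<iota>Z[OF x] w z] L(1)
          by (intro add_left_mono mult_left_mono) (auto simp: mdist_commute)
      finally show "g z - L * mdist Z z w \<le> f x + L * mdist Z (\<iota> x) w"
        by (simp add: algebra_simps)
    qed
    then show ?thesis by simp
  qed
  have lip: "\<bar>g z - g w\<bar> \<le> L * mdist Z z w" if z: "z \<in> mspace Z" and w: "w \<in> mspace Z" for z w
    using one[OF z w] one[OF w z] by (simp add: mdist_commute)
  show ?thesis
  proof (rule that[of g])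
    show "lip_fun Z g" using L(1) lip by (rule lip_funI)
    show "Lip Z euclidean_metric g \<le> Lip X euclidean_metric f"
      using L(1) lip unfolding L_def by (rule Lip_real_le)
    fix x assume x: "x \<in> mspace X"
    show "g (\<iota> x) = f x"
    proof (rule antisym)
      have "g (\<iota> x) \<le> f x + L * mdist Z (\<iota> x) (\<iota> x)"
        unfolding g_def by (rule cINF_lower[OF bdd[OF \<iota>Z[OF x]] x])
      then show "g (\<iota> x) \<le> f x" by (simp add: \<iota>Z[OF x])
      show "f x \<le> g (\<iota> x)" unfolding g_def
      proof (rule cINF_greatest[OF False])
        fix y assume y: "y \<in> mspace X"
        then show "f x \<le> f y + L * mdist Z (\<iota> y) (\<iota> x)"
          using L(2)[OF x y] iso[OF y x] by (simp add: mdist_commute)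
      qed
    qed
  qed
qed

text \<open>
  Truncating at a bound for the given function keeps the extension bounded and does not change it on
  the subspace.
\<close>

lemma bounded_mcshane_extension:
  assumes \<iota>: "isometric_embedding X Z \<iota>" and f: "blip_fun X f"
  obtains g where "blip_fun Z g" "\<And>x. x \<in> mspace X \<Longrightarrow> g (\<iota> x) = f x"
proof -
  obtain B where B: "B \<ge> 0" "\<And>x. x \<in> mspace X \<Longrightarrow> \<bar>f x\<bar> \<le> B"
    using f unfolding blip_fun_iff by auto
  obtain g where g: "lip_fun Z g" "\<And>x. x \<in> mspace X \<Longrightarrow> g (\<iota> x) = f x"
    using mcshane_extension[OF \<iota>] f unfolding blip_fun_iff by metis
  have "blip_fun Z (\<lambda>x. max (-B) (min B (g x)))"
    unfolding blip_fun_iff using lip_fun_clip[OF g(1)] B(1)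
    by (auto intro!: exI[of _ B])
  then show ?thesis by (rule that) (use g(2) B(2) in \<open>force simp: abs_le_iff\<close>)
qed

lemma isometric_embeddingD:
  assumes "isometric_embedding X Z \<iota>" "x \<in> mspace X"
  shows "\<iota> x \<in> mspace Z" "\<And>y. y \<in> mspace X \<Longrightarrow> mdist Z (\<iota> x) (\<iota> y) = mdist X x y"
  using assms unfolding isometric_embedding_def by auto

lemma isometric_embedding_compose:
  "isometric_embedding X Y f \<Longrightarrow> isometric_embedding Y Z g \<Longrightarrow> isometric_embedding X Z (g \<circ> f)"
  unfolding isometric_embedding_def by (auto simp: Pi_iff)

lemma isometric_embedding_Lipschitz:
  "isometric_embedding X Z \<iota> \<Longrightarrow> Lipschitz_continuous_map X Z \<iota>"
  unfolding isometric_embedding_def Lipschitz_continuous_map_iff_nonneg by (auto intro!: exI[of _ 1])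

lemma isometric_embedding_continuous:
  "isometric_embedding X Z \<iota> \<Longrightarrow> continuous_map (mtopology_of X) (mtopology_of Z) \<iota>"
  by (simp add: isometric_embedding_Lipschitz Lipschitz_continuous_imp_continuous_map)

lemma lip_fun_compose_isometric:
  assumes \<iota>: "isometric_embedding X Z \<iota>" and p: "lip_fun Z p"
  shows "lip_fun X (p \<circ> \<iota>)" "Lip X euclidean_metric (p \<circ> \<iota>) \<le> Lip Z euclidean_metric p"
proof -
  show "lip_fun X (p \<circ> \<iota>)"
    using Lipschitz_continuous_map_compose isometric_embedding_Lipschitz[OF \<iota>] p unfolding lip_fun_def
      by blast
  show "Lip X euclidean_metric (p \<circ> \<iota>) \<le> Lip Z euclidean_metric p"
  proof (rule Lip_real_le)
    fix x y assume "x \<in> mspace X" "y \<in> mspace X"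
    then show "\<bar>(p \<circ> \<iota>) x - (p \<circ> \<iota>) y\<bar> \<le> Lip Z euclidean_metric p * mdist X x y"
      using lip_fun_Lip(2)[OF p, of "\<iota> x" "\<iota> y"] \<iota>
        by (simp add: isometric_embedding_def Pi_iff)
  qed (rule lip_fun_Lip(1)[OF p])
qed

lemma blip_fun_compose_isometric:
  assumes \<iota>: "isometric_embedding X Z \<iota>" and p: "blip_fun Z p"
  shows "blip_fun X (p \<circ> \<iota>)"
  using lip_fun_compose_isometric(1)[OF \<iota>] p isometric_embeddingD(1)[OF \<iota>] unfolding blip_fun_iff comp_def
    by blast

lemma adm_compose_isometric:
  assumes "isometric_embedding X Z \<iota>" "adm m Z f \<pi>"
  shows "adm m X (f \<circ> \<iota>) (map (\<lambda>p. p \<circ> \<iota>) \<pi>)"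
  using assms lip_fun_compose_isometric(1)[OF assms(1)] blip_fun_compose_isometric[OF assms(1)]
  unfolding adm_def by auto

abbreviation lip_prod :: "'a metric \<Rightarrow> ('a \<Rightarrow> real) list \<Rightarrow> real" where
  "lip_prod Z \<pi> \<equiv> prod_list (map (Lip Z euclidean_metric) \<pi>)"

lemma lip_prod_nonneg:
  assumes "\<forall>p\<in>set \<pi>. lip_fun Z p"
  shows "0 \<le> lip_prod Z \<pi>"
  using assms by (induction \<pi>) (auto simp: lip_fun_Lip)

text \<open>
  Stated for two lists on two spaces, because both push-forward and extension compare the Lipschitz
  constants of functions on a space with those of functions on a subspace.
\<close>

lemma lip_prod_mono:
  assumes "list_all2 (\<lambda>p q. lip_fun X p \<and> Lip X euclidean_metric p \<le> Lip Z euclidean_metric q) \<pi> \<rho>"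
  shows "lip_prod X \<pi> \<le> lip_prod Z \<rho>"
  using assms
proof (induction rule: list_all2_induct)
  case (Cons p \<pi> q \<rho>)
  have "\<forall>p\<in>set \<pi>. lip_fun X p"
    using Cons.hyps(2) by (auto simp: list_all2_conv_all_nth in_set_conv_nth)
  with Cons show ?case
    using lip_prod_nonneg[of \<pi> X] lip_fun_Lip(1)[of X p] by (auto intro!: mult_mono)
qed auto

section \<open>Borel measures on a metric space\<close>

lemma space_borel_metric [simp]: "space (borel_metric Z) = mspace Z"
  unfolding borel_metric_def by (simp add: space_measure_of_conv)

lemma open_subset_mspace: "openin (mtopology_of Z) U \<Longrightarrow> U \<subseteq> mspace Z"
  using openin_subset[of "mtopology_of Z" U] by simp

lemma openin_mball_of: "openin (mtopology_of Z) (mball_of Z x r)"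
  by (simp add: mtopology_of_def mball_of_def Metric_space.openin_mball[OF Metric_space_mspace_mdist])

lemma openin_contains_mball_of:
  assumes "openin (mtopology_of Z) U" "x \<in> U"
  obtains r where "r > 0" "mball_of Z x r \<subseteq> U"
  using assms unfolding mtopology_of_def mball_of_def
  by (auto simp: Metric_space.openin_mtopology[OF Metric_space_mspace_mdist])

lemma sets_borel_metric: "sets (borel_metric Z) = sigma_sets (mspace Z) {U. openin (mtopology_of Z) U}"
  unfolding borel_metric_def using open_subset_mspace by (subst sets_measure_of) auto

lemma open_in_borel_metric: "openin (mtopology_of Z) U \<Longrightarrow> U \<in> sets (borel_metric Z)"
  unfolding sets_borel_metric by auto

lemma closed_in_borel_metric: "closedin (mtopology_of Z) C \<Longrightarrow> C \<in> sets (borel_metric Z)"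
proof -
  assume C: "closedin (mtopology_of Z) C"
  then have "C = space (borel_metric Z) - (mspace Z - C)"
    using closedin_subset by fastforce
  moreover have "mspace Z - C \<in> sets (borel_metric Z)"
    using C by (intro open_in_borel_metric) (auto simp: closedin_def)
  ultimately show ?thesis by (metis sets.compl_sets)
qed

lemma measurable_borel_metric:
  assumes "f \<in> space M \<rightarrow> mspace Z" "\<And>U. openin (mtopology_of Z) U \<Longrightarrow> f -` U \<inter> space M \<in> sets M"
  shows "f \<in> measurable M (borel_metric Z)"
  unfolding borel_metric_def
  using assms by (intro measurable_measure_of) (auto dest: open_subset_mspace)

lemma continuous_map_measurable:
  assumes "continuous_map (mtopology_of X) (mtopology_of Z) f"
  shows "f \<in> measurable (borel_metric X) (borel_metric Z)"
proof (rule measurable_borel_metric)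
  show "f \<in> space (borel_metric X) \<rightarrow> mspace Z"
    using assms by (auto simp: continuous_map_def)
  fix U assume "openin (mtopology_of Z) U"
  then have "openin (mtopology_of X) {x \<in> topspace (mtopology_of X). f x \<in> U}"
    using assms by (rule openin_continuous_map_preimage[rotated])
  then have "openin (mtopology_of X) (f -` U \<inter> space (borel_metric X))"
    by (simp add: vimage_def Collect_conj_eq Int_commute)
  then show "f -` U \<inter> space (borel_metric X) \<in> sets (borel_metric X)"
    by (rule open_in_borel_metric)
qed

lemma lip_fun_measurable [measurable_dest]:
  assumes "lip_fun Z f" shows "f \<in> borel_measurable (borel_metric Z)"
proof (rule borel_measurableI)
  fix S :: "real set" assume "open S"
  have "continuous_map (mtopology_of Z) euclidean f"
    using assms Lipschitz_continuous_imp_continuous_map unfolding lip_fun_def by fastforce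
  then have "openin (mtopology_of Z) {x \<in> topspace (mtopology_of Z). f x \<in> S}"
    using \<open>open S\<close> by (intro openin_continuous_map_preimage) auto
  then have "openin (mtopology_of Z) (f -` S \<inter> space (borel_metric Z))"
    by (simp add: vimage_def Collect_conj_eq Int_commute)
  then show "f -` S \<inter> space (borel_metric Z) \<in> sets (borel_metric Z)"
    by (rule open_in_borel_metric)
qed

lemma blip_fun_integrable:
  assumes "finite_measure \<mu>" "sets \<mu> = sets (borel_metric Z)" "blip_fun Z f"
  shows "integrable \<mu> f"
proof -
  interpret finite_measure \<mu> by fact
  obtain B where "\<forall>x\<in>mspace Z. \<bar>f x\<bar> \<le> B"
    using assms(3) unfolding blip_fun_iff by auto
  moreover have "space \<mu> = mspace Z" using sets_eq_imp_space_eq[OF assms(2)] by simp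
  ultimately show ?thesis
    using lip_fun_measurable assms unfolding blip_fun_iff
    by (intro integrable_const_bound[of _ B] AE_I2) (auto simp: measurable_cong_sets[OF assms(2) refl])
qed

definition finite_borel_measure :: "'a metric \<Rightarrow> 'a measure \<Rightarrow> bool" where
  "finite_borel_measure Z \<mu> \<longleftrightarrow> finite_measure \<mu> \<and> sets \<mu> = sets (borel_metric Z)"

lemma finite_borel_measure_space: "finite_borel_measure Z \<mu> \<Longrightarrow> space \<mu> = mspace Z"
  by (drule finite_borel_measure_def[THEN iffD1], drule conjunct2, drule sets_eq_imp_space_eq) simp

lemma finite_borel_measure_measurable:
  assumes "finite_borel_measure Z \<mu>" shows "(f :: 'a \<Rightarrow> 'c :: topological_space) \<in> borel_measurable \<mu> \<longleftrightarrow> f \<in> borel_measurable (borel_metric Z)"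
proof -
  have "sets \<mu> = sets (borel_metric Z)" using assms unfolding finite_borel_measure_def by simp
  then have "borel_measurable \<mu> = (borel_measurable (borel_metric Z) :: ('a \<Rightarrow> 'c) set)"
    by (rule measurable_cong_sets) simp
  then show ?thesis by simp
qed

lemma mass_bound_finite_borel_measure: "mass_bound m Z T \<mu> \<Longrightarrow> finite_borel_measure Z \<mu>"
  unfolding mass_bound_def finite_borel_measure_def by simp

lemma finite_borel_measure_integrable:
  fixes f :: "'a \<Rightarrow> real"
  assumes \<mu>: "finite_borel_measure Z \<mu>" and "f \<in> borel_measurable (borel_metric Z)"
    and "\<And>x. x \<in> mspace Z \<Longrightarrow> \<bar>f x\<bar> \<le> B"
  shows "integrable \<mu> f"
proof -
  interpret finite_measure \<mu> using \<mu> by (simp add: finite_borel_measure_def)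
  show ?thesis
    using assms by (intro integrable_const_bound[of _ B] AE_I2)
      (auto simp: finite_borel_measure_space finite_borel_measure_measurable)
qed

lemma blip_fun_measurable: "blip_fun Z f \<Longrightarrow> f \<in> borel_measurable (borel_metric Z)"
  by (simp add: blip_fun_def lip_fun_measurable)

section \<open>Lipschitz approximation of Borel sets\<close>

text \<open>
  Approximation in \<open>L\<^sup>1\<close> by one function for two measures at once: the functional is
  to be cut into two pieces, each of which is estimated by its own measure.
\<close>

definition lip_approximable :: "'a metric \<Rightarrow> 'a measure \<Rightarrow> 'a measure \<Rightarrow> 'a set \<Rightarrow> bool" where
  "lip_approximable Z \<mu> \<nu> A \<longleftrightarrow> (\<forall>e>0. \<exists>g. blip_fun Z g \<and> (\<forall>x. 0 \<le> g x \<and> g x \<le> 1) \<and>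
     (LINT x|\<mu>. \<bar>g x - indicator A x\<bar>) < e \<and> (LINT x|\<nu>. \<bar>g x - indicator A x\<bar>) < e)"

text \<open>
  With \<open>\<delta>\<close> the distance to the complement, the truncations \<open>min 1 (n * \<delta>)\<close> increase to the
  indicator of the open set, because \<open>\<delta>\<close> is positive on it. If the complement is empty there is no
  distance to it, and the constant \<open>1\<close> serves.
\<close>

lemma open_pointwise_lip_limit:
  assumes U: "openin (mtopology_of Z) U"
  obtains g :: "nat \<Rightarrow> 'a \<Rightarrow> real" where "\<And>n. blip_fun Z (g n)" "\<And>n x. 0 \<le> g n x \<and> g n x \<le> 1"
    "\<And>x. x \<in> mspace Z \<Longrightarrow> (\<lambda>n. g n x) \<longlonglongrightarrow> indicator U x"
proof (cases "U = mspace Z")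
  case True
  show ?thesis
    by (rule that[of "\<lambda>_ _. 1"]) (auto simp: True)
next
  case False
  define C where "C = mspace Z - U"
  have C: "C \<noteq> {}" "C \<subseteq> mspace Z"
    using False open_subset_mspace[OF U] by (auto simp: C_def)
  define \<delta> where "\<delta> x = (INF c\<in>C. mdist Z x c)" for x
  have bdd: "bdd_below (mdist Z x ` C)" for x by (auto intro: bdd_belowI[of _ 0])
  have \<delta>0: "0 \<le> \<delta> x" for x unfolding \<delta>_def using C by (intro cINF_greatest) auto
  have one: "\<delta> x - mdist Z x y \<le> \<delta> y" if "x \<in> mspace Z" "y \<in> mspace Z" for x y
    unfolding \<delta>_def[of y]
  proof (rule cINF_greatest[OF C(1)])
    fix c assume c: "c \<in> C"
    have "\<delta> x \<le> mdist Z x c" unfolding \<delta>_def by (rule cINF_lower[OF bdd c])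
    also have "\<dots> \<le> mdist Z x y + mdist Z y c" using that c C by (intro mdist_triangle) auto
    finally show "\<delta> x - mdist Z x y \<le> mdist Z y c" by simp
  qed
  have \<delta>lip: "\<bar>\<delta> x - \<delta> y\<bar> \<le> mdist Z x y" if "x \<in> mspace Z" "y \<in> mspace Z" for x y
    using one[of x y] one[of y x] that by (simp add: mdist_commute)
  have \<delta>pos: "0 < \<delta> x" if x: "x \<in> U" for x
  proof -
    obtain r where r: "r > 0" "mball_of Z x r \<subseteq> U"
      using openin_contains_mball_of[OF U x] by blast
    have "r \<le> \<delta> x" unfolding \<delta>_def
    proof (rule cINF_greatest[OF C(1)])
      fix c assume "c \<in> C"
      then have "c \<notin> mball_of Z x r" "c \<in> mspace Z" using r(2) unfolding C_def by auto
      then show "r \<le> mdist Z x c" using x open_subset_mspace[OF U] by auto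
    qed
    with r show ?thesis by simp
  qed
  define g where "g n x = min 1 (real n * \<delta> x)" for n x
  show ?thesis
  proof (rule that[of g])
    show range: "0 \<le> g n x \<and> g n x \<le> 1" for n x using \<delta>0 by (simp add: g_def)
    have "lip_fun Z (g n)" for n
    proof (rule lip_funI[of "real n"])
      fix x y assume "x \<in> mspace Z" "y \<in> mspace Z"
      then have "real n * \<bar>\<delta> x - \<delta> y\<bar> \<le> real n * mdist Z x y"
        by (intro mult_left_mono \<delta>lip) auto
      moreover have "real n * \<bar>\<delta> x - \<delta> y\<bar> = \<bar>real n * \<delta> x - real n * \<delta> y\<bar>"
        by (simp add: abs_mult flip: right_diff_distrib)
      ultimately show "\<bar>g n x - g n y\<bar> \<le> real n * mdist Z x y" by (auto simp: g_def min_def)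
    qed auto
    then show "blip_fun Z (g n)" for n
      unfolding blip_fun_iff using range by (auto intro!: exI[of _ 1])
    fix x assume x: "x \<in> mspace Z"
    show "(\<lambda>n. g n x) \<longlonglongrightarrow> indicator U x"
    proof (cases "x \<in> U")
      case True
      obtain N where N: "1 / \<delta> x < real N" using reals_Archimedean2 by blast
      have "g n x = 1" if "n \<ge> N" for n
      proof -
        have "1 / \<delta> x < real n" using N that by linarith
        then show ?thesis using \<delta>pos[OF True] by (simp add: g_def field_simps)
      qed
      then show ?thesis
        using True by (auto intro!: tendsto_eventually eventually_sequentiallyI[of N])
    next
      case False
      then have "x \<in> C" using x by (simp add: C_def)
      then have "\<delta> x \<le> 0"
        using cINF_lower[OF bdd[of x] \<open>x \<in> C\<close>] x by (simp add: \<delta>_def)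
      then have "\<delta> x = 0" using \<delta>0 by (rule antisym)
      then show ?thesis using False by (simp add: g_def)
    qed
  qed
qed

lemma approx_error_integrable:
  assumes "blip_fun Z g" "A \<in> sets (borel_metric Z)" "finite_borel_measure Z \<kappa>"
  shows "integrable \<kappa> (\<lambda>x. \<bar>g x - indicator A x\<bar>)"
proof -
  obtain B where B: "\<forall>x\<in>mspace Z. \<bar>g x\<bar> \<le> B"
    using assms(1) unfolding blip_fun_iff by auto
  have [measurable]: "g \<in> borel_measurable (borel_metric Z)" by (rule blip_fun_measurable[OF assms(1)])
  note assms(2)[measurable]
  show ?thesis
    by (rule finite_borel_measure_integrable[OF assms(3), of _ "B + 1"])
       (use B in \<open>auto simp: indicator_def abs_if split: if_splits\<close>)
qed

context
  fixes Z :: "'a metric" and \<mu> \<nu> :: "'a measure"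
  assumes \<mu>: "finite_borel_measure Z \<mu>" and \<nu>: "finite_borel_measure Z \<nu>"
begin

lemma lip_approximable_open:
  assumes U: "openin (mtopology_of Z) U"
  shows "lip_approximable Z \<mu> \<nu> U"
proof -
  obtain g :: "nat \<Rightarrow> 'a \<Rightarrow> real" where g: "\<And>n. blip_fun Z (g n)" "\<And>n x. 0 \<le> g n x \<and> g n x \<le> 1"
    "\<And>x. x \<in> mspace Z \<Longrightarrow> (\<lambda>n. g n x) \<longlonglongrightarrow> indicator U x"
    using open_pointwise_lip_limit[OF U] by metis
  have [measurable]: "U \<in> sets (borel_metric Z)" by (rule open_in_borel_metric[OF U])
  have [measurable]: "g n \<in> borel_measurable (borel_metric Z)" for n
    by (rule blip_fun_measurable[OF g(1)])
  have lim: "(\<lambda>n. LINT x|\<kappa>. \<bar>g n x - indicator U x\<bar>) \<longlonglongrightarrow> 0" if \<kappa>: "finite_borel_measure Z \<kappa>" for \<kappa>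
  proof -
    have "(\<lambda>n. LINT x|\<kappa>. \<bar>g n x - indicator U x\<bar>) \<longlonglongrightarrow> (LINT x|\<kappa>. 0)"
    proof (rule integral_dominated_convergence[where w = "\<lambda>_. 1"])
      show "integrable \<kappa> (\<lambda>_. 1::real)"
        by (rule finite_borel_measure_integrable[OF \<kappa>, of _ 1]) auto
      show "AE x in \<kappa>. (\<lambda>n. \<bar>g n x - indicator U x\<bar>) \<longlonglongrightarrow> 0"
        using tendsto_rabs_zero[OF LIM_zero[OF g(3)]]
          by (intro AE_I2) (simp add: finite_borel_measure_space[OF \<kappa>])
      show "AE x in \<kappa>. norm \<bar>g n x - indicator U x\<bar> \<le> 1" for n
      proof (rule AE_I2)
        show "norm \<bar>g n x - indicator U x\<bar> \<le> 1" for x using g(2)[of n x]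
          by (auto simp: indicator_def)
      qed
    qed (auto simp: finite_borel_measure_measurable[OF \<kappa>])
    then show ?thesis by simp
  qed
  show ?thesis unfolding lip_approximable_def
  proof (intro allI impI)
    fix e :: real assume "e > 0"
    then have "\<forall>\<^sub>F n in sequentially. (LINT x|\<mu>. \<bar>g n x - indicator U x\<bar>) < e \<and> (LINT x|\<nu>. \<bar>g n x - indicator U x\<bar>) < e"
      using lim[OF \<mu>] lim[OF \<nu>] by (intro eventually_conj order_tendstoD)
    then obtain n where "(LINT x|\<mu>. \<bar>g n x - indicator U x\<bar>) < e \<and> (LINT x|\<nu>. \<bar>g n x - indicator U x\<bar>) < e"
      by (auto simp: eventually_sequentially)
    then show "\<exists>g. blip_fun Z g \<and> (\<forall>x. 0 \<le> g x \<and> g x \<le> 1) \<and>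
         (LINT x|\<mu>. \<bar>g x - indicator U x\<bar>) < e \<and> (LINT x|\<nu>. \<bar>g x - indicator U x\<bar>) < e"
      using g by blast
  qed
qed

lemma lip_approximable_compl:
  assumes "lip_approximable Z \<mu> \<nu> A"
  shows "lip_approximable Z \<mu> \<nu> (mspace Z - A)"
  unfolding lip_approximable_def
proof (intro allI impI)
  fix e :: real assume "e > 0"
  then obtain g where g: "blip_fun Z g" "\<forall>x. 0 \<le> g x \<and> g x \<le> 1"
     "(LINT x|\<mu>. \<bar>g x - indicator A x\<bar>) < e" "(LINT x|\<nu>. \<bar>g x - indicator A x\<bar>) < e"
    using assms unfolding lip_approximable_def by blast
  have "(LINT x|\<kappa>. \<bar>(1 - g x) - indicator (mspace Z - A) x\<bar>) = (LINT x|\<kappa>. \<bar>g x - indicator A x\<bar>)"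
    if "finite_borel_measure Z \<kappa>" for \<kappa>
    by (rule Bochner_Integration.integral_cong) (auto simp: finite_borel_measure_space[OF that] indicator_def)
  moreover have "blip_fun Z (\<lambda>x. 1 - g x)" using blip_fun_diff[OF blip_fun_const g(1)] .
  ultimately show "\<exists>h. blip_fun Z h \<and> (\<forall>x. 0 \<le> h x \<and> h x \<le> 1) \<and>
         (LINT x|\<mu>. \<bar>h x - indicator (mspace Z - A) x\<bar>) < e \<and> (LINT x|\<nu>. \<bar>h x - indicator (mspace Z - A) x\<bar>) < e"
    using g \<mu> \<nu> by (intro exI[of _ "\<lambda>x. 1 - g x"]) auto
qed

text \<open>
  The indicator of a union is \<open>1 - (1 - 1\<^sub>A) (1 - 1\<^sub>B)\<close>, an expression that preserves
  bounded Lipschitz functions with values between \<open>0\<close> and \<open>1\<close>.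
\<close>

lemma lip_approximable_Un:
  assumes A: "lip_approximable Z \<mu> \<nu> A" "A \<in> sets (borel_metric Z)"
    and B: "lip_approximable Z \<mu> \<nu> B" "B \<in> sets (borel_metric Z)"
  shows "lip_approximable Z \<mu> \<nu> (A \<union> B)"
  unfolding lip_approximable_def
proof (intro allI impI)
  fix e :: real assume "e > 0"
  then have e2: "e / 2 > 0" by simp
  obtain g where g: "blip_fun Z g" "\<And>x. 0 \<le> g x \<and> g x \<le> 1"
     "(LINT x|\<mu>. \<bar>g x - indicator A x\<bar>) < e/2" "(LINT x|\<nu>. \<bar>g x - indicator A x\<bar>) < e/2"
    using A(1) e2 unfolding lip_approximable_def by meson
  obtain h where h: "blip_fun Z h" "\<And>x. 0 \<le> h x \<and> h x \<le> 1"
     "(LINT x|\<mu>. \<bar>h x - indicator B x\<bar>) < e/2" "(LINT x|\<nu>. \<bar>h x - indicator B x\<bar>) < e/2"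
    using B(1) e2 unfolding lip_approximable_def by meson
  define k where "k x = 1 - (1 - g x) * (1 - h x)" for x
  have k: "blip_fun Z k"
    unfolding k_def by (intro blip_fun_diff blip_fun_mult blip_fun_const g h)
  have k01: "0 \<le> k x \<and> k x \<le> 1" for x
    using g(2)[of x] h(2)[of x] mult_mono[of "1 - g x" 1 "1 - h x" 1] by (simp add: k_def)
  have pt: "\<bar>k x - indicator (A \<union> B) x\<bar> \<le> \<bar>g x - indicator A x\<bar> + \<bar>h x - indicator B x\<bar>" for x
  proof -
    have "\<bar>(1 - g x) * (1 - h x) - 0\<bar> \<le> 1 - g x" "\<bar>(1 - g x) * (1 - h x) - 0\<bar> \<le> 1 - h x"
      using g(2)[of x] h(2)[of x] mult_mono[of "1 - g x" "1 - g x" "1 - h x" 1] mult_mono[of "1 - g x" 1 "1 - h x" "1 - h x"]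
      by auto
    moreover have "k x \<le> g x + h x" using g(2)[of x] h(2)[of x] by (simp add: k_def algebra_simps)
    ultimately show ?thesis using g(2)[of x] h(2)[of x] k01[of x]
      by (auto simp: k_def indicator_def)
  qed
  have bound: "(LINT x|\<kappa>. \<bar>k x - indicator (A \<union> B) x\<bar>) < e"
    if \<kappa>: "finite_borel_measure Z \<kappa>" "(LINT x|\<kappa>. \<bar>g x - indicator A x\<bar>) < e/2" "(LINT x|\<kappa>. \<bar>h x - indicator B x\<bar>) < e/2" for \<kappa>
  proof -
    have "(LINT x|\<kappa>. \<bar>k x - indicator (A \<union> B) x\<bar>) \<le> (LINT x|\<kappa>. \<bar>g x - indicator A x\<bar> + \<bar>h x - indicator B x\<bar>)"
      using A(2) B(2) k g h \<kappa>(1)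
        by (intro integral_mono pt approx_error_integrable Bochner_Integration.integrable_add) auto
    also have "\<dots> = (LINT x|\<kappa>. \<bar>g x - indicator A x\<bar>) + (LINT x|\<kappa>. \<bar>h x - indicator B x\<bar>)"
      using A(2) B(2) g h \<kappa>(1)
        by (intro Bochner_Integration.integral_add approx_error_integrable) auto
    finally show ?thesis using \<kappa>(2,3) by simp
  qed
  show "\<exists>k. blip_fun Z k \<and> (\<forall>x. 0 \<le> k x \<and> k x \<le> 1) \<and>
         (LINT x|\<mu>. \<bar>k x - indicator (A \<union> B) x\<bar>) < e \<and> (LINT x|\<nu>. \<bar>k x - indicator (A \<union> B) x\<bar>) < e"
    using k k01 bound[OF \<mu> g(3) h(3)] bound[OF \<nu> g(4) h(4)] by blast
qed

text \<open>
  By continuity of finite measures from below, a late member of the sequence already approximates the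
  union.
\<close>

lemma lip_approximable_incseq:
  fixes A :: "nat \<Rightarrow> 'a set"
  assumes A: "\<And>n. lip_approximable Z \<mu> \<nu> (A n)" "\<And>n. A n \<in> sets (borel_metric Z)" "incseq A"
  shows "lip_approximable Z \<mu> \<nu> (\<Union>n. A n)"
  unfolding lip_approximable_def
proof (intro allI impI)
  fix e :: real assume "e > 0"
  then have e2: "e / 2 > 0" by simp
  let ?A = "\<Union>n. A n"
  have lim: "(\<lambda>n. measure \<kappa> (?A - A n)) \<longlonglongrightarrow> 0" if \<kappa>: "finite_borel_measure Z \<kappa>" for \<kappa>
  proof -
    interpret finite_measure \<kappa> using \<kappa> by (simp add: finite_borel_measure_def)
    have s: "sets \<kappa> = sets (borel_metric Z)" using \<kappa> by (simp add: finite_borel_measure_def)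
    have "(\<lambda>n. measure \<kappa> (?A - A n)) \<longlonglongrightarrow> measure \<kappa> (\<Inter>n. ?A - A n)"
      using A(2,3) by (intro finite_Lim_measure_decseq) (auto simp: s decseq_def incseq_def)
    moreover have "(\<Inter>n. ?A - A n) = {}" by auto
    ultimately show ?thesis by simp
  qed
  have "\<forall>\<^sub>F n in sequentially. measure \<mu> (?A - A n) < e/2 \<and> measure \<nu> (?A - A n) < e/2"
    using lim[OF \<mu>] lim[OF \<nu>] e2 by (intro eventually_conj order_tendstoD)
  then obtain n where n: "measure \<mu> (?A - A n) < e/2" "measure \<nu> (?A - A n) < e/2"
    by (auto simp: eventually_sequentially)
  obtain g where g: "blip_fun Z g" "\<And>x. 0 \<le> g x \<and> g x \<le> 1"
     "(LINT x|\<mu>. \<bar>g x - indicator (A n) x\<bar>) < e/2" "(LINT x|\<nu>. \<bar>g x - indicator (A n) x\<bar>) < e/2"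
    using A(1)[of n] e2 unfolding lip_approximable_def by meson
  have mA: "?A \<in> sets (borel_metric Z)" "?A - A n \<in> sets (borel_metric Z)" using A(2) by auto
  have bound: "(LINT x|\<kappa>. \<bar>g x - indicator ?A x\<bar>) < e"
    if \<kappa>: "finite_borel_measure Z \<kappa>" "(LINT x|\<kappa>. \<bar>g x - indicator (A n) x\<bar>) < e/2" "measure \<kappa> (?A - A n) < e/2" for \<kappa>
  proof -
    interpret finite_measure \<kappa> using \<kappa> by (simp add: finite_borel_measure_def)
    have s: "sets \<kappa> = sets (borel_metric Z)" using \<kappa> by (simp add: finite_borel_measure_def)
    have pt: "\<bar>g x - indicator ?A x\<bar> \<le> \<bar>g x - indicator (A n) x\<bar> + indicator (?A - A n) x" for x
      by (auto simp: indicator_def)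
    have int: "integrable \<kappa> (indicator (?A - A n) :: 'a \<Rightarrow> real)"
      using mA s by (auto intro!: integrable_real_indicator emeasure_finite simp: less_top[symmetric])
    have "(LINT x|\<kappa>. \<bar>g x - indicator ?A x\<bar>) \<le> (LINT x|\<kappa>. \<bar>g x - indicator (A n) x\<bar> + indicator (?A - A n) x)"
      using A(2) mA g int \<kappa>(1)
        by (intro integral_mono pt approx_error_integrable Bochner_Integration.integrable_add) auto
    also have "\<dots> = (LINT x|\<kappa>. \<bar>g x - indicator (A n) x\<bar>) + (LINT x|\<kappa>. indicator (?A - A n) x)"
      using A(2) g int \<kappa>(1) by (intro Bochner_Integration.integral_add approx_error_integrable) auto
    also have "(LINT x|\<kappa>. indicator (?A - A n) x) = measure \<kappa> (?A - A n)"
      using mA s by simp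
    finally show ?thesis using \<kappa>(2,3) by simp
  qed
  show "\<exists>k. blip_fun Z k \<and> (\<forall>x. 0 \<le> k x \<and> k x \<le> 1) \<and>
         (LINT x|\<mu>. \<bar>k x - indicator ?A x\<bar>) < e \<and> (LINT x|\<nu>. \<bar>k x - indicator ?A x\<bar>) < e"
    using g(1,2) bound[OF \<mu> g(3) n(1)] bound[OF \<nu> g(4) n(2)] by blast
qed

text \<open>
  The approximable sets contain the open sets and are closed under complements, finite unions and
  increasing unions, hence are all Borel sets.
\<close>

lemma borel_lip_approximable:
  assumes "A \<in> sets (borel_metric Z)"
  shows "lip_approximable Z \<mu> \<nu> A"
proof -
  have "A \<in> sigma_sets (mspace Z) {U. openin (mtopology_of Z) U}"
    using assms by (simp add: sets_borel_metric)
  then show ?thesis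
  proof (induction rule: sigma_sets.induct)
    case (Basic U)
    then show ?case by (simp add: lip_approximable_open)
  next
    case Empty
    then show ?case by (simp add: lip_approximable_open)
  next
    case (Compl A)
    then show ?case by (simp add: lip_approximable_compl)
  next
    case (Union A)
    have s: "A i \<in> sets (borel_metric Z)" for i using Union(1) by (simp add: sets_borel_metric)
    have fin: "lip_approximable Z \<mu> \<nu> (\<Union>i\<le>n. A i) \<and> (\<Union>i\<le>n. A i) \<in> sets (borel_metric Z)" for n
    proof (induction n)
      case 0
      then show ?case using Union s by simp
    next
      case (Suc n)
      then show ?case using lip_approximable_Un[of "A (Suc n)" "\<Union>i\<le>n. A i"] Union s
        by (simp add: atMost_Suc)
    qed
    have "lip_approximable Z \<mu> \<nu> (\<Union>n. \<Union>i\<le>n. A i)"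
      by (rule lip_approximable_incseq) (use fin in \<open>auto simp: incseq_def\<close>, force)
    moreover have "(\<Union>n. \<Union>i\<le>n. A i) = (\<Union>n. A n)" by auto
    ultimately show ?case by simp
  qed
qed

end

section \<open>Existence of the mass measure\<close>

text \<open>
  The property from which the mass measure is constructed. It is shared by currents and their
  boundaries, so that the masses of both are treated at once.
\<close>

definition additive_functional :: "nat \<Rightarrow> 'a metric \<Rightarrow> 'a current \<Rightarrow> bool" where
  "additive_functional m Z T \<longleftrightarrow>
     (\<forall>f g \<pi>. adm m Z f \<pi> \<and> adm m Z g \<pi> \<longrightarrow> T (\<lambda>x. f x + g x) \<pi> = T f \<pi> + T g \<pi>)"

lemma mass_boundD:
  assumes "mass_bound m Z T \<mu>" "adm m Z f \<pi>"
  shows "\<bar>T f \<pi>\<bar> \<le> lip_prod Z \<pi> * (LINT x|\<mu>. \<bar>f x\<bar>)"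
  using assms unfolding mass_bound_def by blast

lemma adm_blip: "adm m Z f \<pi> \<Longrightarrow> blip_fun Z f"
  by (simp add: adm_def)

lemma adm_cong_fun: "adm m Z f \<pi> \<Longrightarrow> blip_fun Z g \<Longrightarrow> adm m Z g \<pi>"
  by (simp add: adm_def)

lemma adm_lip_prod_nonneg: "adm m Z f \<pi> \<Longrightarrow> 0 \<le> lip_prod Z \<pi>"
  by (simp add: adm_def lip_prod_nonneg)

text \<open>
  Two bounds can be combined along any Borel set: write \<open>f = f g + f (1 - g)\<close> with a Lipschitz
  function \<open>g\<close> close to the indicator of \<open>Y\<close>, estimate the first piece
    by \<open>\<nu>\<close> and the second by
  \<open>\<mu>\<close>, and let \<open>g\<close> tend to the indicator.
\<close>

lemma mass_bound_split:
  assumes T: "additive_functional m Z T" and \<mu>: "mass_bound m Z T \<mu>" and \<nu>: "mass_bound m Z T \<nu>"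
    and Y: "Y \<in> sets (borel_metric Z)" and f: "adm m Z f \<pi>"
  shows "\<bar>T f \<pi>\<bar> \<le> lip_prod Z \<pi> *
     ((LINT x|\<nu>. indicator Y x * \<bar>f x\<bar>) + (LINT x|\<mu>. (1 - indicator Y x) * \<bar>f x\<bar>))"
proof -
  define C where "C = lip_prod Z \<pi>"
  have C: "0 \<le> C" using adm_lip_prod_nonneg[OF f] by (simp add: C_def)
  have b\<mu>: "finite_borel_measure Z \<mu>" and b\<nu>: "finite_borel_measure Z \<nu>"
    using \<mu> \<nu> mass_bound_finite_borel_measure by auto
  obtain B where B: "0 \<le> B" "\<And>x. x \<in> mspace Z \<Longrightarrow> \<bar>f x\<bar> \<le> B"
    using adm_blip[OF f] unfolding blip_fun_iff by auto
  have fm[measurable]: "f \<in> borel_measurable (borel_metric Z)"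
    by (rule blip_fun_measurable[OF adm_blip[OF f]])
  note Y[measurable]
  let ?R = "(LINT x|\<nu>. indicator Y x * \<bar>f x\<bar>) + (LINT x|\<mu>. (1 - indicator Y x) * \<bar>f x\<bar>)"
  have intY: "integrable \<kappa> (\<lambda>x. indicator Y x * \<bar>f x\<bar>)" "integrable \<kappa> (\<lambda>x. (1 - indicator Y x) * \<bar>f x\<bar>)"
    if "finite_borel_measure Z \<kappa>" for \<kappa>
    by (rule finite_borel_measure_integrable[OF that, of _ B]; use B in \<open>auto simp: indicator_def\<close>)+
  have main: "\<bar>T f \<pi>\<bar> \<le> C * ?R + 2 * C * B * e" if e: "e > 0" for e :: real
  proof -
    obtain g where g: "blip_fun Z g" "\<And>x. 0 \<le> g x \<and> g x \<le> 1"
      "(LINT x|\<mu>. \<bar>g x - indicator Y x\<bar>) < e" "(LINT x|\<nu>. \<bar>g x - indicator Y x\<bar>) < e"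
      using borel_lip_approximable[OF b\<mu> b\<nu> Y] e unfolding lip_approximable_def by meson
    have g': "blip_fun Z (\<lambda>x. 1 - g x)" by (rule blip_fun_diff[OF blip_fun_const g(1)])
    have fg: "adm m Z (\<lambda>x. f x * g x) \<pi>" "adm m Z (\<lambda>x. f x * (1 - g x)) \<pi>"
      using f g g' by (auto intro!: adm_cong_fun[OF f] blip_fun_mult adm_blip[OF f])
    have err: "integrable \<kappa> (\<lambda>x. \<bar>g x - indicator Y x\<bar>)" if "finite_borel_measure Z \<kappa>" for \<kappa>
      by (rule approx_error_integrable[OF g(1) Y that])
    \<comment> \<open>Replacing g by the indicator costs at most the bound of f times the approximation error.\<close>
    have p1: "\<bar>f x * g x\<bar> \<le> indicator Y x * \<bar>f x\<bar> + B * \<bar>g x - indicator Y x\<bar>" if "x \<in> mspace Z" for x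
    proof -
      have "\<bar>f x * g x\<bar> = indicator Y x * \<bar>f x\<bar> + \<bar>f x\<bar> * (g x - indicator Y x)"
        using g(2)[of x] by (simp add: abs_mult algebra_simps)
      also have "\<dots> \<le> indicator Y x * \<bar>f x\<bar> + B * \<bar>g x - indicator Y x\<bar>"
        using B(2)[OF that] by (intro add_left_mono order_trans[OF mult_left_mono[OF abs_ge_self] mult_right_mono]) auto
      finally show ?thesis .
    qed
    have p2: "\<bar>f x * (1 - g x)\<bar> \<le> (1 - indicator Y x) * \<bar>f x\<bar> + B * \<bar>g x - indicator Y x\<bar>" if "x \<in> mspace Z" for x
    proof -
      have "\<bar>f x * (1 - g x)\<bar> = \<bar>f x\<bar> * (1 - g x)"
        using g(2)[of x] by (simp add: abs_mult)
      also have "\<dots> = (1 - indicator Y x) * \<bar>f x\<bar> + \<bar>f x\<bar> * (indicator Y x - g x)"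
        by (simp add: algebra_simps)
      also have "\<dots> \<le> (1 - indicator Y x) * \<bar>f x\<bar> + B * \<bar>indicator Y x - g x\<bar>"
        using B(2)[OF that] by (intro add_left_mono order_trans[OF mult_left_mono[OF abs_ge_self] mult_right_mono]) auto
      finally show ?thesis by (simp add: abs_minus_commute)
    qed
    have i1: "(LINT x|\<nu>. \<bar>f x * g x\<bar>) \<le> (LINT x|\<nu>. indicator Y x * \<bar>f x\<bar>) + B * e"
    proof -
      have "(LINT x|\<nu>. \<bar>f x * g x\<bar>) \<le> (LINT x|\<nu>. indicator Y x * \<bar>f x\<bar> + B * \<bar>g x - indicator Y x\<bar>)"
        using \<nu> fg(1) by (intro integral_mono_AE AE_I2 integrable_abs Bochner_Integration.integrable_add intY
            integrable_mult_right err b\<nu> p1 blip_fun_integrable[of _ Z] adm_blip) (auto simp: mass_bound_def)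
      also have "\<dots> = (LINT x|\<nu>. indicator Y x * \<bar>f x\<bar>) + B * (LINT x|\<nu>. \<bar>g x - indicator Y x\<bar>)"
        using intY[OF b\<nu>] err[OF b\<nu>] by simp
      also have "\<dots> \<le> (LINT x|\<nu>. indicator Y x * \<bar>f x\<bar>) + B * e"
        using g(4) B(1) by (auto intro: mult_left_mono)
      finally show ?thesis .
    qed
    have i2: "(LINT x|\<mu>. \<bar>f x * (1 - g x)\<bar>) \<le> (LINT x|\<mu>. (1 - indicator Y x) * \<bar>f x\<bar>) + B * e"
    proof -
      have "(LINT x|\<mu>. \<bar>f x * (1 - g x)\<bar>) \<le> (LINT x|\<mu>. (1 - indicator Y x) * \<bar>f x\<bar> + B * \<bar>g x - indicator Y x\<bar>)"
        using \<mu> fg(2) by (intro integral_mono_AE AE_I2 integrable_abs Bochner_Integration.integrable_add intY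
            integrable_mult_right err b\<mu> p2 blip_fun_integrable[of _ Z] adm_blip) (auto simp: mass_bound_def)
      also have "\<dots> = (LINT x|\<mu>. (1 - indicator Y x) * \<bar>f x\<bar>) + B * (LINT x|\<mu>. \<bar>g x - indicator Y x\<bar>)"
        using intY[OF b\<mu>] err[OF b\<mu>] by simp
      also have "\<dots> \<le> (LINT x|\<mu>. (1 - indicator Y x) * \<bar>f x\<bar>) + B * e"
        using g(3) B(1) by (auto intro: mult_left_mono)
      finally show ?thesis .
    qed
    have "T f \<pi> = T (\<lambda>x. f x * g x + f x * (1 - g x)) \<pi>" by (simp add: algebra_simps)
    also have "\<dots> = T (\<lambda>x. f x * g x) \<pi> + T (\<lambda>x. f x * (1 - g x)) \<pi>"
      using T fg unfolding additive_functional_def by blast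
    finally have "\<bar>T f \<pi>\<bar> \<le> \<bar>T (\<lambda>x. f x * g x) \<pi>\<bar> + \<bar>T (\<lambda>x. f x * (1 - g x)) \<pi>\<bar>"
      by linarith
    also have "\<dots> \<le> C * (LINT x|\<nu>. \<bar>f x * g x\<bar>) + C * (LINT x|\<mu>. \<bar>f x * (1 - g x)\<bar>)"
      unfolding C_def by (intro add_mono mass_boundD[OF \<nu> fg(1)] mass_boundD[OF \<mu> fg(2)])
    also have "\<dots> \<le> C * ((LINT x|\<nu>. indicator Y x * \<bar>f x\<bar>) + B * e) + C * ((LINT x|\<mu>. (1 - indicator Y x) * \<bar>f x\<bar>) + B * e)"
      by (intro add_mono mult_left_mono i1 i2 C)
    also have "\<dots> = C * ?R + 2 * C * B * e" by (simp add: algebra_simps)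
    finally show ?thesis .
  qed
  have "\<bar>T f \<pi>\<bar> \<le> C * ?R"
  proof (rule field_le_epsilon)
    fix e :: real assume e: "e > 0"
    define d where "d = e / (2 * C * B + 1)"
    have pos: "2 * C * B + 1 > 0" using C B(1) by (simp add: add_nonneg_pos)
    then have d: "d > 0" using e by (simp add: d_def)
    have "2 * C * B * d \<le> (2 * C * B + 1) * d" using d by (simp add: algebra_simps)
    also have "\<dots> = e" using pos by (simp add: d_def)
    finally show "\<bar>T f \<pi>\<bar> \<le> C * ?R + e" using main[OF d] by linarith
  qed
  then show ?thesis by (simp add: C_def)
qed

lemma integrable_mult_bounded:
  fixes u g :: "'a \<Rightarrow> real"
  assumes \<mu>: "finite_borel_measure Z \<mu>" and u: "integrable \<mu> u"
    and g: "g \<in> borel_measurable (borel_metric Z)" "\<And>x. x \<in> mspace Z \<Longrightarrow> \<bar>g x\<bar> \<le> B"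
  shows "integrable \<mu> (\<lambda>x. u x * g x)"
proof (rule Bochner_Integration.integrable_bound[of _ "\<lambda>x. B * u x"])
  show "integrable \<mu> (\<lambda>x. B * u x)" using u by simp
  have "g \<in> borel_measurable \<mu>" using g(1) finite_borel_measure_measurable[OF \<mu>] by blast
  then show "(\<lambda>x. u x * g x) \<in> borel_measurable \<mu>" using u by simp
  show "AE x in \<mu>. norm (u x * g x) \<le> norm (B * u x)"
  proof (rule AE_I2)
    fix x assume "x \<in> space \<mu>"
    then have "\<bar>g x\<bar> \<le> \<bar>B\<bar>"
      using g(2)[of x] finite_borel_measure_space[OF \<mu>] by auto
    then show "norm (u x * g x) \<le> norm (B * u x)" by (simp add: abs_mult mult.commute mult_right_mono)
  qed
qed

lemma mass_bound_density_iff: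
  assumes \<mu>: "mass_bound m Z T \<mu>" and h: "h \<in> borel_measurable (borel_metric Z)" "\<And>x. 0 \<le> h x" "integrable \<mu> h"
  shows "mass_bound m Z T (density \<mu> h) \<longleftrightarrow>
    (\<forall>f \<pi>. adm m Z f \<pi> \<longrightarrow> \<bar>T f \<pi>\<bar> \<le> lip_prod Z \<pi> * (LINT x|\<mu>. h x * \<bar>f x\<bar>))"
proof -
  have b: "finite_borel_measure Z \<mu>" by (rule mass_bound_finite_borel_measure[OF \<mu>])
  have hm: "h \<in> borel_measurable \<mu>" using h(1) finite_borel_measure_measurable[OF b] by blast
  have "finite_measure (density \<mu> h)"
  proof (rule finite_measureI)
    have "emeasure (density \<mu> h) (space (density \<mu> h)) = (\<integral>\<^sup>+ x. ennreal (h x) \<partial>\<mu>)"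
      using hm by (subst emeasure_density) (auto intro!: nn_integral_cong)
    also have "\<dots> < \<infinity>" using h(2,3) by (simp add: integrable_iff_bounded)
    finally show "emeasure (density \<mu> h) (space (density \<mu> h)) \<noteq> \<infinity>" by simp
  qed
  moreover have "(LINT x|density \<mu> h. \<bar>f x\<bar>) = (LINT x|\<mu>. h x * \<bar>f x\<bar>)" if "adm m Z f \<pi>" for f \<pi>
  proof -
    have "f \<in> borel_measurable \<mu>"
      using blip_fun_measurable[OF adm_blip[OF that]] finite_borel_measure_measurable[OF b] by blast
    then have "(\<lambda>x. \<bar>f x\<bar>) \<in> borel_measurable \<mu>" by simp
    from integral_density[OF this hm] h(2) show ?thesis by simp
  qed
  ultimately show ?thesis
    using \<mu> by (auto simp: mass_bound_def)
qed

definition minimal_mass_bound :: "nat \<Rightarrow> 'a metric \<Rightarrow> 'a current \<Rightarrow> 'a measure \<Rightarrow> bool" where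
  "minimal_mass_bound m Z T \<mu> \<longleftrightarrow> mass_bound m Z T \<mu> \<and>
     (\<forall>\<nu>. mass_bound m Z T \<nu> \<longrightarrow> (\<forall>A\<in>sets (borel_metric Z). emeasure \<mu> A \<le> emeasure \<nu> A))"

text \<open>
  Among the densities with respect to a fixed bound \<open>\<mu>\<close> that again give a bound, there is one of
  least integral. Splitting along the set where one density is below another shows that the pointwise
  minimum of two such densities is again one. So a minimizing sequence can be taken decreasing, and its
  limit is admissible by dominated convergence.
\<close>

lemma minimal_density:
  assumes T: "additive_functional m Z T" and \<mu>: "mass_bound m Z T \<mu>"
  obtains h :: "'a \<Rightarrow> real" where "h \<in> borel_measurable (borel_metric Z)" "\<And>x. 0 \<le> h x" "integrable \<mu> h"
    "mass_bound m Z T (density \<mu> h)"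
    "\<And>k. k \<in> borel_measurable (borel_metric Z) \<Longrightarrow> (\<And>x. 0 \<le> k x) \<Longrightarrow> integrable \<mu> k \<Longrightarrow>
       mass_bound m Z T (density \<mu> k) \<Longrightarrow> integral\<^sup>L \<mu> h \<le> integral\<^sup>L \<mu> k"
proof -
  have b: "finite_borel_measure Z \<mu>" by (rule mass_bound_finite_borel_measure[OF \<mu>])
  note meas = finite_borel_measure_measurable[OF b]
  define H where "H = {h. h \<in> borel_measurable (borel_metric Z) \<and> (\<forall>x. 0 \<le> h x) \<and> integrable \<mu> h \<and>
    mass_bound m Z T (density \<mu> h)}"
  have H_iff: "h \<in> H \<longleftrightarrow> h \<in> borel_measurable (borel_metric Z) \<and> (\<forall>x. 0 \<le> h x) \<and> integrable \<mu> h \<and>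
      (\<forall>f \<pi>. adm m Z f \<pi> \<longrightarrow> \<bar>T f \<pi>\<bar> \<le> lip_prod Z \<pi> * (LINT x|\<mu>. h x * \<bar>f x\<bar>))" for h
    unfolding H_def using mass_bound_density_iff[OF \<mu>, of h] by auto
  \<comment> \<open>The minimum of two densities: split along the set where the first is the smaller one.\<close>
  have Hmin: "(\<lambda>x. min (h x) (k x)) \<in> H" if h: "h \<in> H" and k: "k \<in> H" for h k
    unfolding H_iff
  proof (intro conjI allI impI)
    have [measurable]: "h \<in> borel_measurable (borel_metric Z)" "k \<in> borel_measurable (borel_metric Z)"
      using h k by (auto simp: H_iff)
    show "(\<lambda>x. min (h x) (k x)) \<in> borel_measurable (borel_metric Z)" by measurable
    show "0 \<le> min (h x) (k x)" for x using h k by (simp add: H_iff)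
    show "integrable \<mu> (\<lambda>x. min (h x) (k x))"
      using h k by (intro integrable_min) (auto simp: H_iff)
    fix f \<pi> assume f: "adm m Z f \<pi>"
    have [measurable]: "f \<in> borel_measurable (borel_metric Z)"
      by (rule blip_fun_measurable[OF adm_blip[OF f]])
    define Y where "Y = {x \<in> space (borel_metric Z). h x \<le> k x}"
    have Y[measurable]: "Y \<in> sets (borel_metric Z)" unfolding Y_def by measurable
    obtain B where B: "\<And>x. x \<in> mspace Z \<Longrightarrow> \<bar>f x\<bar> \<le> B" "0 \<le> B"
      using adm_blip[OF f] unfolding blip_fun_iff by auto
    have int: "integrable \<mu> (\<lambda>x. h x * (indicator Y x * \<bar>f x\<bar>))" "integrable \<mu> (\<lambda>x. k x * ((1 - indicator Y x) * \<bar>f x\<bar>))"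
      by (rule integrable_mult_bounded[OF b, of _ _ B]; use h k B in \<open>auto simp: H_iff indicator_def\<close>)+
    have "\<bar>T f \<pi>\<bar> \<le> lip_prod Z \<pi> *
     ((LINT x|density \<mu> h. indicator Y x * \<bar>f x\<bar>) + (LINT x|density \<mu> k. (1 - indicator Y x) * \<bar>f x\<bar>))"
      by (rule mass_bound_split[OF T _ _ Y f]) (use h k in \<open>auto simp: H_def\<close>)
    also have "(LINT x|density \<mu> h. indicator Y x * \<bar>f x\<bar>) = (LINT x|\<mu>. h x * (indicator Y x * \<bar>f x\<bar>))"
      using h by (subst integral_density) (auto simp: meas H_iff)
    also have "(LINT x|density \<mu> k. (1 - indicator Y x) * \<bar>f x\<bar>) = (LINT x|\<mu>. k x * ((1 - indicator Y x) * \<bar>f x\<bar>))"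
      using k by (subst integral_density) (auto simp: meas H_iff)
    also have "(LINT x|\<mu>. h x * (indicator Y x * \<bar>f x\<bar>)) + (LINT x|\<mu>. k x * ((1 - indicator Y x) * \<bar>f x\<bar>))
      = (LINT x|\<mu>. min (h x) (k x) * \<bar>f x\<bar>)"
      unfolding Bochner_Integration.integral_add[OF int, symmetric]
      by (rule Bochner_Integration.integral_cong) (auto simp: Y_def indicator_def finite_borel_measure_space[OF b])
    finally show "\<bar>T f \<pi>\<bar> \<le> lip_prod Z \<pi> * (LINT x|\<mu>. min (h x) (k x) * \<bar>f x\<bar>)" .
  qed
  have "integrable \<mu> (\<lambda>_. 1 :: real)"
    by (rule finite_borel_measure_integrable[OF b, of _ 1]) auto
  then have "(\<lambda>_. 1) \<in> H" unfolding H_iff[of "\<lambda>_. 1"]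
  proof (intro conjI allI impI)
    fix f \<pi> assume "adm m Z f \<pi>"
    then show "\<bar>T f \<pi>\<bar> \<le> lip_prod Z \<pi> * (LINT x|\<mu>. 1 * \<bar>f x\<bar>)"
      unfolding mult_1 by (rule mass_boundD[OF \<mu>])
  qed (rule borel_measurable_const zero_le_one | assumption)+
  then have Hne: "H \<noteq> {}" by auto
  define c where "c = (INF h\<in>H. integral\<^sup>L \<mu> h)"
  have bdd: "bdd_below ((\<lambda>h. integral\<^sup>L \<mu> h) ` H)"
    by (rule bdd_belowI2[of _ 0]) (auto simp: H_iff intro!: integral_nonneg_AE)
  have c_le: "c \<le> integral\<^sup>L \<mu> h" if "h \<in> H" for h unfolding c_def
    by (rule cINF_lower[OF bdd that])
  have "\<exists>h\<in>H. integral\<^sup>L \<mu> h < c + 1 / real (Suc n)" for n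
    using cINF_less_iff[OF Hne bdd, of "c + 1 / real (Suc n)"] by (simp add: c_def)
  then have "\<forall>n. \<exists>h. h \<in> H \<and> integral\<^sup>L \<mu> h < c + 1 / real (Suc n)"
    by blast
  from choice[OF this] obtain h
    where h: "\<And>n. h n \<in> H" "\<And>n. integral\<^sup>L \<mu> (h n) < c + 1 / real (Suc n)" by blast
  \<comment> \<open>Running minima turn the minimizing sequence into a decreasing one.\<close>
  define k where "k = rec_nat (h 0) (\<lambda>n kn x. min (kn x) (h (Suc n) x))"
  have k0: "k 0 = h 0" and kS: "k (Suc n) = (\<lambda>x. min (k n x) (h (Suc n) x))" for n
    by (simp_all add: k_def)
  have kH: "k n \<in> H" for n by (induction n) (auto simp: k0 kS intro!: Hmin h(1))
  have kh: "k n x \<le> h n x" for n x by (cases n) (simp_all add: k0 kS)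
  have dec: "decseq (\<lambda>n. k n x)" for x by (rule decseq_SucI) (simp add: kS)
  have k_ge: "0 \<le> k n x" for n x using kH by (simp add: H_iff)
  define l where "l x = (INF n. k n x)" for x
  have lim: "(\<lambda>n. k n x) \<longlonglongrightarrow> l x" for x
    unfolding l_def by (rule LIMSEQ_decseq_INF[OF _ dec]) (auto intro!: bdd_belowI[of _ 0] k_ge)
  have l_ge: "0 \<le> l x" for x by (rule LIMSEQ_le_const[OF lim]) (auto intro: k_ge)
  have km[measurable]: "k n \<in> borel_measurable (borel_metric Z)" for n using kH by (simp add: H_iff)
  have lm[measurable]: "l \<in> borel_measurable (borel_metric Z)"
    by (rule borel_measurable_LIMSEQ_real[OF lim km])
  have kint: "integrable \<mu> (k n)" for n using kH by (simp add: H_iff)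
  have l_int: "integrable \<mu> l" and l_lim: "(\<lambda>n. integral\<^sup>L \<mu> (k n)) \<longlonglongrightarrow> integral\<^sup>L \<mu> l"
  proof -
    have a: "AE x in \<mu>. (\<lambda>n. k n x) \<longlonglongrightarrow> l x" using lim by simp
    have d: "AE x in \<mu>. norm (k n x) \<le> k 0 x" for n using k_ge decseqD[OF dec, of 0 n]
      by (intro AE_I2) auto
    show "integrable \<mu> l" by (rule integrable_dominated_convergence[OF _ _ kint[of 0] a d]) (simp_all add: meas)
    show "(\<lambda>n. integral\<^sup>L \<mu> (k n)) \<longlonglongrightarrow> integral\<^sup>L \<mu> l"
      by (rule integral_dominated_convergence[OF _ _ kint[of 0] a d]) (simp_all add: meas)
  qed
  have lH: "l \<in> H" unfolding H_iff
  proof (intro conjI allI impI lm l_ge l_int)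
    fix f \<pi> assume f: "adm m Z f \<pi>"
    have [measurable]: "f \<in> borel_measurable (borel_metric Z)"
      by (rule blip_fun_measurable[OF adm_blip[OF f]])
    obtain B where B: "\<And>x. x \<in> mspace Z \<Longrightarrow> \<bar>f x\<bar> \<le> B" "0 \<le> B"
      using adm_blip[OF f] unfolding blip_fun_iff by auto
    have "(\<lambda>n. LINT x|\<mu>. k n x * \<bar>f x\<bar>) \<longlonglongrightarrow> (LINT x|\<mu>. l x * \<bar>f x\<bar>)"
    proof (rule integral_dominated_convergence[where w = "\<lambda>x. B * k 0 x"])
      show "integrable \<mu> (\<lambda>x. B * k 0 x)" using kint by simp
      show "AE x in \<mu>. (\<lambda>n. k n x * \<bar>f x\<bar>) \<longlonglongrightarrow> l x * \<bar>f x\<bar>"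
        using lim by (intro AE_I2 tendsto_mult_right)
      show "AE x in \<mu>. norm (k n x * \<bar>f x\<bar>) \<le> B * k 0 x" for n
      proof (rule AE_I2)
        fix x assume "x \<in> space \<mu>"
        then have "\<bar>f x\<bar> \<le> B" using B finite_borel_measure_space[OF b] by auto
        then have "\<bar>f x\<bar> * k n x \<le> B * k 0 x"
          using k_ge decseqD[OF dec, of 0 n] B(2) by (intro mult_mono) auto
        then show "norm (k n x * \<bar>f x\<bar>) \<le> B * k 0 x"
          using k_ge by (simp add: abs_mult mult.commute)
      qed
    qed (simp_all add: meas)
    then have "(\<lambda>n. lip_prod Z \<pi> * (LINT x|\<mu>. k n x * \<bar>f x\<bar>))
      \<longlonglongrightarrow> lip_prod Z \<pi> * (LINT x|\<mu>. l x * \<bar>f x\<bar>)" by (rule tendsto_mult_left)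
    then show "\<bar>T f \<pi>\<bar> \<le> lip_prod Z \<pi> * (LINT x|\<mu>. l x * \<bar>f x\<bar>)"
      by (rule LIMSEQ_le_const) (use kH f in \<open>auto simp: H_iff\<close>)
  qed
  have "integral\<^sup>L \<mu> l \<le> c"
  proof (rule LIMSEQ_le[OF l_lim])
    show "(\<lambda>n. c + 1 / real (Suc n)) \<longlonglongrightarrow> c"
      using tendsto_add[OF tendsto_const LIMSEQ_inverse_real_of_nat, of c] by (simp add: inverse_eq_divide)
    have "integral\<^sup>L \<mu> (k n) \<le> c + 1 / real (Suc n)" for n
      using integral_mono[OF kint, of "h n" n] h(1)[of n] h(2)[of n] kh by (force simp: H_iff)
    then show "\<exists>N. \<forall>n\<ge>N. integral\<^sup>L \<mu> (k n) \<le> c + 1 / real (Suc n)"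
      by blast
  qed
  then have "\<And>k. k \<in> H \<Longrightarrow> integral\<^sup>L \<mu> l \<le> integral\<^sup>L \<mu> k"
    using c_le by force
  then show ?thesis using lH that unfolding H_def by blast
qed

text \<open>
  A bound of least total mass below \<open>\<mu>\<close> lies below every bound \<open>\<nu>\<close>. Take a Hahn decomposition
  with \<open>\<nu> \<le> \<kappa>\<close> on \<open>Y\<close> and \<open>\<kappa> \<le> \<nu>\<close> off \<open>Y\<close>. By splitting, \<open>\<nu>\<close> on \<open>Y\<close> together with
  \<open>\<kappa>\<close> off \<open>Y\<close> is a bound, and it is absolutely continuous with respect to \<open>\<mu>\<close>, so minimality
  of \<open>\<kappa>\<close> applies to it and forces \<open>\<nu>\<close> and \<open>\<kappa>\<close> to agree on \<open>Y\<close>.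
\<close>

lemma minimal_mass_bound_exists:
  assumes T: "additive_functional m Z T" and \<mu>: "mass_bound m Z T \<mu>"
  obtains \<kappa> where "minimal_mass_bound m Z T \<kappa>"
proof -
  obtain h :: "'a \<Rightarrow> real" where h: "h \<in> borel_measurable (borel_metric Z)" "\<And>x. 0 \<le> h x" "integrable \<mu> h"
    "mass_bound m Z T (density \<mu> h)"
    and least: "\<And>k. k \<in> borel_measurable (borel_metric Z) \<Longrightarrow> (\<And>x. 0 \<le> k x) \<Longrightarrow> integrable \<mu> k \<Longrightarrow>
       mass_bound m Z T (density \<mu> k) \<Longrightarrow> integral\<^sup>L \<mu> h \<le> integral\<^sup>L \<mu> k"
    using minimal_density[OF T \<mu>] by metis
  define \<kappa> where "\<kappa> = density \<mu> h"
  have b: "finite_borel_measure Z \<mu>" by (rule mass_bound_finite_borel_measure[OF \<mu>])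
  have s: "sets \<mu> = sets (borel_metric Z)" using b by (simp add: finite_borel_measure_def)
  note meas = finite_borel_measure_measurable[OF b]
  interpret \<mu>: finite_measure \<mu> using b by (simp add: finite_borel_measure_def)
  have \<kappa>: "mass_bound m Z T \<kappa>" using h by (simp add: \<kappa>_def)
  have b\<kappa>: "finite_borel_measure Z \<kappa>" by (rule mass_bound_finite_borel_measure[OF \<kappa>])
  interpret \<kappa>: finite_measure \<kappa> using b\<kappa> by (simp add: finite_borel_measure_def)
  have s\<kappa>: "sets \<kappa> = sets (borel_metric Z)"
    using b\<kappa> by (simp add: finite_borel_measure_def)
  have ac: "emeasure \<kappa> A = 0" if "emeasure \<mu> A = 0" "A \<in> sets \<mu>" for A
    using that h unfolding \<kappa>_def
      by (subst emeasure_density) (auto simp: meas nn_integral_null_set null_sets_def)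
  have min: "emeasure \<kappa> A \<le> emeasure \<nu> A" if \<nu>: "mass_bound m Z T \<nu>" and A: "A \<in> sets (borel_metric Z)" for \<nu> A
  proof -
    have b\<nu>: "finite_borel_measure Z \<nu>" by (rule mass_bound_finite_borel_measure[OF \<nu>])
    interpret \<nu>: finite_measure \<nu> using b\<nu> by (simp add: finite_borel_measure_def)
    have s\<nu>: "sets \<nu> = sets (borel_metric Z)" using b\<nu> by (simp add: finite_borel_measure_def)
    have "mspace Z \<in> sets (borel_metric Z)" by (metis sets.top space_borel_metric)
    then obtain Y where Y: "Y \<in> sets (borel_metric Z)"
      and le: "\<And>X. X \<in> sets (borel_metric Z) \<Longrightarrow> X \<subseteq> Y \<Longrightarrow> emeasure \<nu> X \<le> emeasure \<kappa> X"
      and ge: "\<And>X. X \<in> sets (borel_metric Z) \<Longrightarrow> X \<inter> Y = {} \<Longrightarrow> emeasure \<kappa> X \<le> emeasure \<nu> X"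
      using unsigned_Hahn_decomposition[of \<nu> \<kappa> "mspace Z"] s\<nu> s\<kappa> \<nu>.emeasure_finite \<kappa>.emeasure_finite
        sets.sets_into_space[of _ "borel_metric Z"] by (auto simp: space_borel_metric)
    note Y[measurable] h(1)[measurable]
    \<comment> \<open>The part of the competing bound on the set where it is below the minimizer.\<close>
    define \<nu>Y where "\<nu>Y = density \<nu> (indicator Y)"
    have e\<nu>Y: "emeasure \<nu>Y X = emeasure \<nu> (X \<inter> Y)" if "X \<in> sets (borel_metric Z)" for X
    proof -
      have "(\<lambda>x. indicator Y x * indicator X x :: ennreal) = indicator (X \<inter> Y)"
        by (auto simp: fun_eq_iff indicator_def)
      then have "emeasure \<nu>Y X = (\<integral>\<^sup>+x. indicator (X \<inter> Y) x \<partial>\<nu>)"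
        unfolding \<nu>Y_def
        using that Y s\<nu> by (subst emeasure_density) auto
      then show ?thesis using that Y s\<nu> by simp
    qed
    have s\<nu>Y: "sets \<nu>Y = sets \<mu>" by (simp add: \<nu>Y_def s\<nu> s)
    have fin: "finite_measure \<nu>Y"
      using e\<nu>Y[of "mspace Z"] \<open>mspace Z \<in> _\<close>
        by (intro finite_measureI) (simp add: \<nu>Y_def finite_borel_measure_space[OF b\<nu>])
    have "absolutely_continuous \<mu> \<nu>Y"
      unfolding absolutely_continuous_def
    proof
      fix N assume N: "N \<in> null_sets \<mu>"
      then have "N \<in> sets (borel_metric Z)" by (auto simp: s)
      then have NY: "N \<inter> Y \<in> sets (borel_metric Z)" using Y by auto
      have "emeasure \<mu> (N \<inter> Y) \<le> emeasure \<mu> N"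
        using \<open>N \<in> sets (borel_metric Z)\<close> by (intro emeasure_mono) (auto simp: s)
      then have "emeasure \<kappa> (N \<inter> Y) = 0" using N NY by (intro ac) (auto simp: s null_sets_def)
      then have "emeasure \<nu>Y N = 0"
        using le[OF NY] e\<nu>Y[OF \<open>N \<in> sets (borel_metric Z)\<close>] by simp
      then show "N \<in> null_sets \<nu>Y" using N s\<nu>Y by (auto simp: null_sets_def)
    qed
    then obtain D where D: "D \<in> borel_measurable \<mu>" "AE x in \<mu>. RN_deriv \<mu> \<nu>Y x = ennreal (D x)" "\<And>x. 0 \<le> D x"
      using \<mu>.real_RN_deriv[OF fin _ s\<nu>Y] by metis
    have dD: "density \<mu> D = \<nu>Y"
    proof -
      have "density \<mu> D = density \<mu> (RN_deriv \<mu> \<nu>Y)"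
        using D by (intro density_cong) auto
      then show ?thesis using \<mu>.density_RN_deriv[OF \<open>absolutely_continuous \<mu> \<nu>Y\<close> s\<nu>Y]
        by simp
    qed
    have Dm[measurable]: "D \<in> borel_measurable (borel_metric Z)" using D(1) meas by blast
    have Dint: "integrable \<mu> D"
    proof -
      have "(\<integral>\<^sup>+x. ennreal (D x) \<partial>\<mu>) = emeasure (density \<mu> D) (space \<mu>)"
        using D(1) by (subst emeasure_density) (auto intro!: nn_integral_cong)
      also have "\<dots> < \<infinity>"
        using finite_measure.emeasure_finite[OF fin] by (simp add: dD less_top[symmetric])
      finally show ?thesis using D by (simp add: integrable_iff_bounded)
    qed
    \<comment> \<open>The density of the combined measure; D vanishes almost everywhere off Y, so its two
      summands describe the two parts.\<close>
    define k where "k x = D x + (1 - indicator Y x) * h x" for x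
    have km: "k \<in> borel_measurable (borel_metric Z)" unfolding k_def by measurable
    have k0: "0 \<le> k x" for x using D(3) h(2) by (simp add: k_def indicator_def)
    have hY: "integrable \<mu> (\<lambda>x. (1 - indicator Y x) * h x)"
      by (rule Bochner_Integration.integrable_bound[OF h(3)]) (auto simp: meas indicator_def)
    have kint: "integrable \<mu> k" unfolding k_def using Dint hY by simp
    have "mass_bound m Z T (density \<mu> k)"
      unfolding mass_bound_density_iff[OF \<mu> km k0 kint]
    proof (intro allI impI)
      fix f \<pi> assume f: "adm m Z f \<pi>"
      have fm[measurable]: "f \<in> borel_measurable (borel_metric Z)"
        by (rule blip_fun_measurable[OF adm_blip[OF f]])
      obtain B where B: "\<And>x. x \<in> mspace Z \<Longrightarrow> \<bar>f x\<bar> \<le> B" "0 \<le> B"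
        using adm_blip[OF f] unfolding blip_fun_iff by auto
      have ib: "integrable \<mu> (\<lambda>x. u x * \<bar>f x\<bar>)" if "integrable \<mu> u" for u
        by (rule integrable_mult_bounded[OF b that, of _ B]) (use B in auto)
      have "\<bar>T f \<pi>\<bar> \<le> lip_prod Z \<pi> *
         ((LINT x|\<nu>. indicator Y x * \<bar>f x\<bar>) + (LINT x|\<kappa>. (1 - indicator Y x) * \<bar>f x\<bar>))"
        by (rule mass_bound_split[OF T \<kappa> \<nu> Y f])
      also have "(LINT x|\<nu>. indicator Y x * \<bar>f x\<bar>) = (LINT x|\<nu>Y. \<bar>f x\<bar>)"
      proof -
        have "\<nu>Y = density \<nu> (\<lambda>x. ennreal (indicator Y x))"
          by (simp add: \<nu>Y_def ennreal_indicator)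
        then show ?thesis
          using fm Y by (simp add: integral_density finite_borel_measure_measurable[OF b\<nu>])
      qed
      also have "(LINT x|\<nu>Y. \<bar>f x\<bar>) = (LINT x|\<mu>. D x * \<bar>f x\<bar>)"
        unfolding dD[symmetric] using D fm by (subst integral_density) (auto simp: meas)
      also have "(LINT x|\<kappa>. (1 - indicator Y x) * \<bar>f x\<bar>) = (LINT x|\<mu>. (1 - indicator Y x) * h x * \<bar>f x\<bar>)"
        unfolding \<kappa>_def using h(2) by (subst integral_density) (auto simp: meas ac_simps)
      also have "(LINT x|\<mu>. D x * \<bar>f x\<bar>) + (LINT x|\<mu>. (1 - indicator Y x) * h x * \<bar>f x\<bar>) = (LINT x|\<mu>. k x * \<bar>f x\<bar>)"
        using ib[OF Dint] ib[OF hY]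
          by (subst Bochner_Integration.integral_add[symmetric]) (auto simp: k_def algebra_simps)
      finally show "\<bar>T f \<pi>\<bar> \<le> lip_prod Z \<pi> * (LINT x|\<mu>. k x * \<bar>f x\<bar>)" .
    qed
    then have ineq: "integral\<^sup>L \<mu> h \<le> integral\<^sup>L \<mu> k" by (rule least[OF km k0 kint])
    have "emeasure \<kappa> (mspace Z) = ennreal (integral\<^sup>L \<mu> h)"
    proof -
      have "emeasure \<kappa> (mspace Z) = (\<integral>\<^sup>+x. ennreal (h x) \<partial>\<mu>)"
        unfolding \<kappa>_def
        using \<open>mspace Z \<in> _\<close>
          by (subst emeasure_density) (auto simp: meas s finite_borel_measure_space[OF b, symmetric] intro!: nn_integral_cong)
      then show ?thesis using h by (simp add: nn_integral_eq_integral)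
    qed
    moreover have "ennreal (integral\<^sup>L \<mu> k) = emeasure \<nu> Y + emeasure \<kappa> (mspace Z - Y)"
    proof -
      have "ennreal (integral\<^sup>L \<mu> k) = (\<integral>\<^sup>+x. ennreal (D x) + ennreal ((1 - indicator Y x) * h x) \<partial>\<mu>)"
        using kint k0 D(3) h(2) by (subst nn_integral_eq_integral[symmetric]) (auto simp: k_def indicator_def intro!: nn_integral_cong)
      also have "\<dots> = (\<integral>\<^sup>+x. ennreal (D x) \<partial>\<mu>) + (\<integral>\<^sup>+x. ennreal ((1 - indicator Y x) * h x) \<partial>\<mu>)"
        by (rule nn_integral_add) (simp_all add: meas)
      also have "(\<integral>\<^sup>+x. ennreal (D x) \<partial>\<mu>) = emeasure (density \<mu> D) (mspace Z)"
        using D(1) \<open>mspace Z \<in> _\<close>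
          by (subst emeasure_density) (auto simp: s finite_borel_measure_space[OF b, symmetric] intro!: nn_integral_cong)
      also have "\<dots> = emeasure \<nu> Y"
        using e\<nu>Y[OF \<open>mspace Z \<in> _\<close>] sets.sets_into_space[OF Y]
          by (simp add: dD Int_absorb1)
      also have "(\<integral>\<^sup>+x. ennreal ((1 - indicator Y x) * h x) \<partial>\<mu>) = emeasure \<kappa> (mspace Z - Y)"
        unfolding \<kappa>_def using Y \<open>mspace Z \<in> _\<close>
        by (subst emeasure_density) (auto simp: meas s finite_borel_measure_space[OF b, symmetric] indicator_def intro!: nn_integral_cong)
      finally show ?thesis .
    qed
    ultimately have "emeasure \<kappa> (mspace Z) \<le> emeasure \<nu> Y + emeasure \<kappa> (mspace Z - Y)"
      using ineq by (metis ennreal_leI)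
    moreover have "emeasure \<kappa> (mspace Z) = emeasure \<kappa> Y + emeasure \<kappa> (mspace Z - Y)"
      using Y \<open>mspace Z \<in> _\<close> sets.sets_into_space[OF Y]
        by (subst plus_emeasure) (auto simp: s\<kappa> Un_absorb1)
    ultimately have Yle: "measure \<kappa> Y \<le> measure \<nu> Y"
      by (simp add: \<kappa>.emeasure_eq_measure \<nu>.emeasure_eq_measure flip: ennreal_plus)
    have AY: "A \<inter> Y \<in> sets (borel_metric Z)" "Y - A \<in> sets (borel_metric Z)" "A - Y \<in> sets (borel_metric Z)"
      using A Y by auto
    have split: "measure \<tau> Y = measure \<tau> (A \<inter> Y) + measure \<tau> (Y - A)" "measure \<tau> A = measure \<tau> (A \<inter> Y) + measure \<tau> (A - Y)"
      if "finite_borel_measure Z \<tau>" for \<tau>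
    proof -
      interpret \<tau>: finite_measure \<tau> using that by (simp add: finite_borel_measure_def)
      have "sets \<tau> = sets (borel_metric Z)" using that by (simp add: finite_borel_measure_def)
      then show "measure \<tau> Y = measure \<tau> (A \<inter> Y) + measure \<tau> (Y - A)" "measure \<tau> A = measure \<tau> (A \<inter> Y) + measure \<tau> (A - Y)"
        using AY by (subst \<tau>.finite_measure_Union[symmetric]; auto intro!: arg_cong[where f = "measure \<tau>"])+
    qed
    have "measure \<nu> (Y - A) \<le> measure \<kappa> (Y - A)" "measure \<kappa> (A - Y) \<le> measure \<nu> (A - Y)"
      using le[OF AY(2)] ge[OF AY(3)] by (auto simp: \<kappa>.emeasure_eq_measure \<nu>.emeasure_eq_measure)
    then have "measure \<kappa> A \<le> measure \<nu> A"
      using Yle split[OF b\<kappa>] split[OF b\<nu>] by linarith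
    then show ?thesis by (simp add: \<kappa>.emeasure_eq_measure \<nu>.emeasure_eq_measure)
  qed
  show ?thesis by (rule that[of \<kappa>]) (use \<kappa> min in \<open>auto simp: minimal_mass_bound_def\<close>)
qed

lemma mass_measure_eqI:
  assumes "minimal_mass_bound m Z T \<mu>"
  shows "mass_measure m Z T = \<mu>"
  unfolding mass_measure_def minimal_mass_bound_def[symmetric]
proof (rule the_equality)
  show "minimal_mass_bound m Z T \<mu>" by fact
  fix \<nu> assume "minimal_mass_bound m Z T \<nu>"
  with assms show "\<nu> = \<mu>"
    by (intro measure_eqI) (auto simp: minimal_mass_bound_def mass_bound_def intro: antisym)
qed

lemma minimal_mass_measure:
  assumes "additive_functional m Z T" "mass_bound m Z T \<mu>"
  shows "minimal_mass_bound m Z T (mass_measure m Z T)"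
  using minimal_mass_bound_exists[OF assms] mass_measure_eqI by metis

lemma mass_bound_mass_measure:
  "additive_functional m Z T \<Longrightarrow> mass_bound m Z T \<mu> \<Longrightarrow> mass_bound m Z T (mass_measure m Z T)"
  using minimal_mass_measure unfolding minimal_mass_bound_def by blast

section \<open>Values of currents and their boundaries\<close>

lemma multilinear_additive:
  "multilinear_functional m Z T \<Longrightarrow> additive_functional m Z T"
  unfolding multilinear_functional_def additive_functional_def
proof (elim conjE, intro allI impI)
  fix f g \<pi>
  assume "\<forall>f g \<pi> a b. adm m Z f \<pi> \<and> adm m Z g \<pi> \<longrightarrow> T (\<lambda>x. a * f x + b * g x) \<pi> = a * T f \<pi> + b * T g \<pi>"
    and "adm m Z f \<pi> \<and> adm m Z g \<pi>"
  then have "T (\<lambda>x. 1 * f x + 1 * g x) \<pi> = 1 * T f \<pi> + 1 * T g \<pi>" by blast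
  then show "T (\<lambda>x. f x + g x) \<pi> = T f \<pi> + T g \<pi>" by simp
qed

lemma adm_one_Cons: "adm k Z f \<pi> \<Longrightarrow> adm (Suc k) Z (\<lambda>_. 1) (f # \<pi>)"
  by (auto simp: adm_def blip_fun_def)

lemma boundary_additive:
  assumes T: "multilinear_functional m Z T"
  shows "additive_functional (m - 1) Z (boundary m T)"
proof (cases m)
  case 0
  then show ?thesis by (simp add: additive_functional_def boundary_def)
next
  case (Suc k)
  show ?thesis unfolding additive_functional_def Suc
  proof (intro allI impI, elim conjE)
    fix f g \<pi> assume f: "adm (Suc k - 1) Z f \<pi>" and g: "adm (Suc k - 1) Z g \<pi>"
    have *: "adm m Z (\<lambda>_. 1) (f # \<pi>)" "0 < m" "lip_fun Z f" "lip_fun Z g"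
      using f g adm_one_Cons[of k Z f \<pi>] by (auto simp: Suc adm_def blip_fun_def)
    have "T (\<lambda>_. 1) ((f # \<pi>)[0 := \<lambda>x. 1 * f x + 1 * g x]) = 1 * T (\<lambda>_. 1) ((f # \<pi>)[0 := f]) + 1 * T (\<lambda>_. 1) ((f # \<pi>)[0 := g])"
      using T * unfolding multilinear_functional_def by blast
    then show "boundary (Suc k) T (\<lambda>x. f x + g x) \<pi> = boundary (Suc k) T f \<pi> + boundary (Suc k) T g \<pi>"
      by (simp add: boundary_def)
  qed
qed

text \<open>
  Functions are total on the underlying type, so two tuples may agree on the carrier without being
  equal. For instance, a McShane extension composed with the embedding returns the original function
  on the carrier only.
\<close>

definition carrier_determined :: "nat \<Rightarrow> 'a metric \<Rightarrow> 'a current \<Rightarrow> bool" where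
  "carrier_determined m Z T \<longleftrightarrow> (\<forall>f g \<pi> \<rho>. adm m Z f \<pi> \<and> adm m Z g \<rho> \<and> (\<forall>x\<in>mspace Z. f x = g x) \<and>
     (\<forall>i<m. \<forall>x\<in>mspace Z. (\<pi> ! i) x = (\<rho> ! i) x) \<longrightarrow> T f \<pi> = T g \<rho>)"

lemma carrier_determinedD:
  assumes "carrier_determined m Z T" "adm m Z f \<pi>" "adm m Z g \<rho>" "\<And>x. x \<in> mspace Z \<Longrightarrow> f x = g x"
    "\<And>i x. i < m \<Longrightarrow> x \<in> mspace Z \<Longrightarrow> (\<pi> ! i) x = (\<rho> ! i) x"
  shows "T f \<pi> = T g \<rho>"
  using assms unfolding carrier_determined_def by blast

text \<open>
  A difference that vanishes on the carrier has integral zero in the first slot and Lipschitz constant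
  zero in the others, so linearity and the mass bound show that replacing one entry does not change the
  value.
\<close>

lemma multilinear_carrier_determined:
  assumes T: "multilinear_functional m Z T" and \<mu>: "mass_bound m Z T \<mu>"
  shows "carrier_determined m Z T"
  unfolding carrier_determined_def
proof (intro allI impI, elim conjE)
  fix f g \<pi> \<rho>
  assume f: "adm m Z f \<pi>" and g: "adm m Z g \<rho>" and fg: "\<forall>x\<in>mspace Z. f x = g x"
    and \<pi>\<rho>: "\<forall>i<m. \<forall>x\<in>mspace Z. (\<pi> ! i) x = (\<rho> ! i) x"
  have len: "length \<pi> = m" "length \<rho> = m" using f g by (auto simp: adm_def)
  have b: "finite_borel_measure Z \<mu>" by (rule mass_bound_finite_borel_measure[OF \<mu>])
  have g\<pi>: "adm m Z g \<pi>" using f g by (auto simp: adm_def)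
  have "T (\<lambda>x. 1 * f x + (-1) * g x) \<pi> = 1 * T f \<pi> + (-1) * T g \<pi>"
    using T f g\<pi> unfolding multilinear_functional_def by blast
  moreover have "T (\<lambda>x. 1 * f x + (-1) * g x) \<pi> = 0"
  proof -
    have "adm m Z (\<lambda>x. 1 * f x + (-1) * g x) \<pi>"
      using f g\<pi> by (auto simp: adm_def intro: blip_fun_lincomb[of Z f g 1 "-1", simplified])
    from mass_boundD[OF \<mu> this]
    have "\<bar>T (\<lambda>x. 1 * f x + (-1) * g x) \<pi>\<bar> \<le> lip_prod Z \<pi> * (LINT x|\<mu>. \<bar>1 * f x + (-1) * g x\<bar>)" .
    also have "(LINT x|\<mu>. \<bar>1 * f x + (-1) * g x\<bar>) = (LINT x|\<mu>. 0)"
      by (rule Bochner_Integration.integral_cong) (use fg in \<open>auto simp: finite_borel_measure_space[OF b]\<close>)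
    finally show ?thesis by simp
  qed
  ultimately have 1: "T f \<pi> = T g \<pi>" by simp
  \<comment> \<open>Replace the entries of the list from left to right, one at a time.\<close>
  have "k \<le> m \<Longrightarrow> T g (take k \<rho> @ drop k \<pi>) = T g \<pi>" for k
  proof (induction k)
    case (Suc k)
    then have k: "k < m" by simp
    define \<sigma> where "\<sigma> = take k \<rho> @ drop k \<pi>"
    have s1: "\<sigma> = \<sigma>[k := \<pi> ! k]" and s2: "take (Suc k) \<rho> @ drop (Suc k) \<pi> = \<sigma>[k := \<rho> ! k]" and ls: "length \<sigma> = m"
      using k len by (auto simp: \<sigma>_def list_update_append take_Suc_conv_app_nth Cons_nth_drop_Suc[symmetric] min_def)
    have "set \<sigma> \<subseteq> set \<rho> \<union> set \<pi>"
      unfolding \<sigma>_def by (auto dest: in_set_takeD in_set_dropD)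
    then have \<sigma>: "adm m Z g \<sigma>" using f g ls by (auto simp: adm_def)
    have lk: "lip_fun Z (\<pi> ! k)" "lip_fun Z (\<rho> ! k)" using f g k len by (auto simp: adm_def)
    let ?d = "\<lambda>x. 1 * (\<pi> ! k) x + (-1) * (\<rho> ! k) x"
    have "T g (\<sigma>[k := ?d]) = 1 * T g (\<sigma>[k := \<pi> ! k]) + (-1) * T g (\<sigma>[k := \<rho> ! k])"
      using T \<sigma> k lk unfolding multilinear_functional_def by blast
    moreover have "T g (\<sigma>[k := ?d]) = 0"
    proof -
      have ld: "lip_fun Z ?d" by (rule lip_fun_lincomb[OF lk])
      have "set (\<sigma>[k := ?d]) \<subseteq> insert ?d (set \<sigma>)" by (rule set_update_subset_insert)
      with \<sigma> ld have "adm m Z g (\<sigma>[k := ?d])" by (auto simp: adm_def)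
      from mass_boundD[OF \<mu> this]
      have *: "\<bar>T g (\<sigma>[k := ?d])\<bar> \<le> lip_prod Z (\<sigma>[k := ?d]) * (LINT x|\<mu>. \<bar>g x\<bar>)" .
      have "Lip Z euclidean_metric ?d \<le> 0"
        by (rule Lip_real_le) (use \<pi>\<rho> k in auto)
      then have "Lip Z euclidean_metric ?d = 0" using lip_fun_Lip(1)[OF ld] by linarith
      then have "0 \<in> set (map (Lip Z euclidean_metric) (\<sigma>[k := ?d]))"
        using k ls by (force simp: map_update intro: set_update_memI)
      then have "lip_prod Z (\<sigma>[k := ?d]) = 0"
        by (subst prod_list_zero_iff)
      with * show ?thesis by simp
    qed
    ultimately show ?case using Suc.IH k s1 s2 by (simp flip: \<sigma>_def)
  qed simp
  from this[of m] have "T g \<rho> = T g \<pi>" using len by simp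
  with 1 show "T f \<pi> = T g \<rho>" by simp
qed

lemma metric_current_facts:
  assumes "metric_current m Z T"
  shows "multilinear_functional m Z T" "additive_functional m Z T" "carrier_determined m Z T"
    and "minimal_mass_bound m Z T (mass_measure m Z T)" "mass_bound m Z T (mass_measure m Z T)"
    and "finite_borel_measure Z (mass_measure m Z T)"
proof -
  obtain \<mu> where ml: "multilinear_functional m Z T" and \<mu>: "mass_bound m Z T \<mu>"
    using assms unfolding metric_current_def by blast
  show "multilinear_functional m Z T" by (rule ml)
  show ad: "additive_functional m Z T" by (rule multilinear_additive[OF ml])
  show "carrier_determined m Z T" by (rule multilinear_carrier_determined[OF ml \<mu>])
  show min: "minimal_mass_bound m Z T (mass_measure m Z T)" by (rule minimal_mass_measure[OF ad \<mu>])
  then show mb: "mass_bound m Z T (mass_measure m Z T)" by (simp add: minimal_mass_bound_def)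
  show "finite_borel_measure Z (mass_measure m Z T)" by (rule mass_bound_finite_borel_measure[OF mb])
qed

lemma boundary_carrier_determined:
  assumes T: "carrier_determined m Z T"
  shows "carrier_determined (m - 1) Z (boundary m T)"
proof (cases m)
  case 0
  then show ?thesis by (simp add: carrier_determined_def boundary_def)
next
  case (Suc k)
  show ?thesis unfolding carrier_determined_def Suc
  proof (intro allI impI, elim conjE)
    fix f g \<pi> \<rho>
    assume f: "adm (Suc k - 1) Z f \<pi>" and g: "adm (Suc k - 1) Z g \<rho>" and fg: "\<forall>x\<in>mspace Z. f x = g x"
      and \<pi>\<rho>: "\<forall>i<Suc k - 1. \<forall>x\<in>mspace Z. (\<pi> ! i) x = (\<rho> ! i) x"
    have "T (\<lambda>_. 1) (f # \<pi>) = T (\<lambda>_. 1) (g # \<rho>)"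
      by (rule carrier_determinedD[OF T])
         (use f g fg \<pi>\<rho> in \<open>auto simp: Suc less_Suc_eq_0_disj intro!: adm_one_Cons\<close>)
    then show "boundary (Suc k) T f \<pi> = boundary (Suc k) T g \<rho>" by (simp add: boundary_def)
  qed
qed

lemma boundary_pushforward: "boundary m (pushforward \<iota> T) = pushforward \<iota> (boundary m T)"
  by (auto simp: fun_eq_iff boundary_def pushforward_def comp_def)

section \<open>Mass under isometric embeddings\<close>

lemma limitin_mtopology_of_iff:
  "limitin (mtopology_of Z) \<sigma> x sequentially \<longleftrightarrow>
     x \<in> mspace Z \<and> (\<forall>\<^sub>F n in sequentially. \<sigma> n \<in> mspace Z) \<and> (\<lambda>n. mdist Z (\<sigma> n) x) \<longlonglongrightarrow> 0"
  unfolding mtopology_of_def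
  by (simp add: Metric_space.limitin_metric_dist_null[OF Metric_space_mspace_mdist])

lemma mcomplete_ofD:
  assumes "mcomplete_of Z" "\<And>n. \<sigma> n \<in> mspace Z"
    "\<And>e. e > 0 \<Longrightarrow> \<exists>N. \<forall>n n'. N \<le> n \<longrightarrow> N \<le> n' \<longrightarrow> mdist Z (\<sigma> n) (\<sigma> n') < e"
  obtains x where "x \<in> mspace Z" "(\<lambda>n. mdist Z (\<sigma> n) x) \<longlonglongrightarrow> 0"
proof -
  have "Metric_space.MCauchy (mspace Z) (mdist Z) \<sigma>"
    using assms(2,3) by (auto simp: Metric_space.MCauchy_def[OF Metric_space_mspace_mdist])
  then obtain x where "limitin (mtopology_of Z) \<sigma> x sequentially"
    using assms(1) unfolding mcomplete_of_def Metric_space.mcomplete_def[OF Metric_space_mspace_mdist] mtopology_of_def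
      by blast
  then show ?thesis using that unfolding limitin_mtopology_of_iff by blast
qed

context
  fixes Z :: "'a metric" and Z' :: "'b metric" and \<iota>
  assumes \<iota>: "isometric_embedding Z Z' \<iota>"
begin

lemma isometric_inj_on: "inj_on \<iota> (mspace Z)"
proof (rule inj_onI)
  fix x y assume xy: "x \<in> mspace Z" "y \<in> mspace Z" "\<iota> x = \<iota> y"
  then have "mdist Z x y = 0" using isometric_embeddingD[OF \<iota> xy(1)] by (metis mdist_self)
  then show "x = y" using xy by simp
qed

lemma isometric_measurable: "\<iota> \<in> measurable (borel_metric Z) (borel_metric Z')"
  by (rule continuous_map_measurable[OF isometric_embedding_continuous[OF \<iota>]])

lemma inv_into_isometric [simp]: "x \<in> mspace Z \<Longrightarrow> inv_into (mspace Z) \<iota> (\<iota> x) = x"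
  by (rule inv_into_f_f[OF isometric_inj_on])

text \<open>
  An isometric embedding is a homeomorphism onto its image: the image of an open set is the trace of a
  union of balls of the ambient space.
\<close>

lemma inv_into_isometric_measurable:
  assumes s: "sets \<nu> = sets (borel_metric Z')"
  shows "inv_into (mspace Z) \<iota> \<in> measurable (restrict_space \<nu> (\<iota> ` mspace Z)) (borel_metric Z)"
proof (rule measurable_borel_metric)
  have sp: "space \<nu> = mspace Z'" using sets_eq_imp_space_eq[OF s] by simp
  have sub: "\<iota> ` mspace Z \<subseteq> mspace Z'" using isometric_embeddingD(1)[OF \<iota>] by auto
  then have spr: "space (restrict_space \<nu> (\<iota> ` mspace Z)) = \<iota> ` mspace Z"
    by (auto simp: space_restrict_space sp)
  show "inv_into (mspace Z) \<iota> \<in> space (restrict_space \<nu> (\<iota> ` mspace Z)) \<rightarrow> mspace Z"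
    unfolding spr by auto
  fix U assume U: "openin (mtopology_of Z) U"
  have "\<forall>x\<in>U. \<exists>r>0. mball_of Z x r \<subseteq> U"
    using openin_contains_mball_of[OF U] by blast
  then obtain r where r: "\<And>x. x \<in> U \<Longrightarrow> r x > 0" "\<And>x. x \<in> U \<Longrightarrow> mball_of Z x (r x) \<subseteq> U"
    by metis
  define V where "V = (\<Union>x\<in>U. mball_of Z' (\<iota> x) (r x))"
  have V: "openin (mtopology_of Z') V" unfolding V_def by (auto intro: openin_mball_of)
  have UZ: "U \<subseteq> mspace Z" by (rule open_subset_mspace[OF U])
  have "inv_into (mspace Z) \<iota> -` U \<inter> \<iota> ` mspace Z = V \<inter> \<iota> ` mspace Z"
  proof (intro equalityI subsetI)
    fix y assume "y \<in> inv_into (mspace Z) \<iota> -` U \<inter> \<iota> ` mspace Z"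
    then obtain x where x: "x \<in> mspace Z" "y = \<iota> x" "x \<in> U" by auto
    then have "y \<in> mball_of Z' (\<iota> x) (r x)" using r(1) isometric_embeddingD(1)[OF \<iota>] by auto
    then show "y \<in> V \<inter> \<iota> ` mspace Z" using x by (auto simp: V_def)
  next
    fix y assume "y \<in> V \<inter> \<iota> ` mspace Z"
    then obtain x u where x: "x \<in> mspace Z" "y = \<iota> x" and u: "u \<in> U" "mdist Z' (\<iota> u) (\<iota> x) < r u"
      by (auto simp: V_def)
    then have "x \<in> mball_of Z u (r u)" using UZ isometric_embeddingD(2)[OF \<iota>] by auto
    then have "x \<in> U" using r(2)[OF u(1)] by blast
    then show "y \<in> inv_into (mspace Z) \<iota> -` U \<inter> \<iota> ` mspace Z" using x by auto
  qed
  then show "inv_into (mspace Z) \<iota> -` U \<inter> space (restrict_space \<nu> (\<iota> ` mspace Z)) \<in> sets (restrict_space \<nu> (\<iota> ` mspace Z))"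
    using open_in_borel_metric[OF V] by (auto simp: sets_restrict_space spr s)
qed

lemma mass_bound_pushforward:
  assumes \<mu>: "mass_bound m Z T \<mu>"
  shows "mass_bound m Z' (pushforward \<iota> T) (distr \<mu> (borel_metric Z') \<iota>)"
proof -
  have b: "finite_borel_measure Z \<mu>" by (rule mass_bound_finite_borel_measure[OF \<mu>])
  interpret finite_measure \<mu> using b by (simp add: finite_borel_measure_def)
  have s: "sets \<mu> = sets (borel_metric Z)" using b by (simp add: finite_borel_measure_def)
  have \<iota>m: "\<iota> \<in> measurable \<mu> (borel_metric Z')"
    using isometric_measurable measurable_cong_sets[OF s refl] by blast
  show ?thesis unfolding mass_bound_def
  proof (intro conjI allI impI)
    show "finite_measure (distr \<mu> (borel_metric Z') \<iota>)"
      by (rule finite_measure_distr[OF \<iota>m])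
    fix f \<pi> assume f: "adm m Z' f \<pi>"
    have f': "adm m Z (f \<circ> \<iota>) (map (\<lambda>p. p \<circ> \<iota>) \<pi>)"
      by (rule adm_compose_isometric[OF \<iota> f])
    have "\<bar>pushforward \<iota> T f \<pi>\<bar> \<le> lip_prod Z (map (\<lambda>p. p \<circ> \<iota>) \<pi>) * (LINT x|\<mu>. \<bar>(f \<circ> \<iota>) x\<bar>)"
      unfolding pushforward_def by (rule mass_boundD[OF \<mu> f'])
    also have "\<dots> \<le> lip_prod Z' \<pi> * (LINT x|\<mu>. \<bar>(f \<circ> \<iota>) x\<bar>)"
    proof (intro mult_right_mono lip_prod_mono)
      show "list_all2 (\<lambda>p q. lip_fun Z p \<and> Lip Z euclidean_metric p \<le> Lip Z' euclidean_metric q) (map (\<lambda>p. p \<circ> \<iota>) \<pi>) \<pi>"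
        using f lip_fun_compose_isometric[OF \<iota>] by (auto simp: adm_def list_all2_conv_all_nth)
    qed simp
    also have "(LINT x|\<mu>. \<bar>(f \<circ> \<iota>) x\<bar>) = (LINT x|distr \<mu> (borel_metric Z') \<iota>. \<bar>f x\<bar>)"
      using \<iota>m blip_fun_measurable[OF adm_blip[OF f]] by (subst integral_distr) auto
    finally show "\<bar>pushforward \<iota> T f \<pi>\<bar> \<le> lip_prod Z' \<pi> *
        (LINT x|distr \<mu> (borel_metric Z') \<iota>. \<bar>f x\<bar>)" .
  qed simp_all
qed

lemma additive_pushforward:
  assumes "additive_functional m Z T" shows "additive_functional m Z' (pushforward \<iota> T)"
  unfolding additive_functional_def
proof (intro allI impI, elim conjE)
  fix f g \<pi> assume "adm m Z' f \<pi>" "adm m Z' g \<pi>"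
  then have "adm m Z (f \<circ> \<iota>) (map (\<lambda>p. p \<circ> \<iota>) \<pi>)" "adm m Z (g \<circ> \<iota>) (map (\<lambda>p. p \<circ> \<iota>) \<pi>)"
    by (auto intro: adm_compose_isometric[OF \<iota>])
  then show "pushforward \<iota> T (\<lambda>x. f x + g x) \<pi> = pushforward \<iota> T f \<pi> + pushforward \<iota> T g \<pi>"
    using assms unfolding additive_functional_def pushforward_def by (force simp: comp_def)
qed

end

context
  fixes Z :: "'a metric" and Z' :: "'b metric" and \<iota>
  assumes \<iota>: "isometric_embedding Z Z' \<iota>" and Zc: "mcomplete_of Z"
begin

text \<open>
  A convergent sequence in the image comes from a Cauchy sequence, which converges by completeness of the
  domain.
\<close>

lemma isometric_image_closed: "closedin (mtopology_of Z') (\<iota> ` mspace Z)"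
  unfolding mtopology_of_def Metric_space.metric_closedin_iff_sequentially_closed[OF Metric_space_mspace_mdist]
proof (intro conjI allI impI, goal_cases)
  case 1
  then show ?case using isometric_embeddingD(1)[OF \<iota>] by auto
next
  case (2 \<sigma> l)
  then have r: "range \<sigma> \<subseteq> \<iota> ` mspace Z" and l: "limitin (mtopology_of Z') \<sigma> l sequentially"
    by (auto simp: mtopology_of_def)
  from r have "\<forall>n. \<exists>x\<in>mspace Z. \<sigma> n = \<iota> x" by auto
  then obtain x where x: "\<And>n. x n \<in> mspace Z" "\<And>n. \<sigma> n = \<iota> (x n)" by metis
  have lZ: "l \<in> mspace Z'" and ll: "(\<lambda>n. mdist Z' (\<sigma> n) l) \<longlonglongrightarrow> 0"
    using l by (auto simp: limitin_mtopology_of_iff)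
  have \<sigma>Z: "\<sigma> n \<in> mspace Z'" for n using x isometric_embeddingD(1)[OF \<iota>] by auto
  obtain y where y: "y \<in> mspace Z" "(\<lambda>n. mdist Z (x n) y) \<longlonglongrightarrow> 0"
  proof (rule mcomplete_ofD[OF Zc x(1)])
    fix e :: real assume "e > 0"
    then have "\<forall>\<^sub>F n in sequentially. mdist Z' (\<sigma> n) l < e/2"
      using ll by (intro order_tendstoD) auto
    then obtain N where N: "\<And>n. n \<ge> N \<Longrightarrow> mdist Z' (\<sigma> n) l < e/2"
      by (auto simp: eventually_sequentially)
    show "\<exists>N. \<forall>n n'. N \<le> n \<longrightarrow> N \<le> n' \<longrightarrow> mdist Z (x n) (x n') < e"
    proof (intro exI[of _ N] allI impI)
      fix n n' assume "N \<le> n" "N \<le> n'"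
      then have "mdist Z' (\<sigma> n) (\<sigma> n') < e"
        using N[of n] N[of n'] mdist_triangle[OF \<sigma>Z[of n] lZ \<sigma>Z[of n']]
          by (simp add: mdist_commute[of Z' l])
      then show "mdist Z (x n) (x n') < e" using x isometric_embeddingD(2)[OF \<iota>] by simp
    qed
  qed (use that in blast)
  have "(\<lambda>n. mdist Z' (\<sigma> n) (\<iota> y)) \<longlonglongrightarrow> 0"
    using y x isometric_embeddingD(2)[OF \<iota>] by simp
  then have "(\<lambda>n. mdist Z' (\<sigma> n) l + mdist Z' (\<sigma> n) (\<iota> y)) \<longlonglongrightarrow> 0 + 0"
    using ll by (intro tendsto_add)
  moreover have "mdist Z' l (\<iota> y) \<le> mdist Z' (\<sigma> n) l + mdist Z' (\<sigma> n) (\<iota> y)" for n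
    using mdist_triangle[OF lZ \<sigma>Z[of n] isometric_embeddingD(1)[OF \<iota> y(1)]]
      by (simp add: mdist_commute[of Z' l])
  ultimately have "mdist Z' l (\<iota> y) \<le> 0" by (intro LIMSEQ_le_const[where x = "0::real"]) auto
  then have "mdist Z' l (\<iota> y) = 0" by (simp add: antisym)
  then have "l = \<iota> y" using lZ isometric_embeddingD(1)[OF \<iota> y(1)] by simp
  then show ?case using y by blast
qed

lemma isometric_image_borel: "\<iota> ` mspace Z \<in> sets (borel_metric Z')"
  by (rule closed_in_borel_metric[OF isometric_image_closed])

text \<open>
  The restriction of \<open>\<nu>\<close> to the image, transported back by the inverse of the embedding.
\<close>

definition pullback_measure :: "'b measure \<Rightarrow> 'a measure" where
  "pullback_measure \<nu> = distr (restrict_space \<nu> (\<iota> ` mspace Z)) (borel_metric Z) (inv_into (mspace Z) \<iota>)"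

lemma emeasure_pullback_measure:
  assumes s: "sets \<nu> = sets (borel_metric Z')" and A: "A \<in> sets (borel_metric Z')"
  shows "emeasure (pullback_measure \<nu>) (\<iota> -` A \<inter> mspace Z) = emeasure \<nu> (A \<inter> \<iota> ` mspace Z)"
proof -
  have sp: "space \<nu> = mspace Z'" using sets_eq_imp_space_eq[OF s] by simp
  have sub: "\<iota> ` mspace Z \<subseteq> mspace Z'" using isometric_embeddingD(1)[OF \<iota>] by auto
  have "\<iota> -` A \<inter> mspace Z \<in> sets (borel_metric Z)"
    using measurable_sets[OF isometric_measurable[OF \<iota>] A] by simp
  then have "emeasure (pullback_measure \<nu>) (\<iota> -` A \<inter> mspace Z) = emeasure (restrict_space \<nu> (\<iota> ` mspace Z))
     (inv_into (mspace Z) \<iota> -` (\<iota> -` A \<inter> mspace Z) \<inter> space (restrict_space \<nu> (\<iota> ` mspace Z)))"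
    unfolding pullback_measure_def by (rule emeasure_distr[OF inv_into_isometric_measurable[OF \<iota> s]])
  also have "inv_into (mspace Z) \<iota> -` (\<iota> -` A \<inter> mspace Z) \<inter> space (restrict_space \<nu> (\<iota> ` mspace Z)) = A \<inter> \<iota> ` mspace Z"
    using sub by (auto simp: space_restrict_space sp inv_into_isometric[OF \<iota>])
  also have "emeasure (restrict_space \<nu> (\<iota> ` mspace Z)) (A \<inter> \<iota> ` mspace Z) = emeasure \<nu> (A \<inter> \<iota> ` mspace Z)"
    using sub isometric_image_borel by (intro emeasure_restrict_space) (auto simp: s sp Int_absorb2)
  finally show ?thesis .
qed

text \<open>
  Extend \<open>f\<close> and the \<open>\<pi>\<^sub>i\<close> to the ambient space without increasing the Lipschitz constants. A bound
  \<open>\<nu>\<close> of the push-forward could charge the complement of the image, which is removed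
    by splitting: off
  the image use the push-forward of a bound \<open>\<mu>\<close> of \<open>T\<close>, which does not charge that set.
\<close>

lemma mass_bound_pullback:
  assumes T: "additive_functional m Z T" "carrier_determined m Z T" and \<mu>: "mass_bound m Z T \<mu>"
    and \<nu>: "mass_bound m Z' (pushforward \<iota> T) \<nu>"
  shows "mass_bound m Z T (pullback_measure \<nu>)"
proof -
  have b: "finite_borel_measure Z' \<nu>" by (rule mass_bound_finite_borel_measure[OF \<nu>])
  have s: "sets \<nu> = sets (borel_metric Z')" using b by (simp add: finite_borel_measure_def)
  have s\<mu>: "sets \<mu> = sets (borel_metric Z)" using \<mu> by (simp add: mass_bound_def)
  have sp: "space \<nu> = mspace Z'" using sets_eq_imp_space_eq[OF s] by simp
  have sub: "\<iota> ` mspace Z \<subseteq> mspace Z'" using isometric_embeddingD(1)[OF \<iota>] by auto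
  have im: "\<iota> ` mspace Z \<inter> space \<nu> \<in> sets \<nu>"
    using isometric_image_borel sub by (simp add: s sp Int_absorb2)
  note jm = inv_into_isometric_measurable[OF \<iota> s]
  show ?thesis unfolding mass_bound_def
  proof (intro conjI allI impI)
    show "space (pullback_measure \<nu>) = mspace Z" "sets (pullback_measure \<nu>) = sets (borel_metric Z)"
      by (simp_all add: pullback_measure_def)
    have "finite_measure (restrict_space \<nu> (\<iota> ` mspace Z))"
      using \<nu> im isometric_image_borel
        by (intro finite_measure_restrict_space) (auto simp: mass_bound_def)
    then show "finite_measure (pullback_measure \<nu>)"
      unfolding pullback_measure_def by (rule finite_measure.finite_measure_distr[OF _ jm])
    fix f \<pi> assume f: "adm m Z f \<pi>"
    obtain f' where f': "blip_fun Z' f'" "\<And>x. x \<in> mspace Z \<Longrightarrow> f' (\<iota> x) = f x"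
      using bounded_mcshane_extension[OF \<iota> adm_blip[OF f]] by metis
    \<comment> \<open>A simultaneous choice of McShane extensions, to be applied to the whole list.\<close>
    have "\<forall>p. \<exists>q. lip_fun Z p \<longrightarrow> lip_fun Z' q \<and> (\<forall>x\<in>mspace Z. q (\<iota> x) = p x) \<and> Lip Z' euclidean_metric q \<le> Lip Z euclidean_metric p"
      using mcshane_extension[OF \<iota>] by metis
    then obtain E where E: "\<And>p. lip_fun Z p \<Longrightarrow> lip_fun Z' (E p)"
      "\<And>p x. lip_fun Z p \<Longrightarrow> x \<in> mspace Z \<Longrightarrow> E p (\<iota> x) = p x"
      "\<And>p. lip_fun Z p \<Longrightarrow> Lip Z' euclidean_metric (E p) \<le> Lip Z euclidean_metric p"
        by metis
    have \<pi>: "length \<pi> = m" "\<And>p. p \<in> set \<pi> \<Longrightarrow> lip_fun Z p"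
      using f by (auto simp: adm_def)
    have a': "adm m Z' f' (map E \<pi>)" using f' \<pi> E(1) by (auto simp: adm_def)
    have eq: "T f \<pi> = pushforward \<iota> T f' (map E \<pi>)"
      unfolding pushforward_def
      by (rule carrier_determinedD[OF T(2) f adm_compose_isometric[OF \<iota> a']]) (use f' E \<pi> in auto)
    have f'm: "f' \<in> borel_measurable (borel_metric Z')" by (rule blip_fun_measurable[OF f'(1)])
    have fm: "f \<in> borel_measurable (borel_metric Z)" by (rule blip_fun_measurable[OF adm_blip[OF f]])
    have \<iota>m: "\<iota> \<in> measurable \<mu> (borel_metric Z')"
      using isometric_measurable[OF \<iota>] measurable_cong_sets[OF s\<mu> refl] by blast
    have "\<bar>T f \<pi>\<bar> \<le> lip_prod Z' (map E \<pi>) *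
       ((LINT y|\<nu>. indicator (\<iota> ` mspace Z) y * \<bar>f' y\<bar>) +
        (LINT y|distr \<mu> (borel_metric Z') \<iota>. (1 - indicator (\<iota> ` mspace Z) y) * \<bar>f' y\<bar>))"
      unfolding eq
      by (rule mass_bound_split[OF additive_pushforward[OF \<iota> T(1)] mass_bound_pushforward[OF \<iota> \<mu>] \<nu> isometric_image_borel a'])
    also have "(LINT y|distr \<mu> (borel_metric Z') \<iota>. (1 - indicator (\<iota> ` mspace Z) y) * \<bar>f' y\<bar>) = 
        (LINT x|\<mu>. (1 - indicator (\<iota> ` mspace Z) (\<iota> x)) * \<bar>f' (\<iota> x)\<bar>)"
      using \<iota>m f'm isometric_image_borel by (intro integral_distr) auto
    also have "\<dots> = (LINT x|\<mu>. 0)"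
      by (rule Bochner_Integration.integral_cong) (use sets_eq_imp_space_eq[OF s\<mu>] in auto)
    also have "(LINT y|\<nu>. indicator (\<iota> ` mspace Z) y * \<bar>f' y\<bar>) = (LINT y|\<nu>. indicator (\<iota> ` mspace Z) y *\<^sub>R \<bar>f (inv_into (mspace Z) \<iota> y)\<bar>)"
      by (rule Bochner_Integration.integral_cong) (use f'(2) in \<open>auto simp: indicator_def inv_into_isometric[OF \<iota>]\<close>)
    also have "\<dots> = (LINT y|restrict_space \<nu> (\<iota> ` mspace Z). \<bar>f (inv_into (mspace Z) \<iota> y)\<bar>)"
      by (rule integral_restrict_space[OF im, symmetric])
    also have "\<dots> = (LINT x|pullback_measure \<nu>. \<bar>f x\<bar>)"
      unfolding pullback_measure_def using fm by (intro integral_distr[OF jm, symmetric]) auto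
    finally have "\<bar>T f \<pi>\<bar> \<le> lip_prod Z' (map E \<pi>) * (LINT x|pullback_measure \<nu>. \<bar>f x\<bar>)"
      by simp
    also have "\<dots> \<le> lip_prod Z \<pi> * (LINT x|pullback_measure \<nu>. \<bar>f x\<bar>)"
    proof (intro mult_right_mono lip_prod_mono)
      show "list_all2 (\<lambda>p q. lip_fun Z' p \<and> Lip Z' euclidean_metric p \<le> Lip Z euclidean_metric q) (map E \<pi>) \<pi>"
        using \<pi> E by (auto simp: list_all2_conv_all_nth)
    qed simp
    finally show "\<bar>T f \<pi>\<bar> \<le> lip_prod Z \<pi> * (LINT x|pullback_measure \<nu>. \<bar>f x\<bar>)" .
  qed
qed

text \<open>
  Bounds can be pushed forward and pulled back, and a bound of the push-forward dominates its own
  restriction to the image, so minimality is inherited.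
\<close>

lemma minimal_mass_bound_pushforward:
  assumes T: "additive_functional m Z T" "carrier_determined m Z T" and \<mu>: "minimal_mass_bound m Z T \<mu>"
  shows "minimal_mass_bound m Z' (pushforward \<iota> T) (distr \<mu> (borel_metric Z') \<iota>)"
  unfolding minimal_mass_bound_def
proof (intro conjI allI impI ballI)
  have mb: "mass_bound m Z T \<mu>" using \<mu> by (simp add: minimal_mass_bound_def)
  have s\<mu>: "sets \<mu> = sets (borel_metric Z)" using mb by (simp add: mass_bound_def)
  have sp: "space \<mu> = mspace Z" using sets_eq_imp_space_eq[OF s\<mu>] by simp
  have \<iota>m: "\<iota> \<in> measurable \<mu> (borel_metric Z')"
    using isometric_measurable[OF \<iota>] measurable_cong_sets[OF s\<mu> refl] by blast
  show "mass_bound m Z' (pushforward \<iota> T) (distr \<mu> (borel_metric Z') \<iota>)"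
    by (rule mass_bound_pushforward[OF \<iota> mb])
  fix \<nu> A assume \<nu>: "mass_bound m Z' (pushforward \<iota> T) \<nu>" and A: "A \<in> sets (borel_metric Z')"
  have s: "sets \<nu> = sets (borel_metric Z')" using \<nu> by (simp add: mass_bound_def)
  have "\<iota> -` A \<inter> mspace Z \<in> sets (borel_metric Z)"
    using measurable_sets[OF isometric_measurable[OF \<iota>] A] by simp
  then have "emeasure \<mu> (\<iota> -` A \<inter> mspace Z) \<le> emeasure (pullback_measure \<nu>) (\<iota> -` A \<inter> mspace Z)"
    using \<mu> mass_bound_pullback[OF T mb \<nu>] unfolding minimal_mass_bound_def by blast
  also have "\<dots> = emeasure \<nu> (A \<inter> \<iota> ` mspace Z)"
    by (rule emeasure_pullback_measure[OF s A])
  also have "\<dots> \<le> emeasure \<nu> A" using A by (intro emeasure_mono) (auto simp: s)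
  finally show "emeasure (distr \<mu> (borel_metric Z') \<iota>) A \<le> emeasure \<nu> A"
    using \<iota>m A by (subst emeasure_distr) (auto simp: sp)
qed

lemma mass_measure_pushforward:
  assumes T: "additive_functional m Z T" "carrier_determined m Z T" and \<mu>: "mass_bound m Z T \<mu>"
  shows "mass_measure m Z' (pushforward \<iota> T) = distr (mass_measure m Z T) (borel_metric Z') \<iota>"
  by (rule mass_measure_eqI[OF minimal_mass_bound_pushforward[OF T minimal_mass_measure[OF T(1) \<mu>]]])

lemma mass_pushforward:
  assumes T: "additive_functional m Z T" "carrier_determined m Z T" and \<mu>: "mass_bound m Z T \<mu>"
  shows "mass m Z' (pushforward \<iota> T) = mass m Z T"
proof -
  note mm = mass_bound_mass_measure[OF T(1) \<mu>]
  then have s: "sets (mass_measure m Z T) = sets (borel_metric Z)" and sp: "space (mass_measure m Z T) = mspace Z"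
    by (simp_all add: mass_bound_def)
  have \<iota>m: "\<iota> \<in> measurable (mass_measure m Z T) (borel_metric Z')"
    using isometric_measurable[OF \<iota>] measurable_cong_sets[OF s refl] by blast
  have "mspace Z' \<in> sets (borel_metric Z')" by (metis sets.top space_borel_metric)
  then have "emeasure (distr (mass_measure m Z T) (borel_metric Z') \<iota>) (mspace Z') = emeasure (mass_measure m Z T) (mspace Z)"
    using \<iota>m isometric_embeddingD(1)[OF \<iota>]
      by (subst emeasure_distr) (auto simp: sp intro!: arg_cong[where f = "emeasure (mass_measure m Z T)"])
  then show ?thesis
    unfolding mass_def using mass_measure_pushforward[OF T \<mu>] mass_bound_pushforward[OF \<iota> mm] mm
      by auto
qed

end

section \<open>Isometric push-forwards of integral currents\<close>

lemma metric_diameter_isometric: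
  assumes \<iota>: "isometric_embedding Z Z' \<iota>" and C: "C \<subseteq> mspace Z"
  shows "metric_diameter Z' (\<iota> ` C) = metric_diameter Z C"
  unfolding metric_diameter_def image_image
  using isometric_embeddingD(2)[OF \<iota>] C by (intro SUP_cong refl) (auto simp: subset_iff)

lemma metric_diameter_mono: "C \<subseteq> D \<Longrightarrow> metric_diameter Z C \<le> metric_diameter Z D"
  unfolding metric_diameter_def by (intro SUP_subset_mono) auto

text \<open>
  A way \<open>\<Phi>\<close> to turn covers into covers without increasing diameters compares Hausdorff measures; it is
  used for images and for preimages. Empty sets must be sent to empty sets, because a nonempty set of
  diameter zero counts in dimension zero.
\<close>

lemma hausdorff_measure_le:
  fixes \<Phi> :: "'a set \<Rightarrow> 'b set"
  assumes \<Phi>: "\<Phi> {} = {}" "\<And>C. C \<subseteq> mspace Z \<Longrightarrow> \<Phi> C \<subseteq> mspace Z'"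
    "\<And>C. C \<subseteq> mspace Z \<Longrightarrow> metric_diameter Z' (\<Phi> C) \<le> metric_diameter Z C"
    and cover: "\<And>C :: nat \<Rightarrow> 'a set. S \<subseteq> (\<Union>n. C n) \<Longrightarrow> S' \<subseteq> (\<Union>n. \<Phi> (C n))"
  shows "hausdorff_measure m Z' S' \<le> hausdorff_measure m Z S"
  unfolding hausdorff_measure_def
proof (rule SUP_mono, rule bexI)
  fix \<delta> :: real
  let ?cost = "\<lambda>Z C. \<Sum>n. if C n = {} then 0 else ennreal (unit_ball_vol (real m)) * (metric_diameter Z (C n) / 2) ^ m"
  show "(INF C\<in>{C :: nat \<Rightarrow> 'b set. S' \<subseteq> (\<Union>n. C n) \<and> (\<forall>n. C n \<subseteq> mspace Z' \<and> metric_diameter Z' (C n) \<le> ennreal \<delta>)}. ?cost Z' C)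
      \<le> (INF C\<in>{C :: nat \<Rightarrow> 'a set. S \<subseteq> (\<Union>n. C n) \<and> (\<forall>n. C n \<subseteq> mspace Z \<and> metric_diameter Z (C n) \<le> ennreal \<delta>)}. ?cost Z C)"
  proof (rule INF_mono)
    fix C :: "nat \<Rightarrow> 'a set"
    assume "C \<in> {C. S \<subseteq> (\<Union>n. C n) \<and> (\<forall>n. C n \<subseteq> mspace Z \<and> metric_diameter Z (C n) \<le> ennreal \<delta>)}"
    then have C: "S \<subseteq> (\<Union>n. C n)" "\<And>n. C n \<subseteq> mspace Z" "\<And>n. metric_diameter Z (C n) \<le> ennreal \<delta>"
      by auto
    have "?cost Z' (\<lambda>n. \<Phi> (C n)) \<le> ?cost Z C"
    proof (rule suminf_le)
      fix n
      show "(if \<Phi> (C n) = {} then 0 else ennreal (unit_ball_vol (real m)) * (metric_diameter Z' (\<Phi> (C n)) / 2) ^ m)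
         \<le> (if C n = {} then 0 else ennreal (unit_ball_vol (real m)) * (metric_diameter Z (C n) / 2) ^ m)"
        using \<Phi>(1) \<Phi>(3)[OF C(2)[of n]]
          by (auto intro!: mult_left_mono power_mono divide_right_mono_ennreal)
    qed auto
    moreover have "(\<lambda>n. \<Phi> (C n)) \<in> {C. S' \<subseteq> (\<Union>n. C n) \<and> (\<forall>n. C n \<subseteq> mspace Z' \<and> metric_diameter Z' (C n) \<le> ennreal \<delta>)}"
      using C cover[OF C(1)] \<Phi>(2) order_trans[OF \<Phi>(3)] by auto
    ultimately show "\<exists>D\<in>{C. S' \<subseteq> (\<Union>n. C n) \<and> (\<forall>n. C n \<subseteq> mspace Z' \<and> metric_diameter Z' (C n) \<le> ennreal \<delta>)}. ?cost Z' D \<le> ?cost Z C"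
      by (intro bexI[of _ "\<lambda>n. \<Phi> (C n)"])
  qed
qed

lemma blip_fun_compose_Lipschitz:
  assumes \<phi>: "Lipschitz_continuous_map X Y \<phi>" and p: "blip_fun Y p"
  shows "blip_fun X (p \<circ> \<phi>)"
  using Lipschitz_continuous_map_compose[OF \<phi>] Lipschitz_continuous_map_image[OF \<phi>] p
  unfolding blip_fun_iff lip_fun_def by (auto simp: Pi_iff)

context
  fixes Z :: "'a metric" and Z' :: "'b metric" and \<iota>
  assumes \<iota>: "isometric_embedding Z Z' \<iota>"
begin

lemma hausdorff_measure_isometric_image:
  assumes "S \<subseteq> mspace Z"
  shows "hausdorff_measure m Z' (\<iota> ` S) \<le> hausdorff_measure m Z S"
proof (rule hausdorff_measure_le[where \<Phi> = "\<lambda>C. \<iota> ` C"])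
  fix C assume C: "C \<subseteq> mspace Z"
  show "\<iota> ` C \<subseteq> mspace Z'" using C isometric_embeddingD(1)[OF \<iota>] by auto
  show "metric_diameter Z' (\<iota> ` C) \<le> metric_diameter Z C"
    using metric_diameter_isometric[OF \<iota> C] by simp
qed (auto simp flip: image_UN)

lemma hausdorff_measure_isometric_preimage:
  "hausdorff_measure m Z (\<iota> -` N \<inter> mspace Z) \<le> hausdorff_measure m Z' N"
proof (rule hausdorff_measure_le[where \<Phi> = "\<lambda>C. \<iota> -` C \<inter> mspace Z"])
  fix C assume C: "C \<subseteq> mspace Z'"
  show "metric_diameter Z (\<iota> -` C \<inter> mspace Z) \<le> metric_diameter Z' C"
    using metric_diameter_isometric[OF \<iota>, of "\<iota> -` C \<inter> mspace Z"] metric_diameter_mono[of "\<iota> ` (\<iota> -` C \<inter> mspace Z)" C Z']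
      by auto
next
  fix C :: "nat \<Rightarrow> 'b set" assume "N \<subseteq> (\<Union>n. C n)"
  then show "\<iota> -` N \<inter> mspace Z \<subseteq> (\<Union>n. \<iota> -` C n \<inter> mspace Z)"
    by blast
qed auto

lemma multilinear_pushforward:
  assumes T: "multilinear_functional m Z T"
  shows "multilinear_functional m Z' (pushforward \<iota> T)"
  unfolding multilinear_functional_def
proof (intro conjI allI impI)
  fix f g \<pi> a b assume "adm m Z' f \<pi> \<and> adm m Z' g \<pi>"
  then have "adm m Z (f \<circ> \<iota>) (map (\<lambda>p. p \<circ> \<iota>) \<pi>) \<and> adm m Z (g \<circ> \<iota>) (map (\<lambda>p. p \<circ> \<iota>) \<pi>)"
    using adm_compose_isometric[OF \<iota>] by blast
  then have "T (\<lambda>x. a * (f \<circ> \<iota>) x + b * (g \<circ> \<iota>) x) (map (\<lambda>p. p \<circ> \<iota>) \<pi>) = a * T (f \<circ> \<iota>) (map (\<lambda>p. p \<circ> \<iota>) \<pi>) + b * T (g \<circ> \<iota>) (map (\<lambda>p. p \<circ> \<iota>) \<pi>)"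
    using T unfolding multilinear_functional_def by blast
  then show "pushforward \<iota> T (\<lambda>x. a * f x + b * g x) \<pi> = a * pushforward \<iota> T f \<pi> + b * pushforward \<iota> T g \<pi>"
    by (simp add: pushforward_def comp_def)
next
  fix f \<pi> i p q a b assume "adm m Z' f \<pi> \<and> i < m \<and> lip_fun Z' p \<and> lip_fun Z' q"
  then have "adm m Z (f \<circ> \<iota>) (map (\<lambda>p. p \<circ> \<iota>) \<pi>) \<and> i < m \<and> lip_fun Z (p \<circ> \<iota>) \<and> lip_fun Z (q \<circ> \<iota>)"
    using adm_compose_isometric[OF \<iota>] lip_fun_compose_isometric[OF \<iota>] by blast
  then have "T (f \<circ> \<iota>) ((map (\<lambda>p. p \<circ> \<iota>) \<pi>)[i := \<lambda>x. a * (p \<circ> \<iota>) x + b * (q \<circ> \<iota>) x]) =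
    a * T (f \<circ> \<iota>) ((map (\<lambda>p. p \<circ> \<iota>) \<pi>)[i := p \<circ> \<iota>]) + b * T (f \<circ> \<iota>) ((map (\<lambda>p. p \<circ> \<iota>) \<pi>)[i := q \<circ> \<iota>])"
    using T unfolding multilinear_functional_def by blast
  then show "pushforward \<iota> T f (\<pi>[i := \<lambda>x. a * p x + b * q x]) = a * pushforward \<iota> T f (\<pi>[i := p]) + b * pushforward \<iota> T f (\<pi>[i := q])"
    by (simp add: pushforward_def map_update comp_def)
qed

lemma local_pushforward:
  assumes T: "local_functional m Z T"
  shows "local_functional m Z' (pushforward \<iota> T)"
  unfolding local_functional_def
proof (intro allI impI, elim conjE exE)
  fix f \<pi> i U c
  assume f: "adm m Z' f \<pi>" and i: "i < m" and U: "openin (mtopology_of Z') U"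
    and fU: "{x \<in> mspace Z'. f x \<noteq> 0} \<subseteq> U" and c: "\<forall>x\<in>U. (\<pi> ! i) x = c"
  have f': "adm m Z (f \<circ> \<iota>) (map (\<lambda>p. p \<circ> \<iota>) \<pi>)"
    by (rule adm_compose_isometric[OF \<iota> f])
  have len: "length \<pi> = m" using f by (simp add: adm_def)
  have "openin (mtopology_of Z) {x \<in> topspace (mtopology_of Z). \<iota> x \<in> U}"
    by (rule openin_continuous_map_preimage[OF isometric_embedding_continuous[OF \<iota>] U])
  moreover have "{x \<in> mspace Z. (f \<circ> \<iota>) x \<noteq> 0} \<subseteq> {x \<in> topspace (mtopology_of Z). \<iota> x \<in> U}"
    using fU isometric_embeddingD(1)[OF \<iota>] by auto
  moreover have "\<forall>x\<in>{x \<in> topspace (mtopology_of Z). \<iota> x \<in> U}. (map (\<lambda>p. p \<circ> \<iota>) \<pi> ! i) x = c"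
    using c i len by auto
  ultimately have "T (f \<circ> \<iota>) (map (\<lambda>p. p \<circ> \<iota>) \<pi>) = 0"
    using T f' i unfolding local_functional_def by blast
  then show "pushforward \<iota> T f \<pi> = 0" by (simp add: pushforward_def)
qed

lemma continuous_pushforward:
  assumes T: "continuous_functional m Z T"
  shows "continuous_functional m Z' (pushforward \<iota> T)"
  unfolding continuous_functional_def
proof (intro allI impI, elim conjE)
  fix f \<pi> \<pi>s
  assume f: "adm m Z' f \<pi>" and s: "\<forall>j. adm m Z' f (\<pi>s j) \<and> (\<forall>p\<in>set (\<pi>s j). Lip Z' euclidean_metric p \<le> 1)"
    and lim: "\<forall>i<m. \<forall>x\<in>mspace Z'. (\<lambda>j. (\<pi>s j ! i) x) \<longlonglongrightarrow> (\<pi> ! i) x"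
  let ?c = "map (\<lambda>p. p \<circ> \<iota>)"
  have len: "length \<pi> = m" "\<And>j. length (\<pi>s j) = m" using f s by (auto simp: adm_def)
  have "adm m Z (f \<circ> \<iota>) (?c \<pi>)" by (rule adm_compose_isometric[OF \<iota> f])
  moreover have "\<forall>j. adm m Z (f \<circ> \<iota>) (?c (\<pi>s j)) \<and> (\<forall>p\<in>set (?c (\<pi>s j)). Lip Z euclidean_metric p \<le> 1)"
  proof (intro allI conjI ballI)
    fix j
    show "adm m Z (f \<circ> \<iota>) (?c (\<pi>s j))" using s adm_compose_isometric[OF \<iota>] by blast
    fix p assume "p \<in> set (?c (\<pi>s j))"
    then obtain q where q: "q \<in> set (\<pi>s j)" "p = q \<circ> \<iota>" by auto
    then have "lip_fun Z' q" using s by (auto simp: adm_def)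
    then show "Lip Z euclidean_metric p \<le> 1"
      using lip_fun_compose_isometric(2)[OF \<iota>, of q] s q by force
  qed
  moreover have "\<forall>i<m. \<forall>x\<in>mspace Z. (\<lambda>j. (?c (\<pi>s j) ! i) x) \<longlonglongrightarrow> (?c \<pi> ! i) x"
    using lim len isometric_embeddingD(1)[OF \<iota>] by simp
  ultimately have "(\<lambda>j. T (f \<circ> \<iota>) (?c (\<pi>s j))) \<longlonglongrightarrow> T (f \<circ> \<iota>) (?c \<pi>)"
    using T[unfolded continuous_functional_def, rule_format, of "f \<circ> \<iota>" "?c \<pi>" "\<lambda>j. ?c (\<pi>s j)"]
      by blast
  then show "(\<lambda>j. pushforward \<iota> T f (\<pi>s j)) \<longlonglongrightarrow> pushforward \<iota> T f \<pi>"
    by (simp add: pushforward_def)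
qed

lemma metric_current_pushforward:
  assumes T: "metric_current m Z T"
  shows "metric_current m Z' (pushforward \<iota> T)"
  using T multilinear_pushforward local_pushforward continuous_pushforward mass_bound_pushforward[OF \<iota>]
  unfolding metric_current_def by blast

lemma countably_rectifiable_isometric_image:
  assumes S: "countably_rectifiable m Z S"
  shows "countably_rectifiable m Z' (\<iota> ` S)"
proof -
  obtain A :: "nat \<Rightarrow> (nat \<Rightarrow> real) set" and g where SZ: "S \<subseteq> mspace Z"
    and A: "\<And>n. A n \<subseteq> mspace (euclidean_metric_of_dim m)"
    and g: "\<And>n. Lipschitz_continuous_map (submetric (euclidean_metric_of_dim m) (A n)) Z (g n)"
    and null: "hausdorff_measure m Z (S - (\<Union>n. g n ` A n)) = 0"
    using S unfolding countably_rectifiable_def by blast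
  have "Lipschitz_continuous_map (submetric (euclidean_metric_of_dim m) (A n)) Z' (\<iota> \<circ> g n)" for n
    by (rule Lipschitz_continuous_map_compose[OF g isometric_embedding_Lipschitz[OF \<iota>]])
  moreover have "hausdorff_measure m Z' (\<iota> ` S - (\<Union>n. (\<iota> \<circ> g n) ` A n)) = 0"
  proof -
    have gA: "g n ` A n \<subseteq> mspace Z" for n
      using Lipschitz_continuous_map_image[OF g[of n]] A[of n] by (auto simp: Pi_iff)
    have "\<iota> ` S - (\<Union>n. (\<iota> \<circ> g n) ` A n) = \<iota> ` (S - (\<Union>n. g n ` A n))"
      using isometric_inj_on[OF \<iota>] SZ gA by (auto simp: inj_on_def image_iff subset_iff) blast
    moreover have "hausdorff_measure m Z' (\<iota> ` (S - (\<Union>n. g n ` A n))) \<le> hausdorff_measure m Z (S - (\<Union>n. g n ` A n))"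
      using SZ by (intro hausdorff_measure_isometric_image) auto
    ultimately show ?thesis using null by simp
  qed
  moreover have "\<iota> ` S \<subseteq> mspace Z'" using SZ isometric_embeddingD(1)[OF \<iota>] by auto
  ultimately show ?thesis unfolding countably_rectifiable_def using A
    by (intro conjI exI[of _ A] exI[of _ "\<lambda>n. \<iota> \<circ> g n"]) simp_all
qed

end

context
  fixes Z :: "'a metric" and Z' :: "'b metric" and \<iota>
  assumes \<iota>: "isometric_embedding Z Z' \<iota>" and Zc: "mcomplete_of Z"
begin

text \<open>
  Balls around image points have the same mass as the corresponding balls in the domain, and a point off the
  image has a ball of mass zero since the image is closed.
\<close>

lemma current_set_pushforward:
  assumes T: "additive_functional m Z T" "carrier_determined m Z T" and \<mu>: "mass_bound m Z T \<mu>"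
  shows "current_set m Z' (pushforward \<iota> T) = \<iota> ` current_set m Z T"
proof -
  note mm = mass_bound_mass_measure[OF T(1) \<mu>]
  then have s: "sets (mass_measure m Z T) = sets (borel_metric Z)" and sp: "space (mass_measure m Z T) = mspace Z"
    by (simp_all add: mass_bound_def)
  have \<iota>m: "\<iota> \<in> measurable (mass_measure m Z T) (borel_metric Z')"
    using isometric_measurable[OF \<iota>] measurable_cong_sets[OF s refl] by blast
  define q where "q p r = ereal (measure (mass_measure m Z T) (\<iota> -` mball_of Z' p r \<inter> mspace Z) / (unit_ball_vol (real m) * r ^ m))" for p r
  have ball: "mball_of Z' p r \<in> sets (borel_metric Z')" for p r
    by (rule open_in_borel_metric[OF openin_mball_of])
  have q: "ereal (measure (mass_measure m Z' (pushforward \<iota> T)) (mball_of Z' p r) / (unit_ball_vol (real m) * r ^ m)) = q p r" for p r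
    unfolding mass_measure_pushforward[OF \<iota> Zc T \<mu>] q_def using measure_distr[OF \<iota>m ball]
      by (simp add: sp)
  have img: "ereal (measure (mass_measure m Z T) (mball_of Z x r) / (unit_ball_vol (real m) * r ^ m)) = q (\<iota> x) r" if "x \<in> mspace Z" for x r
  proof -
    have "\<iota> -` mball_of Z' (\<iota> x) r \<inter> mspace Z = mball_of Z x r"
      using that isometric_embeddingD[OF \<iota>] by auto
    then show ?thesis by (simp add: q_def)
  qed
  have off: "Liminf (at_right 0) (q p) = 0" if p: "p \<in> mspace Z'" "p \<notin> \<iota> ` mspace Z" for p
  proof -
    have "openin (mtopology_of Z') (mspace Z' - \<iota> ` mspace Z)"
      using isometric_image_closed[OF \<iota> Zc] by (auto simp: closedin_def)
    then obtain r where r: "r > 0" "mball_of Z' p r \<subseteq> mspace Z' - \<iota> ` mspace Z"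
    proof (rule openin_contains_mball_of)
      show "p \<in> mspace Z' - \<iota> ` mspace Z" using p by simp
    qed (rule that)
    have "\<forall>\<^sub>F s in at_right 0. q p s = 0"
      unfolding eventually_at_right_field
    proof (intro exI[of _ r] conjI allI impI r(1))
      fix t assume "0 < t" "t < r"
      then have "mball_of Z' p t \<subseteq> mball_of Z' p r" by (auto intro: less_trans)
      then have "\<iota> -` mball_of Z' p t \<inter> mspace Z = {}" using r(2) by blast
      then show "q p t = 0" by (simp add: q_def)
    qed
    then have "Liminf (at_right 0) (q p) = Liminf (at_right (0::real)) (\<lambda>_. 0 :: ereal)"
      by (rule Liminf_eq)
    then show ?thesis by (simp add: Liminf_const)
  qed
  show ?thesis
  proof (intro equalityI subsetI)
    fix p assume "p \<in> current_set m Z' (pushforward \<iota> T)"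
    then have p: "p \<in> mspace Z'" "Liminf (at_right 0) (q p) > 0" unfolding current_set_def q by auto
    then have "p \<in> \<iota> ` mspace Z" using off by force
    then obtain x where x: "x \<in> mspace Z" "p = \<iota> x" by auto
    then have "x \<in> current_set m Z T" unfolding current_set_def using p(2) by (simp add: img)
    then show "p \<in> \<iota> ` current_set m Z T" using x by blast
  next
    fix p assume "p \<in> \<iota> ` current_set m Z T"
    then obtain x where x: "x \<in> current_set m Z T" "p = \<iota> x" by auto
    then have xZ: "x \<in> mspace Z" by (simp add: current_set_def)
    then have "Liminf (at_right 0) (q p) > 0" using x by (simp add: current_set_def img)
    then show "p \<in> current_set m Z' (pushforward \<iota> T)"
      unfolding current_set_def q using x xZ isometric_embeddingD(1)[OF \<iota>] by simp
  qed
qed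

text \<open>
  Both restrictions are limits along approximations of the same function in \<open>L\<^sup>1\<close> of the mass
  measure. Composition with the embedding and bounded McShane extension turn the approximating
  sequences on the two spaces into each other, with the same errors and the same values, so the two
  descriptions of the limit agree.
\<close>

lemma restriction_pushforward:
  assumes T: "metric_current m Z T" and f: "adm m Z' f \<pi>" and A: "openin (mtopology_of Z') A"
  shows "restriction m Z' (pushforward \<iota> T) A f \<pi> =
    restriction m Z T (\<iota> -` A \<inter> mspace Z) (f \<circ> \<iota>) (map (\<lambda>p. p \<circ> \<iota>) \<pi>)"
proof -
  note ad = metric_current_facts(2)[OF T] and cd = metric_current_facts(3)[OF T]
    and \<mu> = metric_current_facts(5)[OF T]
  then have s: "sets (mass_measure m Z T) = sets (borel_metric Z)" and sp: "space (mass_measure m Z T) = mspace Z"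
    by (simp_all add: mass_bound_def)
  have \<iota>m: "\<iota> \<in> measurable (mass_measure m Z T) (borel_metric Z')"
    using isometric_measurable[OF \<iota>] measurable_cong_sets[OF s refl] by blast
  let ?c = "map (\<lambda>p. p \<circ> \<iota>) \<pi>"
  have fm: "f \<in> borel_measurable (borel_metric Z')" by (rule blip_fun_measurable[OF adm_blip[OF f]])
  have Am: "A \<in> sets (borel_metric Z')" by (rule open_in_borel_metric[OF A])
  have f': "adm m Z (f \<circ> \<iota>) ?c" by (rule adm_compose_isometric[OF \<iota> f])
  have int: "(LINT x|mass_measure m Z' (pushforward \<iota> T). \<bar>g x - indicator A x * f x\<bar>) =
      (LINT x|mass_measure m Z T. \<bar>h x - indicator (\<iota> -` A \<inter> mspace Z) x * (f \<circ> \<iota>) x\<bar>)"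
    if "blip_fun Z' g" "\<And>x. x \<in> mspace Z \<Longrightarrow> g (\<iota> x) = h x" for g h
  proof -
    have "(LINT x|mass_measure m Z' (pushforward \<iota> T). \<bar>g x - indicator A x * f x\<bar>) =
      (LINT x|mass_measure m Z T. \<bar>g (\<iota> x) - indicator A (\<iota> x) * f (\<iota> x)\<bar>)"
      unfolding mass_measure_pushforward[OF \<iota> Zc ad cd \<mu>]
      using \<iota>m blip_fun_measurable[OF that(1)] fm Am by (intro integral_distr) auto
    also have "\<dots> = (LINT x|mass_measure m Z T. \<bar>h x - indicator (\<iota> -` A \<inter> mspace Z) x * (f \<circ> \<iota>) x\<bar>)"
      by (rule Bochner_Integration.integral_cong) (use that(2) in \<open>auto simp: sp indicator_def\<close>)
    finally show ?thesis .
  qed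
  have "(\<exists>g. (\<forall>n. blip_fun Z' (g n)) \<and>
        (\<lambda>n. LINT x|mass_measure m Z' (pushforward \<iota> T). \<bar>g n x - indicator A x * f x\<bar>) \<longlonglongrightarrow> 0 \<and>
        (\<lambda>n. pushforward \<iota> T (g n) \<pi>) \<longlonglongrightarrow> l) \<longleftrightarrow>
      (\<exists>h. (\<forall>n. blip_fun Z (h n)) \<and>
        (\<lambda>n. LINT x|mass_measure m Z T. \<bar>h n x - indicator (\<iota> -` A \<inter> mspace Z) x * (f \<circ> \<iota>) x\<bar>) \<longlonglongrightarrow> 0 \<and>
        (\<lambda>n. T (h n) ?c) \<longlonglongrightarrow> l)" (is "(\<exists>g. ?P g) \<longleftrightarrow> (\<exists>h. ?Q h)") for l
  proof
    assume "\<exists>g. ?P g"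
    then obtain g where g: "?P g" ..
    have eq: "(LINT x|mass_measure m Z' (pushforward \<iota> T). \<bar>g n x - indicator A x * f x\<bar>) =
      (LINT x|mass_measure m Z T. \<bar>(g n \<circ> \<iota>) x - indicator (\<iota> -` A \<inter> mspace Z) x * (f \<circ> \<iota>) x\<bar>)" for n
      using g by (intro int) auto
    have "?Q (\<lambda>n. g n \<circ> \<iota>)"
      using g blip_fun_compose_isometric[OF \<iota>] unfolding eq by (auto simp: pushforward_def)
    then show "\<exists>h. ?Q h" by (rule exI[where x = "\<lambda>n. g n \<circ> \<iota>"])
  next
    assume "\<exists>h. ?Q h"
    then obtain h where h: "?Q h" ..
    have "\<forall>n. \<exists>g. blip_fun Z' g \<and> (\<forall>x\<in>mspace Z. g (\<iota> x) = h n x)"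
      using bounded_mcshane_extension[OF \<iota>] h by metis
    then obtain g where g: "\<And>n. blip_fun Z' (g n)" "\<And>n x. x \<in> mspace Z \<Longrightarrow> g n (\<iota> x) = h n x"
      by metis
    have eq: "(LINT x|mass_measure m Z' (pushforward \<iota> T). \<bar>g n x - indicator A x * f x\<bar>) =
      (LINT x|mass_measure m Z T. \<bar>h n x - indicator (\<iota> -` A \<inter> mspace Z) x * (f \<circ> \<iota>) x\<bar>)" for n
      using g by (intro int) auto
    have eqT: "pushforward \<iota> T (g n) \<pi> = T (h n) ?c" for n
      unfolding pushforward_def
    proof (rule carrier_determinedD[OF cd])
      show "adm m Z (h n) ?c" by (rule adm_cong_fun[OF f']) (use h in auto)
      show "adm m Z (g n \<circ> \<iota>) ?c"
        by (rule adm_cong_fun[OF f' blip_fun_compose_isometric[OF \<iota> g(1)]])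
    qed (use g in auto)
    have "?P g" using g(1) h unfolding eq eqT by auto
    then show "\<exists>g. ?P g" by (rule exI[where x = g])
  qed
  then show ?thesis unfolding restriction_def borel_extension_def by simp
qed

text \<open>
  Each clause is pulled back along the embedding: a Lipschitz map to Euclidean space composed with
  the embedding is again one, and preimages of open or null sets are open or null.
\<close>

lemma integer_rectifiable_pushforward:
  assumes T: "integer_rectifiable m Z T"
  shows "integer_rectifiable m Z' (pushforward \<iota> T)"
proof -
  have mc: "metric_current m Z T" using T by (simp add: integer_rectifiable_def)
  note ad = metric_current_facts(2)[OF mc] and cd = metric_current_facts(3)[OF mc]
    and \<mu> = metric_current_facts(5)[OF mc]
  then have s: "sets (mass_measure m Z T) = sets (borel_metric Z)" and sp: "space (mass_measure m Z T) = mspace Z"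
    by (simp_all add: mass_bound_def)
  have \<iota>m: "\<iota> \<in> measurable (mass_measure m Z T) (borel_metric Z')"
    using isometric_measurable[OF \<iota>] measurable_cong_sets[OF s refl] by blast
  show ?thesis
  proof (cases "m = 0")
    case True
    then obtain n and p :: "nat \<Rightarrow> 'a" and \<sigma> :: "nat \<Rightarrow> real" and \<theta> :: "nat \<Rightarrow> nat"
      where p: "\<And>j. j < n \<Longrightarrow> p j \<in> mspace Z \<and> \<sigma> j \<in> {1, -1} \<and> \<theta> j > 0"
      and Tf: "\<And>f. blip_fun Z f \<Longrightarrow> T f [] = (\<Sum>j<n. \<sigma> j * real (\<theta> j) * f (p j))"
      using T unfolding integer_rectifiable_def by auto
    have "\<forall>j<n. \<iota> (p j) \<in> mspace Z' \<and> \<sigma> j \<in> {1, -1} \<and> \<theta> j > 0"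
      using p isometric_embeddingD(1)[OF \<iota>] by blast
    moreover have "\<forall>f. blip_fun Z' f \<longrightarrow> pushforward \<iota> T f [] = (\<Sum>j<n. \<sigma> j * real (\<theta> j) * f (\<iota> (p j)))"
      using Tf blip_fun_compose_isometric[OF \<iota>] by (auto simp: pushforward_def)
    ultimately show ?thesis
      unfolding integer_rectifiable_def using metric_current_pushforward[OF \<iota> mc] True
      by (simp, intro exI[of _ n] exI[of _ "\<lambda>j. \<iota> (p j)"] exI[of _ \<sigma>] exI[of _ \<theta>]) blast
  next
    case False
    then have cr: "countably_rectifiable m Z (current_set m Z T)"
      and null: "\<And>N. N \<in> sets (borel_metric Z) \<Longrightarrow> hausdorff_measure m Z N = 0 \<Longrightarrow> emeasure (mass_measure m Z T) N = 0"
      and ex: "\<And>\<phi> A. Lipschitz_continuous_map Z (euclidean_metric_of_dim m) \<phi> \<Longrightarrow> openin (mtopology_of Z) A \<Longrightarrow>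
           (\<exists>\<theta>. integrable (lebesgue_of_dim m) \<theta> \<and>
                (\<forall>x\<in>mspace (euclidean_metric_of_dim m). \<theta> x \<in> \<int>) \<and>
                (\<forall>f \<pi>. adm m (euclidean_metric_of_dim m) f \<pi> \<longrightarrow>
                   pushforward \<phi> (restriction m Z T A) f \<pi> = integration_current m \<theta> f \<pi>))"
      using T unfolding integer_rectifiable_def by auto
    show ?thesis unfolding integer_rectifiable_def if_not_P[OF False]
    proof (intro conjI ballI allI impI)
      show "metric_current m Z' (pushforward \<iota> T)" by (rule metric_current_pushforward[OF \<iota> mc])
      show "countably_rectifiable m Z' (current_set m Z' (pushforward \<iota> T))"
        unfolding current_set_pushforward[OF ad cd \<mu>]
          by (rule countably_rectifiable_isometric_image[OF \<iota> cr])
      fix N assume N: "N \<in> sets (borel_metric Z')" "hausdorff_measure m Z' N = 0"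
      have "hausdorff_measure m Z (\<iota> -` N \<inter> mspace Z) = 0"
        using hausdorff_measure_isometric_preimage[OF \<iota>, of m N] N(2) by simp
      then have "emeasure (mass_measure m Z T) (\<iota> -` N \<inter> mspace Z) = 0"
        using measurable_sets[OF \<iota>m N(1)] by (intro null) (simp_all add: s sp)
      then show "emeasure (mass_measure m Z' (pushforward \<iota> T)) N = 0"
        unfolding mass_measure_pushforward[OF \<iota> Zc ad cd \<mu>] using \<iota>m N(1)
          by (subst emeasure_distr) (simp_all add: sp)
    next
      fix \<phi> A assume "Lipschitz_continuous_map Z' (euclidean_metric_of_dim m) \<phi> \<and> openin (mtopology_of Z') A"
      then have \<phi>: "Lipschitz_continuous_map Z' (euclidean_metric_of_dim m) \<phi>" and A: "openin (mtopology_of Z') A"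
        by auto
      have "Lipschitz_continuous_map Z (euclidean_metric_of_dim m) (\<phi> \<circ> \<iota>)"
        by (rule Lipschitz_continuous_map_compose[OF isometric_embedding_Lipschitz[OF \<iota>] \<phi>])
      moreover have "openin (mtopology_of Z) (\<iota> -` A \<inter> mspace Z)"
        using openin_continuous_map_preimage[OF isometric_embedding_continuous[OF \<iota>] A]
        by (simp add: vimage_def Collect_conj_eq Int_commute)
      ultimately obtain \<theta> where \<theta>: "integrable (lebesgue_of_dim m) \<theta>" "\<forall>x\<in>mspace (euclidean_metric_of_dim m). \<theta> x \<in> \<int>"
        and eq: "\<And>f \<pi>. adm m (euclidean_metric_of_dim m) f \<pi> \<Longrightarrow>
                   pushforward (\<phi> \<circ> \<iota>) (restriction m Z T (\<iota> -` A \<inter> mspace Z)) f \<pi> = integration_current m \<theta> f \<pi>"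
        using ex by blast
      have "pushforward \<phi> (restriction m Z' (pushforward \<iota> T) A) f \<pi> = integration_current m \<theta> f \<pi>"
        if f: "adm m (euclidean_metric_of_dim m) f \<pi>" for f \<pi>
      proof -
        have "adm m Z' (f \<circ> \<phi>) (map (\<lambda>p. p \<circ> \<phi>) \<pi>)"
          using f blip_fun_compose_Lipschitz[OF \<phi>] Lipschitz_continuous_map_compose[OF \<phi>]
          by (auto simp: adm_def lip_fun_def)
        from restriction_pushforward[OF mc this A]
        have "pushforward \<phi> (restriction m Z' (pushforward \<iota> T) A) f \<pi> =
          pushforward (\<phi> \<circ> \<iota>) (restriction m Z T (\<iota> -` A \<inter> mspace Z)) f \<pi>"
          by (simp add: pushforward_def comp_assoc comp_def)
        then show ?thesis using eq[OF f] by simp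
      qed
      then show "\<exists>\<theta>. integrable (lebesgue_of_dim m) \<theta> \<and>
                (\<forall>x\<in>mspace (euclidean_metric_of_dim m). \<theta> x \<in> \<int>) \<and>
                (\<forall>f \<pi>. adm m (euclidean_metric_of_dim m) f \<pi> \<longrightarrow>
                   pushforward \<phi> (restriction m Z' (pushforward \<iota> T) A) f \<pi> = integration_current m \<theta> f \<pi>)"
        using \<theta> by blast
    qed
  qed
qed

lemma metric_current_mass_pushforward:
  assumes "metric_current m Z T" shows "mass m Z' (pushforward \<iota> T) = mass m Z T"
proof -
  note T = metric_current_facts[OF assms]
  show ?thesis by (rule mass_pushforward[OF \<iota> Zc T(2,3,5)])
qed

lemma integral_current_pushforward:
  assumes T: "integral_current m Z T"
  shows "integral_current m Z' (pushforward \<iota> T)"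
proof -
  have ir: "integer_rectifiable m Z T" and fin: "mass (m - 1) Z (boundary m T) < \<infinity>"
    using T by (auto simp: integral_current_def)
  then have mc: "metric_current m Z T" by (simp add: integer_rectifiable_def)
  note facts = metric_current_facts[OF mc]
  obtain \<nu> where \<nu>: "mass_bound (m - 1) Z (boundary m T) \<nu>"
    using fin by (auto simp: mass_def split: if_splits)
  have "mass (m - 1) Z' (boundary m (pushforward \<iota> T)) = mass (m - 1) Z (boundary m T)"
    unfolding boundary_pushforward
    by (rule mass_pushforward[OF \<iota> Zc boundary_additive[OF facts(1)]
          boundary_carrier_determined[OF facts(3)] \<nu>])
  then show ?thesis using integer_rectifiable_pushforward[OF ir] fin by (simp add: integral_current_def)
qed

text \<open>
  A decomposition \<open>S - T = U + \<partial>V\<close> is pushed forward to one of the same total mass.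
\<close>

lemma flat_dist_pushforward:
  "flat_dist m Z' (pushforward \<iota> S) (pushforward \<iota> T) \<le> flat_dist m Z S T"
  unfolding flat_dist_def
proof (rule INF_mono, clarify)
  fix U V assume U: "integral_current m Z U" and V: "integral_current (Suc m) Z V"
    and eq: "\<forall>f \<pi>. adm m Z f \<pi> \<longrightarrow> S f \<pi> - T f \<pi> = U f \<pi> + boundary (Suc m) V f \<pi>"
  have "metric_current m Z U" "metric_current (Suc m) Z V"
    using U V by (auto simp: integral_current_def integer_rectifiable_def)
  then have "mass m Z' (pushforward \<iota> U) + mass (Suc m) Z' (pushforward \<iota> V) = mass m Z U + mass (Suc m) Z V"
    by (simp add: metric_current_mass_pushforward)
  moreover have "\<forall>f \<pi>. adm m Z' f \<pi> \<longrightarrow> pushforward \<iota> S f \<pi> - pushforward \<iota> T f \<pi> = pushforward \<iota> U f \<pi> + boundary (Suc m) (pushforward \<iota> V) f \<pi>"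
    unfolding boundary_pushforward unfolding pushforward_def using eq adm_compose_isometric[OF \<iota>]
      by blast
  ultimately show "\<exists>UV\<in>{(U, V). integral_current m Z' U \<and> integral_current (Suc m) Z' V \<and>
          (\<forall>f \<pi>. adm m Z' f \<pi> \<longrightarrow> pushforward \<iota> S f \<pi> - pushforward \<iota> T f \<pi> = U f \<pi> + boundary (Suc m) V f \<pi>)}.
     (case UV of (U', V') \<Rightarrow> mass m Z' U' + mass (Suc m) Z' V') \<le> mass m Z U + mass (Suc m) Z V"
    using integral_current_pushforward[OF U] integral_current_pushforward[OF V]
    by (intro bexI[of _ "(pushforward \<iota> U, pushforward \<iota> V)"]) auto
qed

end

section \<open>Gluing metric spaces along a common subspace\<close>

text \<open>
  The disjoint union of the spaces \<open>Y\<^sub>i\<close> with the copies \<open>\<psi>\<^sub>i A\<close> of \<open>A\<close> identified. A path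
  between different pieces has to cross \<open>A\<close>, which dictates the distance between them.
\<close>

locale glued_spaces =
  fixes A :: "'c metric" and Y :: "nat \<Rightarrow> 'z metric" and \<psi> :: "nat \<Rightarrow> 'c \<Rightarrow> 'z"
  assumes A_nonempty: "mspace A \<noteq> {}" and A_complete: "mcomplete_of A"
    and Y_complete: "\<And>i. mcomplete_of (Y i)"
    and \<psi>: "\<And>i. isometric_embedding A (Y i) (\<psi> i)"
begin

text \<open>
  The two orientations of the distance from a point to \<open>a\<close> inside the piece of that point, so that
  a path through \<open>a\<close> reads from left to right.
\<close>

abbreviation leg :: "nat \<times> 'z \<Rightarrow> 'c \<Rightarrow> real" where
  "leg s a \<equiv> mdist (Y (fst s)) (snd s) (\<psi> (fst s) a)"

abbreviation leg' :: "nat \<times> 'z \<Rightarrow> 'c \<Rightarrow> real" where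
  "leg' s a \<equiv> mdist (Y (fst s)) (\<psi> (fst s) a) (snd s)"

definition bridge_dist :: "nat \<times> 'z \<Rightarrow> nat \<times> 'z \<Rightarrow> real" where
  "bridge_dist s t = (INF a\<in>mspace A. leg s a + leg' t a)"

definition glue_dist :: "nat \<times> 'z \<Rightarrow> nat \<times> 'z \<Rightarrow> real" where
  "glue_dist s t = (if fst s = fst t then mdist (Y (fst s)) (snd s) (snd t) else bridge_dist s t)"

text \<open>
  The disjoint union before identification; \<open>glue_dist\<close> is a pseudometric on it.
\<close>

definition pts :: "(nat \<times> 'z) set" where "pts = {s. snd s \<in> mspace (Y (fst s))}"

text \<open>
  One representative for each class of points at distance zero: a point of \<open>A\<close> is kept only in the
  piece with index \<open>0\<close>.
\<close>

definition glue_carrier :: "(nat \<times> 'z) set" where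
  "glue_carrier = {s \<in> pts. fst s = 0 \<or> snd s \<notin> \<psi> (fst s) ` mspace A}"

definition glue_metric :: "(nat \<times> 'z) metric" where
  "glue_metric = metric (glue_carrier, glue_dist)"

text \<open>
  The map of a piece to the representatives; it moves points by distance zero, which is why it is
  isometric.
\<close>

definition glue_map :: "nat \<Rightarrow> 'z \<Rightarrow> nat \<times> 'z" where
  "glue_map i z = (if z \<in> \<psi> i ` mspace A then (0, \<psi> 0 (inv_into (mspace A) (\<psi> i) z)) else (i, z))"

lemma \<psi>_in: "a \<in> mspace A \<Longrightarrow> \<psi> i a \<in> mspace (Y i)"
  and \<psi>_dist: "a \<in> mspace A \<Longrightarrow> b \<in> mspace A \<Longrightarrow> mdist (Y i) (\<psi> i a) (\<psi> i b) = mdist A a b"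
  using isometric_embeddingD[OF \<psi>] by auto

lemma bridge_bdd: "bdd_below ((\<lambda>a. leg s a + leg' t a) ` mspace A)"
  by (rule bdd_belowI2[of _ 0]) simp

lemma bridge_le: "a \<in> mspace A \<Longrightarrow> bridge_dist s t \<le> leg s a + leg' t a"
  unfolding bridge_dist_def by (rule cINF_lower[OF bridge_bdd])

lemma bridge_ge: "(\<And>a. a \<in> mspace A \<Longrightarrow> c \<le> leg s a + leg' t a)
   \<Longrightarrow> c \<le> bridge_dist s t"
  unfolding bridge_dist_def by (rule cINF_greatest[OF A_nonempty])

lemma bridge_approx:
  assumes "bridge_dist s t < c"
  obtains a where "a \<in> mspace A" "leg s a + leg' t a < c"
  using assms cINF_less_iff[OF A_nonempty bridge_bdd[of s t]] unfolding bridge_dist_def by blast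

lemma glue_le_bridge:
  assumes "s \<in> pts" "t \<in> pts" shows "glue_dist s t \<le> bridge_dist s t"
proof (cases "fst s = fst t")
  case True
  have "mdist (Y (fst s)) (snd s) (snd t) \<le> bridge_dist s t"
  proof (rule bridge_ge)
    fix a assume "a \<in> mspace A"
    from \<psi>_in[OF this] show "mdist (Y (fst s)) (snd s) (snd t) \<le>
        leg s a + leg' t a"
      using assms True mdist_triangle[of "snd s" "Y (fst t)" "\<psi> (fst t) a" "snd t"]
        by (simp add: pts_def)
  qed
  then show ?thesis using True by (simp add: glue_dist_def)
qed (simp add: glue_dist_def)

lemma glue_nonneg: "0 \<le> glue_dist s t"
  unfolding glue_dist_def using bridge_ge[of 0 s t] by simp

lemma bridge_commute: "bridge_dist s t = bridge_dist t s"
  unfolding bridge_dist_def by (rule INF_cong) (auto simp: mdist_commute add.commute)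

lemma glue_commute: "glue_dist s t = glue_dist t s"
  unfolding glue_dist_def using bridge_commute[of s t] by (auto simp: mdist_commute)

lemma bridge_triangle_left:
  assumes "s \<in> pts" "t \<in> pts" "u \<in> pts" "fst s = fst t"
  shows "bridge_dist s u \<le> glue_dist s t + bridge_dist t u"
proof -
  have "bridge_dist s u - glue_dist s t \<le> bridge_dist t u"
  proof (rule bridge_ge)
    fix a assume a: "a \<in> mspace A"
    have "leg s a \<le> mdist (Y (fst s)) (snd s) (snd t) + mdist (Y (fst s)) (snd t) (\<psi> (fst s) a)"
      using assms \<psi>_in[OF a] by (intro mdist_triangle) (auto simp: pts_def)
    then show "bridge_dist s u - glue_dist s t \<le> leg t a + leg' u a"
      using bridge_le[OF a, of s u] assms(4) by (simp add: glue_dist_def)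
  qed
  then show ?thesis by simp
qed

lemma bridge_triangle:
  assumes "s \<in> pts" "t \<in> pts" "u \<in> pts"
  shows "bridge_dist s u \<le> bridge_dist s t + bridge_dist t u"
proof (rule field_le_epsilon)
  fix e :: real assume "e > 0"
  then have e: "e/2 > 0" by simp
  obtain a where a: "a \<in> mspace A" "leg s a + leg' t a < bridge_dist s t + e/2"
    using bridge_approx[of s t "bridge_dist s t + e/2"] e by auto
  obtain b where b: "b \<in> mspace A" "leg t b + leg' u b < bridge_dist t u + e/2"
    using bridge_approx[of t u "bridge_dist t u + e/2"] e by auto
  have "mdist A a b \<le> leg' t a + leg t b"
    unfolding \<psi>_dist[OF a(1) b(1), of "fst t", symmetric] using assms \<psi>_in[OF a(1)] \<psi>_in[OF b(1)]
      by (intro mdist_triangle) (auto simp: pts_def)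
  moreover have "leg s b \<le> leg s a + mdist A a b"
    unfolding \<psi>_dist[OF a(1) b(1), of "fst s", symmetric] using assms \<psi>_in[OF a(1)] \<psi>_in[OF b(1)]
      by (intro mdist_triangle) (auto simp: pts_def)
  ultimately show "bridge_dist s u \<le> bridge_dist s t + bridge_dist t u + e"
    using bridge_le[OF b(1), of s u] a b by simp
qed

lemma glue_triangle:
  assumes "s \<in> pts" "t \<in> pts" "u \<in> pts"
  shows "glue_dist s u \<le> glue_dist s t + glue_dist t u"
proof -
  consider "fst s = fst t" "fst t = fst u" | "fst s = fst t" "fst t \<noteq> fst u" | "fst s \<noteq> fst t" "fst t = fst u" | "fst s \<noteq> fst t" "fst t \<noteq> fst u"
    by blast
  then show ?thesis
  proof cases
    case 1
    then show ?thesis using assms mdist_triangle by (auto simp: glue_dist_def pts_def)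
  next
    case 2
    then show ?thesis using bridge_triangle_left[OF assms] by (simp add: glue_dist_def)
  next
    case 3
    then show ?thesis using bridge_triangle_left[of u t s] assms glue_commute[of t u]
      by (simp add: glue_dist_def bridge_commute[of s] mdist_commute)
  next
    case 4
    then show ?thesis using bridge_triangle[OF assms] glue_le_bridge[OF assms(1,3)]
      by (simp add: glue_dist_def)
  qed
qed

lemma glue_dist_\<psi>:
  assumes a: "a \<in> mspace A" and s: "s \<in> pts"
  shows "glue_dist (i, \<psi> i a) s = leg' s a"
proof (cases "i = fst s")
  case True
  then show ?thesis by (simp add: glue_dist_def)
next
  case False
  have "bridge_dist (i, \<psi> i a) s = leg' s a"
  proof (rule antisym)
    show "bridge_dist (i, \<psi> i a) s \<le> leg' s a"
      using bridge_le[OF a, of "(i, \<psi> i a)" s] \<psi>_in[OF a] by simp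
    show "leg' s a \<le> bridge_dist (i, \<psi> i a) s"
    proof (rule bridge_ge)
      fix b assume b: "b \<in> mspace A"
      have "leg' s a \<le> mdist (Y (fst s)) (\<psi> (fst s) a) (\<psi> (fst s) b) + leg' s b"
        using s \<psi>_in[OF a] \<psi>_in[OF b] by (intro mdist_triangle) (auto simp: pts_def)
      then show "leg' s a \<le> mdist (Y (fst (i, \<psi> i a))) (snd (i, \<psi> i a)) (\<psi> (fst (i, \<psi> i a)) b) + leg' s b"
        using \<psi>_dist[OF a b] by simp
    qed
  qed
  with False show ?thesis by (simp add: glue_dist_def)
qed

text \<open>
  The copy of \<open>A\<close> is closed, so a point off it has positive distance to it; this is what separates
  points of different pieces.
\<close>

lemma positive_dist_off_image:
  assumes s: "s \<in> glue_carrier" "fst s \<noteq> 0"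
  obtains r where "r > 0" "\<And>a. a \<in> mspace A \<Longrightarrow> r \<le> leg s a"
proof -
  have sY: "snd s \<in> mspace (Y (fst s))" and n: "snd s \<notin> \<psi> (fst s) ` mspace A"
    using s by (auto simp: glue_carrier_def pts_def)
  have "openin (mtopology_of (Y (fst s))) (mspace (Y (fst s)) - \<psi> (fst s) ` mspace A)"
    using isometric_image_closed[OF \<psi> A_complete, of "fst s"] by (auto simp: closedin_def)
  then obtain r where r: "r > 0" "mball_of (Y (fst s)) (snd s) r \<subseteq> mspace (Y (fst s)) - \<psi> (fst s) ` mspace A"
  proof (rule openin_contains_mball_of)
    show "snd s \<in> mspace (Y (fst s)) - \<psi> (fst s) ` mspace A" using sY n by simp
  qed (rule that)
  have "r \<le> leg s a" if a: "a \<in> mspace A" for a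
  proof -
    have "\<psi> (fst s) a \<notin> mball_of (Y (fst s)) (snd s) r" using r(2) a by blast
    then show ?thesis using sY \<psi>_in[OF a] by auto
  qed
  with r(1) show ?thesis by (rule that)
qed

lemma carrier_pts: "s \<in> glue_carrier \<Longrightarrow> s \<in> pts" by (simp add: glue_carrier_def)

lemma glue_zero_imp_eq:
  assumes s: "s \<in> glue_carrier" and t: "t \<in> glue_carrier" and z: "glue_dist s t = 0"
  shows "s = t"
proof (cases "fst s = fst t")
  case True
  then have "snd s = snd t" using s t z by (auto simp: glue_dist_def glue_carrier_def pts_def)
  with True show ?thesis by (simp add: prod_eq_iff)
next
  case False
  have pos: False if uv: "u \<in> glue_carrier" "fst u \<noteq> 0" "bridge_dist u v = 0" for u v
  proof -
    obtain r where r: "r > 0" "\<And>a. a \<in> mspace A \<Longrightarrow> r \<le> leg u a"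
      using positive_dist_off_image[OF uv(1,2)] by metis
    have "r \<le> bridge_dist u v"
      by (rule bridge_ge) (use r(2) in \<open>simp add: add_increasing2\<close>)
    then show False using uv r by simp
  qed
  have b: "bridge_dist s t = 0" "bridge_dist t s = 0"
    using z False bridge_commute[of s t] by (auto simp: glue_dist_def)
  have "fst s \<noteq> 0 \<or> fst t \<noteq> 0" using False by auto
  then show ?thesis using pos[OF s _ b(1)] pos[OF t _ b(2)] by blast
qed

sublocale glue: Metric_space glue_carrier glue_dist
proof
  fix x y z
  show "0 \<le> glue_dist x y" by (rule glue_nonneg)
  show "glue_dist x y = glue_dist y x" by (rule glue_commute)
  show "(glue_dist x y = 0) = (x = y)" if "x \<in> glue_carrier" "y \<in> glue_carrier"
    using glue_zero_imp_eq[OF that] that by (auto simp: glue_dist_def glue_carrier_def pts_def)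
  show "glue_dist x z \<le> glue_dist x y + glue_dist y z" if "x \<in> glue_carrier" "y \<in> glue_carrier" "z \<in> glue_carrier"
    by (intro glue_triangle carrier_pts that)
qed

lemma glue_metric_simps [simp]: "mspace glue_metric = glue_carrier" "mdist glue_metric = glue_dist"
  by (simp_all add: glue_metric_def)

lemmas \<psi>_inv = inv_into_isometric[OF \<psi>]

lemma glue_map_\<psi>: "a \<in> mspace A \<Longrightarrow> glue_map i (\<psi> i a) = (0, \<psi> 0 a)"
  by (simp add: glue_map_def \<psi>_inv)

lemma glue_map_carrier: "z \<in> mspace (Y i) \<Longrightarrow> glue_map i z \<in> glue_carrier"
  by (auto simp: glue_map_def glue_carrier_def pts_def \<psi>_inv \<psi>_in)

lemma glue_map_0: "z \<in> mspace (Y 0) \<Longrightarrow> glue_map 0 z = (0, z)"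
  by (auto simp: glue_map_def \<psi>_inv)

lemma glue_map_close: "z \<in> mspace (Y i) \<Longrightarrow> glue_dist (glue_map i z) (i, z) = 0"
proof (cases "z \<in> \<psi> i ` mspace A")
  case True
  assume "z \<in> mspace (Y i)"
  with True show ?thesis by (auto simp: glue_map_\<psi> glue_dist_\<psi> pts_def)
qed (simp add: glue_map_def glue_dist_def)

lemma glue_map_isometric: "isometric_embedding (Y i) glue_metric (glue_map i)"
  unfolding isometric_embedding_def
proof (intro conjI funcsetI ballI)
  fix z w assume z: "z \<in> mspace (Y i)" and w: "w \<in> mspace (Y i)"
  show "glue_map i z \<in> mspace glue_metric" using glue_map_carrier[OF z] by simp
  have p: "(i, z) \<in> pts" "(i, w) \<in> pts" using z w by (simp_all add: pts_def)
  have q: "glue_map i z \<in> pts" "glue_map i w \<in> pts"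
    by (rule carrier_pts[OF glue_map_carrier[OF z]], rule carrier_pts[OF glue_map_carrier[OF w]])
  have "glue_dist (glue_map i z) (glue_map i w) = glue_dist (i, z) (i, w)"
    using glue_triangle[OF q(1) p(1) q(2)] glue_triangle[OF p(1) p(2) q(2)]
      glue_triangle[OF p(1) q(1) p(2)] glue_triangle[OF q p(2)]
      glue_map_close[OF z] glue_map_close[OF w] glue_commute[of "(i,z)" "glue_map i z"] glue_commute[of "(i,w)" "glue_map i w"]
    by linarith
  then show "mdist glue_metric (glue_map i z) (glue_map i w) = mdist (Y i) z w"
    by (simp add: glue_dist_def)
qed

text \<open>
  A Cauchy sequence either visits some piece infinitely often, and then converges there, or visits
  each piece finitely often. In the second case late members are joined through \<open>A\<close> to members of
  other pieces, so they come arbitrarily close to \<open>A\<close>; nearby points of \<open>A\<close> form a Cauchy sequence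
  with the same limit.
\<close>

lemma glue_complete: "mcomplete_of glue_metric"
  unfolding glue_metric_def glue.mcomplete_of glue.mcomplete_def
proof (intro allI impI)
  fix \<sigma> assume \<sigma>: "glue.MCauchy \<sigma>"
  have \<sigma>C: "\<sigma> n \<in> glue_carrier" for n using \<sigma> by (auto simp: glue.MCauchy_def)
  note \<sigma>p = carrier_pts[OF \<sigma>C]
  have cau: "\<exists>N. \<forall>n n'. N \<le> n \<longrightarrow> N \<le> n' \<longrightarrow> glue_dist (\<sigma> n) (\<sigma> n') < e" if "e > 0" for e
    using \<sigma> that by (auto simp: glue.MCauchy_def)
  show "\<exists>x. limitin glue.mtopology \<sigma> x sequentially"
  proof (cases "\<exists>i. \<exists>\<^sub>\<infinity>n. fst (\<sigma> n) = i")
    case True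
    then obtain i where i: "\<exists>\<^sub>\<infinity>n. fst (\<sigma> n) = i" ..
    define r where "r = enumerate {n. fst (\<sigma> n) = i}"
    have inf: "infinite {n. fst (\<sigma> n) = i}" using i by (simp add: INFM_iff_infinite)
    have r: "strict_mono r" "\<And>n. fst (\<sigma> (r n)) = i"
      using inf strict_mono_enumerate[OF inf] enumerate_in_set[OF inf] by (auto simp: r_def)
    define z where "z n = snd (\<sigma> (r n))" for n
    have \<sigma>r: "\<sigma> (r n) = (i, z n)" for n using r(2)[of n] by (simp add: z_def prod_eq_iff)
    have zY: "z n \<in> mspace (Y i)" for n using \<sigma>p[of "r n"] by (simp add: \<sigma>r pts_def)
    have zm: "glue_map i (z n) = \<sigma> (r n)" for n
    proof (cases "i = 0")
      case True
      then show ?thesis using glue_map_0 zY \<sigma>r by simp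
    next
      case False
      then have "z n \<notin> \<psi> i ` mspace A"
        using \<sigma>C[of "r n"] by (simp add: \<sigma>r glue_carrier_def)
      then show ?thesis by (simp add: glue_map_def \<sigma>r)
    qed
    obtain l where l: "l \<in> mspace (Y i)" "(\<lambda>n. mdist (Y i) (z n) l) \<longlonglongrightarrow> 0"
    proof (rule mcomplete_ofD[OF Y_complete zY])
      fix e :: real assume "e > 0"
      then obtain N where N: "\<And>n n'. N \<le> n \<Longrightarrow> N \<le> n' \<Longrightarrow> glue_dist (\<sigma> n) (\<sigma> n') < e"
        using cau by blast
      have "mdist (Y i) (z n) (z n') < e" if "N \<le> n" "N \<le> n'" for n n'
        using N[of "r n" "r n'"] that seq_suble[OF r(1), of n] seq_suble[OF r(1), of n']
          by (simp add: \<sigma>r glue_dist_def)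
      then show "\<exists>N. \<forall>n n'. N \<le> n \<longrightarrow> N \<le> n' \<longrightarrow> mdist (Y i) (z n) (z n') < e"
        by blast
    qed (use that in blast)
    have "glue_dist (\<sigma> (r n)) (glue_map i l) = mdist (Y i) (z n) l" for n
      using isometric_embeddingD(2)[OF glue_map_isometric zY l(1)] by (simp add: zm)
    then have "limitin glue.mtopology (\<sigma> \<circ> r) (glue_map i l) sequentially"
      unfolding glue.limitin_metric_dist_null using l \<sigma>C glue_map_carrier by (simp add: comp_def)
    then show ?thesis using glue.MCauchy_convergent_subsequence[OF \<sigma> r(1)] by blast
  next
    case False
    then have fin: "\<forall>\<^sub>F m in sequentially. fst (\<sigma> m) \<noteq> i" for i
      by (auto simp: frequently_def cofinite_eq_sequentially)
    \<comment> \<open>Compare with a later member that lies in a different piece.\<close>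
    have near: "\<exists>N. \<forall>n\<ge>N. \<exists>a\<in>mspace A. leg (\<sigma> n) a < e" if e: "e > 0" for e
    proof -
      obtain N where N: "\<And>n n'. N \<le> n \<Longrightarrow> N \<le> n' \<Longrightarrow> glue_dist (\<sigma> n) (\<sigma> n') < e"
        using cau[OF e] by blast
      have "\<exists>a\<in>mspace A. leg (\<sigma> n) a < e" if n: "n \<ge> N" for n
      proof -
        obtain k where k: "k \<ge> N" "fst (\<sigma> k) \<noteq> fst (\<sigma> n)"
          using fin[of "fst (\<sigma> n)"] by (auto simp: eventually_sequentially) (meson nat_le_linear)
        then have "bridge_dist (\<sigma> n) (\<sigma> k) < e"
          using N[OF n k(1)] by (simp add: glue_dist_def)
        then obtain a where "a \<in> mspace A" "leg (\<sigma> n) a + leg' (\<sigma> k) a < e"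
          by (rule bridge_approx)
        then show ?thesis using mdist_nonneg[of "Y (fst (\<sigma> k))" "\<psi> (fst (\<sigma> k)) a" "snd (\<sigma> k)"]
          by (intro bexI[of _ a]) linarith+
      qed
      then show ?thesis by blast
    qed
    define \<delta> where "\<delta> n = (INF a\<in>mspace A. leg (\<sigma> n) a)" for n
    have bdd: "bdd_below ((\<lambda>a. leg (\<sigma> n) a) ` mspace A)" for n
      by (rule bdd_belowI2[of _ 0]) simp
    have "\<exists>a\<in>mspace A. leg (\<sigma> n) a < \<delta> n + 1 / real (Suc n)" for n
      using cINF_less_iff[OF A_nonempty bdd, of n "\<delta> n + 1 / real (Suc n)"]
        by (simp add: \<delta>_def)
    then obtain a where a: "\<And>n. a n \<in> mspace A" "\<And>n. leg (\<sigma> n) (a n) < \<delta> n + 1 / real (Suc n)"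
      by metis
    have ga: "glue_dist (\<sigma> n) (0, \<psi> 0 b) = leg (\<sigma> n) b" if "b \<in> mspace A" for n b
      using glue_dist_\<psi>[OF that \<sigma>p, of 0 n] glue_commute by (metis mdist_commute)
    have pa: "(0, \<psi> 0 b) \<in> pts" "(0, \<psi> 0 b) \<in> glue_carrier" if "b \<in> mspace A" for b
      using \<psi>_in[OF that] by (auto simp: pts_def glue_carrier_def)
    have da: "(\<lambda>n. glue_dist (\<sigma> n) (0, \<psi> 0 (a n))) \<longlonglongrightarrow> 0"
    proof (rule LIMSEQ_I)
      fix e :: real assume "e > 0"
      then have "e/2 > 0" by simp
      from near[OF this] obtain N where N: "\<And>n. n \<ge> N \<Longrightarrow> \<exists>a\<in>mspace A. leg (\<sigma> n) a < e/2"
        by blast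
      obtain M where M: "1 / real (Suc M) < e/2" using nat_approx_posE[OF \<open>e/2 > 0\<close>] by blast
      have "norm (glue_dist (\<sigma> n) (0, \<psi> 0 (a n)) - 0) < e" if n: "n \<ge> max N M" for n
      proof -
        obtain b where b: "b \<in> mspace A" "leg (\<sigma> n) b < e/2" using N[of n] n by auto
        have "\<delta> n \<le> leg (\<sigma> n) b" unfolding \<delta>_def by (rule cINF_lower[OF bdd b(1)])
        moreover have "1 / real (Suc n) \<le> 1 / real (Suc M)" using n by (simp add: field_simps)
        ultimately show ?thesis using a(2)[of n] b(2) M glue_nonneg[of "\<sigma> n" "(0, \<psi> 0 (a n))"]
          by (simp add: ga[OF a(1)])
      qed
      then show "\<exists>no. \<forall>n\<ge>no. norm (glue_dist (\<sigma> n) (0, \<psi> 0 (a n)) - 0) < e"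
        by blast
    qed
    obtain l where l: "l \<in> mspace A" "(\<lambda>n. mdist A (a n) l) \<longlonglongrightarrow> 0"
    proof (rule mcomplete_ofD[OF A_complete a(1)])
      fix e :: real assume "e > 0"
      then have e3: "e/3 > 0" by simp
      from cau[OF e3] obtain N where N: "\<And>n n'. N \<le> n \<Longrightarrow> N \<le> n' \<Longrightarrow> glue_dist (\<sigma> n) (\<sigma> n') < e/3"
        by blast
      from order_tendstoD(2)[OF da e3] obtain M where M: "\<And>n. n \<ge> M \<Longrightarrow> glue_dist (\<sigma> n) (0, \<psi> 0 (a n)) < e/3"
        by (auto simp: eventually_sequentially)
      have "mdist A (a n) (a n') < e" if n: "max N M \<le> n" "max N M \<le> n'" for n n'
      proof -
        have "mdist A (a n) (a n') = glue_dist (0, \<psi> 0 (a n)) (0, \<psi> 0 (a n'))"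
          using a(1) by (simp add: glue_dist_def \<psi>_dist)
        also have "\<dots> \<le> glue_dist (0, \<psi> 0 (a n)) (\<sigma> n) + glue_dist (\<sigma> n) (0, \<psi> 0 (a n'))"
          by (intro glue_triangle pa \<sigma>p a)
        also have "glue_dist (\<sigma> n) (0, \<psi> 0 (a n')) \<le> glue_dist (\<sigma> n) (\<sigma> n') + glue_dist (\<sigma> n') (0, \<psi> 0 (a n'))"
          by (intro glue_triangle pa \<sigma>p a)
        finally show ?thesis using N[of n n'] M[of n] M[of n'] n glue_commute[of "\<sigma> n" "(0, \<psi> 0 (a n))"]
          by simp
      qed
      then show "\<exists>N. \<forall>n n'. N \<le> n \<longrightarrow> N \<le> n' \<longrightarrow> mdist A (a n) (a n') < e"
        by blast
    qed (use that in blast)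
    have "(\<lambda>n. glue_dist (\<sigma> n) (0, \<psi> 0 l)) \<longlonglongrightarrow> 0"
    proof (rule tendsto_sandwich[OF _ _ tendsto_const])
      show "(\<lambda>n. glue_dist (\<sigma> n) (0, \<psi> 0 (a n)) + mdist A (a n) l) \<longlonglongrightarrow> 0"
        using tendsto_add[OF da l(2)] by simp
      show "\<forall>\<^sub>F n in sequentially. glue_dist (\<sigma> n) (0, \<psi> 0 l) \<le> glue_dist (\<sigma> n) (0, \<psi> 0 (a n)) + mdist A (a n) l"
      proof (rule always_eventually, rule allI)
        fix n
        have "glue_dist (0, \<psi> 0 (a n)) (0, \<psi> 0 l) = mdist A (a n) l"
          using a(1) l(1) by (simp add: glue_dist_def \<psi>_dist)
        then show "glue_dist (\<sigma> n) (0, \<psi> 0 l) \<le> glue_dist (\<sigma> n) (0, \<psi> 0 (a n)) + mdist A (a n) l"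
          using glue_triangle[OF \<sigma>p[of n] pa(1)[OF a(1)[of n]] pa(1)[OF l(1)]] by simp
      qed
    qed (simp add: glue_nonneg)
    then have "limitin glue.mtopology \<sigma> (0, \<psi> 0 l) sequentially"
      unfolding glue.limitin_metric_dist_null using pa(2)[OF l(1)] \<sigma>C by simp
    then show ?thesis by blast
  qed
qed

end

lemma glue_along_nonempty_subspace:
  fixes A :: "'c metric" and Y :: "nat \<Rightarrow> 'z metric"
  assumes "mspace A \<noteq> {}" "mcomplete_of A" "\<And>i. mcomplete_of (Y i)" "\<And>i. isometric_embedding A (Y i) (\<psi> i)"
  obtains Z :: "(nat \<times> 'z) metric" and \<iota> where "mcomplete_of Z" "\<And>i. isometric_embedding (Y i) Z (\<iota> i)"
    "\<And>i j a. a \<in> mspace A \<Longrightarrow> \<iota> i (\<psi> i a) = \<iota> j (\<psi> j a)"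
proof -
  interpret glued_spaces A Y \<psi> using assms by unfold_locales auto
  show ?thesis
    by (rule that[of glue_metric glue_map]) (auto simp: glue_complete glue_map_isometric glue_map_\<psi>)
qed

definition point_metric :: "'a \<Rightarrow> 'a metric" where
  "point_metric a = metric ({a}, \<lambda>_ _. 0)"

lemma point_metric_simps [simp]: "mspace (point_metric a) = {a}" "mdist (point_metric a) = (\<lambda>_ _. 0)"
proof -
  have "Metric_space {a} (\<lambda>_ _. 0)" by (rule Metric_space.intro) simp_all
  then show "mspace (point_metric a) = {a}" "mdist (point_metric a) = (\<lambda>_ _. 0)"
    unfolding point_metric_def by (rule Metric_space.mspace_metric, rule Metric_space.mdist_metric)
qed

lemma mcomplete_point_metric: "mcomplete_of (point_metric a)"
  unfolding mcomplete_of_def Metric_space.mcomplete_def[OF Metric_space_mspace_mdist]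
    Metric_space.limitin_metric_dist_null[OF Metric_space_mspace_mdist] Metric_space.MCauchy_def[OF Metric_space_mspace_mdist]
  by (auto intro!: always_eventually)

text \<open>
  If \<open>A\<close> is empty, the pieces are instead joined at one chosen point each, and an empty piece is
  first replaced by a point.
\<close>

lemma glue_along_common_subspace:
  fixes A :: "'c metric" and Y :: "nat \<Rightarrow> 'z metric"
  assumes "mcomplete_of A" "\<And>i. mcomplete_of (Y i)" "\<And>i. isometric_embedding A (Y i) (\<psi> i)"
  obtains Z :: "(nat \<times> 'z) metric" and \<iota> where "mcomplete_of Z" "\<And>i. isometric_embedding (Y i) Z (\<iota> i)"
    "\<And>i j a. a \<in> mspace A \<Longrightarrow> \<iota> i (\<psi> i a) = \<iota> j (\<psi> j a)"
proof (cases "mspace A = {}")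
  case False
  show ?thesis
    by (rule glue_along_nonempty_subspace[OF False assms]) (rule that)
next
  case True
  define Y' where "Y' i = (if mspace (Y i) = {} then point_metric undefined else Y i)" for i
  have sub: "isometric_embedding (Y i) (Y' i) id" for i
    by (auto simp: isometric_embedding_def Y'_def)
  have c: "mcomplete_of (Y' i)" for i using assms(2) by (simp add: Y'_def mcomplete_point_metric)
  have "\<forall>i. \<exists>y. y \<in> mspace (Y' i)" by (auto simp: Y'_def)
  then obtain y where y: "\<And>i. y i \<in> mspace (Y' i)" by metis
  have e: "isometric_embedding (point_metric ()) (Y' i) (\<lambda>_. y i)" for i
    using y by (auto simp: isometric_embedding_def)
  obtain Z :: "(nat \<times> 'z) metric" and \<iota> where "mcomplete_of Z" "\<And>i. isometric_embedding (Y' i) Z (\<iota> i)"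
  proof (rule glue_along_nonempty_subspace[where A = "point_metric ()" and Y = Y' and \<psi> = "\<lambda>i _. y i",
        OF _ mcomplete_point_metric c e])
    show "mspace (point_metric ()) \<noteq> {}" by simp
    fix Z :: "(nat \<times> 'z) metric" and \<iota>
    assume Z: "mcomplete_of Z" and \<iota>: "\<And>i. isometric_embedding (Y' i) Z (\<iota> i)"
    show thesis by (rule that[OF Z \<iota>])
  qed
  then have "isometric_embedding (Y i) Z (\<iota> i \<circ> id)" for i
    using isometric_embedding_compose[OF sub] by blast
  then show ?thesis
    using \<open>mcomplete_of Z\<close> True by (intro that[of Z \<iota>]) simp_all
qed

section \<open>Flat convergence and supports\<close>

lemma metric_current_bound:
  assumes T: "metric_current m Z T" and f: "adm m Z f \<pi>" and B: "\<And>x. x \<in> mspace Z \<Longrightarrow> \<bar>f x\<bar> \<le> B"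
  shows "\<bar>T f \<pi>\<bar> \<le> lip_prod Z \<pi> * (B * enn2real (mass m Z T))"
proof -
  define \<kappa> where "\<kappa> = mass_measure m Z T"
  have mm: "mass_bound m Z T \<kappa>" unfolding \<kappa>_def by (rule metric_current_facts(5)[OF T])
  then interpret finite_measure \<kappa> by (simp add: mass_bound_def)
  have sp: "space \<kappa> = mspace Z" and s: "sets \<kappa> = sets (borel_metric Z)"
    using mm by (auto simp: mass_bound_def)
  have "(LINT x|\<kappa>. \<bar>f x\<bar>) \<le> (LINT x|\<kappa>. B)"
    using B by (intro integral_mono integrable_abs blip_fun_integrable[OF finite_measure_axioms s adm_blip[OF f]]) (auto simp: sp)
  also have "\<dots> = B * enn2real (mass m Z T)"
  proof -
    have "mass m Z T = emeasure \<kappa> (mspace Z)" using mm by (auto simp: mass_def \<kappa>_def)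
    then show ?thesis by (simp add: sp measure_def)
  qed
  finally show ?thesis
    using mass_boundD[OF mm f] adm_lip_prod_nonneg[OF f] mult_left_mono order_trans by blast
qed

lemma metric_current_mass_finite:
  assumes T: "metric_current m Z T" shows "mass m Z T < \<infinity>"
proof -
  have "finite_measure (mass_measure m Z T)"
    using metric_current_facts(5)[OF T] by (simp add: mass_bound_def)
  then show ?thesis using metric_current_facts(5)[OF T] finite_measure.emeasure_finite
    by (auto simp: mass_def less_top[symmetric])
qed

text \<open>
  Flat convergence implies weak convergence: the value at \<open>(f, \<pi>)\<close> of \<open>U\<close> is controlled
    by the
  supremum of \<open>f\<close>, and that of \<open>\<partial>V\<close>, which is \<open>V (1, f, \<pi>)\<close>,
    by the Lipschitz constant of \<open>f\<close>.
\<close>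

lemma flat_dist_controls_values:
  assumes f: "adm m Z f \<pi>" and B: "0 \<le> B" "\<And>x. x \<in> mspace Z \<Longrightarrow> \<bar>f x\<bar> \<le> B"
    and lt: "flat_dist m Z S T < ennreal e"
  shows "\<bar>S f \<pi> - T f \<pi>\<bar> \<le> (B + Lip Z euclidean_metric f) * lip_prod Z \<pi> * e"
proof -
  obtain U V where U: "integral_current m Z U" and V: "integral_current (Suc m) Z V"
    and eq: "S f \<pi> - T f \<pi> = U f \<pi> + boundary (Suc m) V f \<pi>" and m: "mass m Z U + mass (Suc m) Z V < ennreal e"
    using lt f unfolding flat_dist_def INF_less_iff by auto
  have mc: "metric_current m Z U" "metric_current (Suc m) Z V"
    using U V by (auto simp: integral_current_def integer_rectifiable_def)
  define C where "C = lip_prod Z \<pi>"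
  define L where "L = Lip Z euclidean_metric f"
  define u v where "u = enn2real (mass m Z U)" and "v = enn2real (mass (Suc m) Z V)"
  have C: "0 \<le> C" using adm_lip_prod_nonneg[OF f] by (simp add: C_def)
  have L: "0 \<le> L" using f lip_fun_Lip(1) by (auto simp: L_def adm_def blip_fun_def)
  have uv0: "0 \<le> u" "0 \<le> v" by (simp_all add: u_def v_def)
  have "ennreal u + ennreal v < ennreal e"
    using m metric_current_mass_finite[OF mc(1)] metric_current_mass_finite[OF mc(2)]
      by (simp add: u_def v_def)
  then have uv: "u + v < e" using uv0 by (simp add: ennreal_less_iff flip: ennreal_plus)
  have "\<bar>U f \<pi>\<bar> \<le> C * (B * u)"
    unfolding C_def u_def by (rule metric_current_bound[OF mc(1) f B(2)])
  moreover have "\<bar>boundary (Suc m) V f \<pi>\<bar> \<le> C * (L * v)"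
    using metric_current_bound[OF mc(2) adm_one_Cons[OF f], of 1]
      by (simp add: boundary_def C_def L_def v_def ac_simps)
  ultimately have "\<bar>S f \<pi> - T f \<pi>\<bar> \<le> C * (B * u) + C * (L * v)"
    unfolding eq by linarith
  also have "\<dots> \<le> C * (B * e) + C * (L * e)"
    using uv uv0 C L B(1) by (intro add_mono mult_left_mono) auto
  finally show ?thesis by (simp add: C_def L_def algebra_simps)
qed

lemma flat_dist_cong:
  assumes "\<And>f \<pi>. adm m Z f \<pi> \<Longrightarrow> T f \<pi> = T' f \<pi>"
  shows "flat_dist m Z S T = flat_dist m Z S T'"
  unfolding flat_dist_def by (intro INF_cong Collect_cong) (auto simp: assms)

lemma current_set_ball_positive:
  assumes q: "q \<in> current_set m Z T" and e: "e > 0" and fin: "finite_borel_measure Z (mass_measure m Z T)"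
  shows "0 < measure (mass_measure m Z T) (mball_of Z q e)"
proof (rule ccontr)
  interpret finite_measure "mass_measure m Z T" using fin by (simp add: finite_borel_measure_def)
  have s: "sets (mass_measure m Z T) = sets (borel_metric Z)"
    using fin by (simp add: finite_borel_measure_def)
  assume "\<not> 0 < measure (mass_measure m Z T) (mball_of Z q e)"
  then have z: "measure (mass_measure m Z T) (mball_of Z q e) = 0" by (simp add: antisym not_less)
  have "\<forall>\<^sub>F r in at_right 0. ereal (measure (mass_measure m Z T) (mball_of Z q r) / (unit_ball_vol (real m) * r ^ m)) = 0"
    unfolding eventually_at_right_field
  proof (intro exI[of _ e] conjI allI impI e)
    fix r assume "0 < r" "r < e"
    then have "mball_of Z q r \<subseteq> mball_of Z q e" by (auto intro: less_trans)
    then have "measure (mass_measure m Z T) (mball_of Z q r) \<le> 0"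
      unfolding z[symmetric] by (rule finite_measure_mono) (simp add: s open_in_borel_metric[OF openin_mball_of])
    then have "measure (mass_measure m Z T) (mball_of Z q r) = 0" by (simp add: antisym)
    then show "ereal (measure (mass_measure m Z T) (mball_of Z q r) / (unit_ball_vol (real m) * r ^ m)) = 0"
      by simp
  qed
  then have "Liminf (at_right 0) (\<lambda>r. ereal (measure (mass_measure m Z T) (mball_of Z q r) / (unit_ball_vol (real m) * r ^ m)))
     = Liminf (at_right (0::real)) (\<lambda>_. 0 :: ereal)" by (rule Liminf_eq)
  then show False using q by (simp add: current_set_def Liminf_const)
qed

text \<open>
  If the current does not see functions of the form \<open>f g\<close>, then \<open>T f = T (f (1 - g))\<close>, so the mass
  measure restricted to the complement of the ball where \<open>g = 1\<close> is still a bound. By minimality the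
  ball has mass zero.
\<close>

lemma not_in_current_set_if_vanishing:
  assumes T: "metric_current m Z T" and q: "q \<in> mspace Z" and e: "e > 0" and g: "blip_fun Z g"
    "\<And>x. x \<in> mspace Z \<Longrightarrow> 0 \<le> g x \<and> g x \<le> 1" "\<And>x. x \<in> mspace Z \<Longrightarrow> mdist Z q x < e \<Longrightarrow> g x = 1"
    and van: "\<And>f \<pi>. adm m Z f \<pi> \<Longrightarrow> T (\<lambda>x. f x * g x) \<pi> = 0"
  shows "q \<notin> current_set m Z T"
proof
  assume qs: "q \<in> current_set m Z T"
  define \<kappa> where "\<kappa> = mass_measure m Z T"
  note ad = metric_current_facts(2)[OF T] and min = metric_current_facts(4)[OF T, folded \<kappa>_def]
    and mm = metric_current_facts(5)[OF T, folded \<kappa>_def] and b = metric_current_facts(6)[OF T, folded \<kappa>_def]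
  have sp: "space \<kappa> = mspace Z" and s: "sets \<kappa> = sets (borel_metric Z)"
    using mm by (auto simp: mass_bound_def)
  define B where "B = mball_of Z q e"
  have Bm[measurable]: "B \<in> sets (borel_metric Z)"
    unfolding B_def by (rule open_in_borel_metric[OF openin_mball_of])
  define h where "h x = (1 - indicator B x :: real)" for x
  have hm: "h \<in> borel_measurable (borel_metric Z)" unfolding h_def by measurable
  have h0: "0 \<le> h x" for x by (simp add: h_def indicator_def)
  have hi: "integrable \<kappa> h"
    by (rule finite_borel_measure_integrable[OF b hm, of 1]) (simp add: h_def indicator_def)
  have "mass_bound m Z T (density \<kappa> h)"
    unfolding mass_bound_density_iff[OF mm hm h0 hi]
  proof (intro allI impI)
    fix f \<pi> assume f: "adm m Z f \<pi>"
    have g': "blip_fun Z (\<lambda>x. 1 - g x)" by (rule blip_fun_diff[OF blip_fun_const g(1)])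
    have fg: "adm m Z (\<lambda>x. f x * g x) \<pi>" "adm m Z (\<lambda>x. f x * (1 - g x)) \<pi>"
      using g(1) g' by (auto intro!: adm_cong_fun[OF f] blip_fun_mult adm_blip[OF f])
    have fm: "f \<in> borel_measurable (borel_metric Z)" by (rule blip_fun_measurable[OF adm_blip[OF f]])
    obtain C where C: "\<And>x. x \<in> mspace Z \<Longrightarrow> \<bar>f x\<bar> \<le> C"
      using adm_blip[OF f] unfolding blip_fun_iff by auto
    have "T f \<pi> = T (\<lambda>x. f x * g x + f x * (1 - g x)) \<pi>" by (simp add: algebra_simps)
    also have "\<dots> = T (\<lambda>x. f x * (1 - g x)) \<pi>"
      using ad fg van[OF f] unfolding additive_functional_def by simp
    finally have "\<bar>T f \<pi>\<bar> \<le> lip_prod Z \<pi> * (LINT x|\<kappa>. \<bar>f x * (1 - g x)\<bar>)"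
      using mass_boundD[OF mm fg(2)] by simp
    also have "\<dots> \<le> lip_prod Z \<pi> * (LINT x|\<kappa>. h x * \<bar>f x\<bar>)"
    proof (intro mult_left_mono adm_lip_prod_nonneg[OF f] integral_mono)
      show "integrable \<kappa> (\<lambda>x. \<bar>f x * (1 - g x)\<bar>)"
        using mm by (intro integrable_abs blip_fun_integrable[OF _ s adm_blip[OF fg(2)]]) (simp add: mass_bound_def)
      show "integrable \<kappa> (\<lambda>x. h x * \<bar>f x\<bar>)"
        by (rule integrable_mult_bounded[OF b hi, of _ C]) (use fm C in auto)
      fix x assume "x \<in> space \<kappa>"
      then have x: "x \<in> mspace Z" by (simp add: sp)
      show "\<bar>f x * (1 - g x)\<bar> \<le> h x * \<bar>f x\<bar>"
      proof (cases "x \<in> B")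
        case True
        then show ?thesis using g(3)[OF x] by (simp add: B_def h_def)
      next
        case False
        have "\<bar>f x\<bar> * \<bar>1 - g x\<bar> \<le> \<bar>f x\<bar> * 1"
          using g(2)[OF x] by (intro mult_left_mono) auto
        then show ?thesis using False by (simp add: h_def abs_mult)
      qed
    qed
    finally show "\<bar>T f \<pi>\<bar> \<le> lip_prod Z \<pi> * (LINT x|\<kappa>. h x * \<bar>f x\<bar>)" .
  qed
  then have "emeasure \<kappa> B \<le> emeasure (density \<kappa> h) B"
    using min Bm unfolding minimal_mass_bound_def by blast
  also have "\<dots> = (\<integral>\<^sup>+x. ennreal (h x) * indicator B x \<partial>\<kappa>)"
    using hm by (intro emeasure_density) (simp_all add: finite_borel_measure_measurable[OF b] s)
  also have "\<dots> = (\<integral>\<^sup>+x. 0 \<partial>\<kappa>)"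
    by (rule nn_integral_cong) (simp add: h_def indicator_def)
  finally have "measure \<kappa> B = 0" by (simp add: measure_def)
  then show False
    using current_set_ball_positive[OF qs e] b unfolding \<kappa>_def B_def by simp
qed

text \<open>
  Suppose that infinitely many of the embedded \<open>X\<^sub>i\<close> avoid a ball around \<open>\<psi> q\<close>. By density so do the
  completions, hence those currents vanish on functions supported in the ball, and by weak convergence
  so does the limit. Then \<open>q\<close> is not in its set.
\<close>

lemma flat_limit_support_approximated:
  fixes X Xbar :: "nat \<Rightarrow> 'a metric" and T :: "nat \<Rightarrow> 'a current" and Z :: "'z metric"
    and Y :: "'b metric" and S :: "'b current"
  assumes X: "\<And>i. metric_completion_of (X i) (Xbar i)" and T: "\<And>i. metric_current m (Xbar i) (T i)"
    and S: "metric_current m Y S"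
    and \<phi>: "\<And>i. isometric_embedding (Xbar i) Z (\<phi> i)" and \<psi>: "isometric_embedding Y Z \<psi>"
    and lim: "(\<lambda>i. flat_dist m Z (pushforward (\<phi> i) (T i)) (pushforward \<psi> S)) \<longlonglongrightarrow> 0"
    and q: "q \<in> current_set m Y S" and e: "e > 0"
  shows "\<forall>\<^sub>F i in sequentially. \<exists>p\<in>mspace (X i). mdist Z (\<phi> i p) (\<psi> q) < e"
proof (rule ccontr)
  assume "\<not> ?thesis"
  then have bad: "\<exists>\<^sub>F i in sequentially. \<forall>p\<in>mspace (X i). e \<le> mdist Z (\<phi> i p) (\<psi> q)"
    by (simp add: not_eventually not_less)
  have qY: "q \<in> mspace Y" using q by (simp add: current_set_def)
  have \<psi>q: "\<psi> q \<in> mspace Z" by (rule isometric_embeddingD(1)[OF \<psi> qY])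
  obtain g where g: "blip_fun Z g" "\<And>x. 0 \<le> g x" "\<And>x. g x \<le> 1"
    "\<And>x. x \<in> mspace Z \<Longrightarrow> mdist Z (\<psi> q) x \<le> e/2 \<Longrightarrow> g x = 1"
    "\<And>x. x \<in> mspace Z \<Longrightarrow> e \<le> mdist Z (\<psi> q) x \<Longrightarrow> g x = 0"
    using blip_fun_cutoff[OF \<psi>q e] by metis
  \<comment> \<open>The completions stay away from the ball as well.\<close>
  have far: "e \<le> mdist Z (\<psi> q) (\<phi> i x)" if i: "\<forall>p\<in>mspace (X i). e \<le> mdist Z (\<phi> i p) (\<psi> q)" and x: "x \<in> mspace (Xbar i)" for i x
  proof (rule field_le_epsilon)
    fix \<delta> :: real assume \<delta>: "\<delta> > 0"
    have "x \<in> mtopology_of (Xbar i) closure_of mspace (X i)"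
      using X[of i] x by (simp add: metric_completion_of_def)
    moreover have "x \<in> mball_of (Xbar i) x \<delta>" using x \<delta> by simp
    ultimately obtain p where p: "p \<in> mspace (X i)" "p \<in> mball_of (Xbar i) x \<delta>"
      using openin_mball_of[of "Xbar i" x \<delta>] unfolding in_closure_of by blast
    have pX: "p \<in> mspace (Xbar i)" using p by simp
    have "e \<le> mdist Z (\<psi> q) (\<phi> i p)" using i p(1) by (simp add: mdist_commute)
    also have "\<dots> \<le> mdist Z (\<psi> q) (\<phi> i x) + mdist Z (\<phi> i x) (\<phi> i p)"
      using isometric_embeddingD(1)[OF \<phi>] x pX \<psi>q by (intro mdist_triangle) auto
    also have "mdist Z (\<phi> i x) (\<phi> i p) \<le> \<delta>"
      using isometric_embeddingD(2)[OF \<phi> x pX] p by simp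
    finally show "e \<le> mdist Z (\<psi> q) (\<phi> i x) + \<delta>" by simp
  qed
  have zero: "pushforward (\<phi> i) (T i) (\<lambda>x. f x * g x) \<pi> = 0"
    if i: "\<forall>p\<in>mspace (X i). e \<le> mdist Z (\<phi> i p) (\<psi> q)" and f: "adm m Z (\<lambda>x. f x * g x) \<pi>" for i f \<pi>
  proof -
    have "\<bar>T i ((\<lambda>x. f x * g x) \<circ> \<phi> i) (map (\<lambda>p. p \<circ> \<phi> i) \<pi>)\<bar> \<le>
       lip_prod (Xbar i) (map (\<lambda>p. p \<circ> \<phi> i) \<pi>) * (0 * enn2real (mass m (Xbar i) (T i)))"
    proof (rule metric_current_bound[OF T adm_compose_isometric[OF \<phi> f]])
      fix x assume x: "x \<in> mspace (Xbar i)"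
      show "\<bar>((\<lambda>x. f x * g x) \<circ> \<phi> i) x\<bar> \<le> 0"
        using g(5)[OF isometric_embeddingD(1)[OF \<phi> x] far[OF i x]] by simp
    qed
    then show ?thesis by (simp add: pushforward_def)
  qed
  \<comment> \<open>Pass to the limit along the bad indices, at which the approximating values are zero; the
    constant c + 1 only avoids a division by zero.\<close>
  have limz: "pushforward \<psi> S (\<lambda>x. f x * g x) \<pi> = 0" if f: "adm m Z (\<lambda>x. f x * g x) \<pi>" for f \<pi>
  proof -
    obtain B where B: "0 \<le> B" "\<And>x. x \<in> mspace Z \<Longrightarrow> \<bar>f x * g x\<bar> \<le> B"
      using adm_blip[OF f] unfolding blip_fun_iff by auto
    define c where "c = (B + Lip Z euclidean_metric (\<lambda>x. f x * g x)) * lip_prod Z \<pi>"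
    have c: "0 \<le> c" using B(1) adm_lip_prod_nonneg[OF f] lip_fun_Lip(1)[of Z "\<lambda>x. f x * g x"] f
      by (auto simp: c_def adm_def blip_fun_def)
    have "\<bar>pushforward \<psi> S (\<lambda>x. f x * g x) \<pi>\<bar> \<le> 0"
    proof (rule field_le_epsilon)
      fix \<delta> :: real assume \<delta>: "\<delta> > 0"
      define \<eta> where "\<eta> = \<delta> / (c + 1)"
      have \<eta>: "\<eta> > 0" using \<delta> c by (simp add: \<eta>_def)
      have "\<forall>\<^sub>F i in sequentially. flat_dist m Z (pushforward (\<phi> i) (T i)) (pushforward \<psi> S) < ennreal \<eta>"
        using lim \<eta> by (intro order_tendstoD) auto
      then obtain i where i: "\<forall>p\<in>mspace (X i). e \<le> mdist Z (\<phi> i p) (\<psi> q)"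
        "flat_dist m Z (pushforward (\<phi> i) (T i)) (pushforward \<psi> S) < ennreal \<eta>"
        using frequently_ex[OF frequently_eventually_frequently[OF bad]] by blast
      have "\<bar>pushforward \<psi> S (\<lambda>x. f x * g x) \<pi>\<bar> \<le> c * \<eta>"
        using flat_dist_controls_values[OF f B i(2)] zero[OF i(1) f] by (simp add: c_def)
      also have "\<dots> \<le> (c + 1) * \<eta>" using \<eta> by simp
      also have "\<dots> = \<delta>" using c by (simp add: \<eta>_def)
      finally show "\<bar>pushforward \<psi> S (\<lambda>x. f x * g x) \<pi>\<bar> \<le> 0 + \<delta>"
        by simp
    qed
    then show ?thesis by simp
  qed
  note cd = metric_current_facts(3)[OF S]
  have "q \<notin> current_set m Y S"
  proof (rule not_in_current_set_if_vanishing[OF S qY, of "e/2" "g \<circ> \<psi>"])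
    show "blip_fun Y (g \<circ> \<psi>)" by (rule blip_fun_compose_isometric[OF \<psi> g(1)])
    show "0 \<le> (g \<circ> \<psi>) x \<and> (g \<circ> \<psi>) x \<le> 1" for x using g by simp
    show "(g \<circ> \<psi>) x = 1" if "x \<in> mspace Y" "mdist Y q x < e/2" for x
      using that g(4)[of "\<psi> x"] isometric_embeddingD(1)[OF \<psi>] isometric_embeddingD(2)[OF \<psi> qY]
        by simp
    fix f \<pi> assume f: "adm m Y f \<pi>"
    obtain f' where f': "blip_fun Z f'" "\<And>x. x \<in> mspace Y \<Longrightarrow> f' (\<psi> x) = f x"
      using bounded_mcshane_extension[OF \<psi> adm_blip[OF f]] by metis
    have "\<forall>p. \<exists>r. lip_fun Y p \<longrightarrow> lip_fun Z r \<and> (\<forall>x\<in>mspace Y. r (\<psi> x) = p x)"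
      using mcshane_extension[OF \<psi>] by metis
    then obtain E where E: "\<And>p. lip_fun Y p \<Longrightarrow> lip_fun Z (E p)"
      "\<And>p x. lip_fun Y p \<Longrightarrow> x \<in> mspace Y \<Longrightarrow> E p (\<psi> x) = p x"
        by metis
    have \<pi>: "length \<pi> = m" "\<And>p. p \<in> set \<pi> \<Longrightarrow> lip_fun Y p"
      using f by (auto simp: adm_def)
    have a: "adm m Z (\<lambda>x. f' x * g x) (map E \<pi>)"
      using \<pi> E(1) blip_fun_mult[OF f'(1) g(1)] by (auto simp: adm_def)
    have "S (\<lambda>x. f x * (g \<circ> \<psi>) x) \<pi> = pushforward \<psi> S (\<lambda>x. f' x * g x) (map E \<pi>)"
      unfolding pushforward_def
      by (rule carrier_determinedD[OF cd _ adm_compose_isometric[OF \<psi> a]])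
         (use f' E \<pi> adm_cong_fun[OF f blip_fun_mult[OF adm_blip[OF f] blip_fun_compose_isometric[OF \<psi> g(1)]]] in auto)
    then show "S (\<lambda>x. f x * (g \<circ> \<psi>) x) \<pi> = 0" using limz[OF a] by simp
  qed (use e in auto)
  then show False using q by blast
qed

text \<open>
  The distance is an arbitrary function, so both orders of its arguments occur in the conclusion.
\<close>

lemma maximal_separated_set:
  fixes M :: "'a set" and d :: "'a \<Rightarrow> 'a \<Rightarrow> real"
  obtains S where "S \<subseteq> M" "\<And>x y. x \<in> S \<Longrightarrow> y \<in> S \<Longrightarrow> x \<noteq> y \<Longrightarrow> e \<le> d x y"
    "\<And>q. q \<in> M \<Longrightarrow> q \<notin> S \<Longrightarrow> \<exists>x\<in>S. d x q < e \<or> d q x < e"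
proof -
  define \<A> where "\<A> = {S. S \<subseteq> M \<and> (\<forall>x\<in>S. \<forall>y\<in>S. x \<noteq> y \<longrightarrow> e \<le> d x y)}"
  have "\<exists>S\<in>\<A>. \<forall>X\<in>\<A>. S \<subseteq> X \<longrightarrow> X = S"
  proof (rule subset_Zorn_nonempty)
    show "\<A> \<noteq> {}" by (auto simp: \<A>_def intro!: exI[of _ "{}"])
    fix \<C> assume "\<C> \<noteq> {}" "subset.chain \<A> \<C>"
    then have C: "\<And>S. S \<in> \<C> \<Longrightarrow> S \<in> \<A>" "\<And>S S'. S \<in> \<C> \<Longrightarrow> S' \<in> \<C> \<Longrightarrow> S \<subseteq> S' \<or> S' \<subseteq> S"
      by (auto simp: subset_chain_def)
    show "\<Union>\<C> \<in> \<A>" unfolding \<A>_def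
    proof (intro CollectI conjI ballI impI)
      show "\<Union>\<C> \<subseteq> M" using C(1) by (auto simp: \<A>_def)
      fix x y assume "x \<in> \<Union>\<C>" "y \<in> \<Union>\<C>" "x \<noteq> y"
      then obtain S where "S \<in> \<C>" "x \<in> S" "y \<in> S" using C(2) by blast
      then show "e \<le> d x y" using C(1) \<open>x \<noteq> y\<close> by (auto simp: \<A>_def)
    qed
  qed
  then obtain S where S: "S \<in> \<A>" "\<And>X. X \<in> \<A> \<Longrightarrow> S \<subseteq> X \<Longrightarrow> X = S"
    by blast
  show ?thesis
  proof (rule that[of S])
    fix q assume q: "q \<in> M" "q \<notin> S"
    show "\<exists>x\<in>S. d x q < e \<or> d q x < e"
    proof (rule ccontr)
      assume "\<not> ?thesis"
      then have "insert q S \<in> \<A>" using S(1) q by (auto simp: \<A>_def not_less)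
      then show False using S(2)[of "insert q S"] q by auto
    qed
  qed (use S(1) in \<open>auto simp: \<A>_def\<close>)
qed

text \<open>
  Every ball around a point of the set has positive mass. For a maximal \<open>e\<close>-separated subset the balls
  of radius \<open>e/2\<close> are disjoint, and a finite measure is positive on only countably many members of
  a disjoint family.
\<close>

lemma current_set_separable:
  assumes fin: "finite_borel_measure Z (mass_measure m Z T)"
  obtains D where "countable D" "D \<subseteq> current_set m Z T"
    "\<And>q e. q \<in> current_set m Z T \<Longrightarrow> e > 0 \<Longrightarrow> \<exists>x\<in>D. mdist Z x q < e"
proof -
  let ?M = "current_set m Z T" and ?\<mu> = "mass_measure m Z T"
  interpret finite_measure ?\<mu> using fin by (simp add: finite_borel_measure_def)
  have s: "sets ?\<mu> = sets (borel_metric Z)" using fin by (simp add: finite_borel_measure_def)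
  have MZ: "?M \<subseteq> mspace Z" by (auto simp: current_set_def)
  have "\<exists>S. S \<subseteq> ?M \<and> countable S \<and> (\<forall>q\<in>?M. \<exists>x\<in>S. mdist Z x q < e)" if e: "e > 0" for e :: real
  proof -
    obtain S where S: "S \<subseteq> ?M" "\<And>x y. x \<in> S \<Longrightarrow> y \<in> S \<Longrightarrow> x \<noteq> y \<Longrightarrow> e \<le> mdist Z x y"
      "\<And>q. q \<in> ?M \<Longrightarrow> q \<notin> S \<Longrightarrow> \<exists>x\<in>S. mdist Z x q < e \<or> mdist Z q x < e"
      using maximal_separated_set[of ?M e "mdist Z"] by metis
    let ?b = "\<lambda>x. measure ?\<mu> (mball_of Z x (e/2))"
    have "?b summable_on S"
    proof (rule nonneg_bdd_above_summable_on)
      show "bdd_above (sum ?b ` {F. F \<subseteq> S \<and> finite F})"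
      proof (rule bdd_aboveI2)
        fix F assume "F \<in> {F. F \<subseteq> S \<and> finite F}"
        then have F: "F \<subseteq> S" "finite F" by auto
        have "disjoint_family_on (\<lambda>x. mball_of Z x (e/2)) F"
          unfolding disjoint_family_on_def
        proof (intro ballI impI equals0I)
          fix x y z assume xy: "x \<in> F" "y \<in> F" "x \<noteq> y" and z: "z \<in> mball_of Z x (e/2) \<inter> mball_of Z y (e/2)"
          then have "mdist Z x y \<le> mdist Z x z + mdist Z y z"
            using mdist_triangle[of x Z z y] by (simp add: mdist_commute)
          then have "mdist Z x y < e" using z by simp
          moreover have "e \<le> mdist Z x y" using S(2) F xy by blast
          ultimately show False by simp
        qed
        then have "sum ?b F = measure ?\<mu> (\<Union>x\<in>F. mball_of Z x (e/2))"
          using F(2) by (intro finite_measure_finite_Union[symmetric]) (auto simp: s open_in_borel_metric[OF openin_mball_of])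
        then show "sum ?b F \<le> measure ?\<mu> (space ?\<mu>)" using bounded_measure by simp
      qed
    qed simp
    then have "countable {x \<in> S. ?b x \<noteq> 0}" by (rule summable_countable_real)
    moreover have "?b x \<noteq> 0" if "x \<in> S" for x
      using current_set_ball_positive[OF subsetD[OF S(1) that] _ fin, of "e/2"] e by simp
    then have "{x \<in> S. ?b x \<noteq> 0} = S" by blast
    ultimately have "countable S" by simp
    moreover have "\<exists>x\<in>S. mdist Z x q < e" if "q \<in> ?M" for q
    proof (cases "q \<in> S")
      case True
      then show ?thesis using MZ that e by (intro bexI[of _ q]) auto
    next
      case False
      then show ?thesis using S(3)[OF that False] by (auto simp: mdist_commute)
    qed
    ultimately show ?thesis using S(1) by blast
  qed
  then have "\<forall>n. \<exists>S. S \<subseteq> ?M \<and> countable S \<and> (\<forall>q\<in>?M. \<exists>x\<in>S. mdist Z x q < 1 / real (Suc n))"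
    by simp
  from choice[OF this] obtain S
    where S: "\<forall>n. S n \<subseteq> ?M \<and> countable (S n) \<and> (\<forall>q\<in>?M. \<exists>x\<in>S n. mdist Z x q < 1 / real (Suc n))"
    by (rule exE)
  show ?thesis
  proof (rule that[of "\<Union>n. S n"])
    fix q and e :: real assume q: "q \<in> ?M" and e: "e > 0"
    obtain n where n: "1 / real (Suc n) < e" using nat_approx_posE[OF e] by blast
    obtain x where "x \<in> S n" "mdist Z x q < 1 / real (Suc n)" using spec[OF S, of n] q by blast
    then show "\<exists>x\<in>\<Union>n. S n. mdist Z x q < e" using n by (auto intro: less_trans)
  qed (use S in auto)
qed

section \<open>Equi-Lipschitz maps on varying domains\<close>

lemma compact_metric_convergent_subsequence:
  assumes W: "compact_space (mtopology_of W)" and u: "\<forall>\<^sub>F n in sequentially. u n \<in> mspace W"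
  shows "\<exists>r l. strict_mono (r :: nat \<Rightarrow> nat) \<and> l \<in> mspace W \<and> (\<lambda>n. mdist W (u (r n)) l) \<longlonglongrightarrow> 0"
proof -
  obtain N where N: "\<And>n. n \<ge> N \<Longrightarrow> u n \<in> mspace W"
    using u by (auto simp: eventually_sequentially)
  have "range (\<lambda>n. u (n + N)) \<subseteq> mspace W" using N by auto
  then obtain l r where l: "l \<in> mspace W" "strict_mono r" "limitin (mtopology_of W) ((\<lambda>n. u (n + N)) \<circ> r) l sequentially"
    using W unfolding mtopology_of_def Metric_space.compact_space_sequentially[OF Metric_space_mspace_mdist]
      by blast
  have "strict_mono (\<lambda>n. r n + N)" using l(2) by (simp add: strict_mono_def)
  moreover have "(\<lambda>n. mdist W (u (r n + N)) l) \<longlonglongrightarrow> 0"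
    using l(3) by (simp add: limitin_mtopology_of_iff)
  ultimately show ?thesis using l(1) by blast
qed

lemma mdist_limit_of_cauchy:
  assumes W: "compact_space (mtopology_of W)" and u: "\<forall>\<^sub>F n in sequentially. u n \<in> mspace W"
    and cau: "\<And>e. e > 0 \<Longrightarrow> \<exists>N. \<forall>n n'. N \<le> n \<longrightarrow> N \<le> n' \<longrightarrow> mdist W (u n) (u n') < e"
  shows "\<exists>l\<in>mspace W. (\<lambda>n. mdist W (u n) l) \<longlonglongrightarrow> 0"
proof -
  obtain N where N: "\<And>n. n \<ge> N \<Longrightarrow> u n \<in> mspace W"
    using u by (auto simp: eventually_sequentially)
  have c: "mcomplete_of W"
    using W Metric_space.compact_space_imp_mcomplete[OF Metric_space_mspace_mdist]
      by (simp add: mcomplete_of_def mtopology_of_def)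
  obtain l where l: "l \<in> mspace W" "(\<lambda>n. mdist W (u (n + N)) l) \<longlonglongrightarrow> 0"
  proof (rule mcomplete_ofD[OF c, of "\<lambda>n. u (n + N)"])
    show "u (n + N) \<in> mspace W" for n using N by simp
    fix e :: real assume "e > 0"
    from cau[OF this] obtain M where M: "\<forall>n n'. M \<le> n \<longrightarrow> M \<le> n' \<longrightarrow> mdist W (u n) (u n') < e"
      by blast
    then show "\<exists>M. \<forall>n n'. M \<le> n \<longrightarrow> M \<le> n' \<longrightarrow> mdist W (u (n + N)) (u (n' + N)) < e"
      by (intro exI[of _ M]) simp
  qed (use that in blast)
  have "(\<lambda>n. mdist W (u n) l) \<longlonglongrightarrow> 0" by (rule LIMSEQ_offset[OF l(2)])
  with l(1) show ?thesis by blast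
qed

text \<open>
  Choose \<open>p i\<close> almost nearest, within \<open>1/(i+1)\<close>; for the finitely many indices with \<open>X i\<close> empty the
  value is arbitrary.
\<close>

lemma eventually_near_imp_sequence:
  fixes d :: "nat \<Rightarrow> 'a \<Rightarrow> real"
  assumes d: "\<And>i p. 0 \<le> d i p" and near: "\<And>e. e > 0 \<Longrightarrow> \<forall>\<^sub>F i in sequentially. \<exists>p\<in>X i. d i p < e"
  shows "\<exists>p. (\<forall>\<^sub>F i in sequentially. p i \<in> X i) \<and> (\<lambda>i. d i (p i)) \<longlonglongrightarrow> 0"
proof -
  define b where "b i = (INF p\<in>X i. d i p)" for i
  have bdd: "bdd_below (d i ` X i)" for i by (rule bdd_belowI2[of _ 0]) (rule d)
  define p where "p i = (SOME p. p \<in> X i \<and> d i p < b i + 1 / real (Suc i))" for i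
  have p: "p i \<in> X i \<and> d i (p i) < b i + 1 / real (Suc i)" if "X i \<noteq> {}" for i
  proof -
    have "\<exists>p\<in>X i. d i p < b i + 1 / real (Suc i)"
      using cINF_less_iff[OF that bdd, of "b i + 1 / real (Suc i)"] by (simp add: b_def)
    then have "\<exists>p. p \<in> X i \<and> d i p < b i + 1 / real (Suc i)" by blast
    then show ?thesis unfolding p_def by (rule someI_ex)
  qed
  have ne: "\<forall>\<^sub>F i in sequentially. X i \<noteq> {}"
    by (rule eventually_mono[OF near[of 1]]) auto
  have "(\<lambda>i. d i (p i)) \<longlonglongrightarrow> 0"
  proof (rule order_tendstoI)
    show "\<forall>\<^sub>F i in sequentially. a < d i (p i)" if "a < 0" for a
      using d that by (intro always_eventually allI) (rule less_le_trans)
    fix e :: real assume "0 < e"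
    then have e: "e/2 > 0" by simp
    have "\<forall>\<^sub>F i in sequentially. 1 / real (Suc i) < e/2"
      using order_tendstoD(2)[OF LIMSEQ_inverse_real_of_nat e] by (simp add: inverse_eq_divide)
    with near[OF e] show "\<forall>\<^sub>F i in sequentially. d i (p i) < e"
    proof eventually_elim
      case (elim i)
      then obtain x where x: "x \<in> X i" "d i x < e/2" by blast
      have "b i \<le> d i x" unfolding b_def by (rule cINF_lower[OF bdd x(1)])
      moreover have "d i (p i) < b i + 1 / real (Suc i)" using p[of i] x(1) by blast
      ultimately show ?case using x elim by linarith
    qed
  qed
  moreover have "\<forall>\<^sub>F i in sequentially. p i \<in> X i"
    using ne by eventually_elim (use p in blast)
  ultimately show ?thesis by blast
qed

text \<open>
  Choose for each limit point \<open>q\<close> points \<open>P q i\<close> of the domains that converge to it. A diagonal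
  argument makes \<open>F\<^sub>i (P q i)\<close> converge for all \<open>q\<close> in the countable dense set. The common Lipschitz
  constant carries convergence over to all \<open>q\<close>, since the values along two sequences differ
  asymptotically by at most \<open>K\<close> times the distance of their limits. The same comparison shows that the
  limit does not depend on the approximating sequence and is \<open>K\<close>-Lipschitz.
\<close>

lemma arzela_ascoli_varying_domains:
  fixes X :: "nat \<Rightarrow> 'a metric" and Y :: "'b metric" and Z :: "'z metric" and W :: "'w metric"
  assumes \<phi>: "\<And>i. isometric_embedding (X i) Z (\<phi> i)" and \<psi>: "isometric_embedding Y Z \<psi>"
    and W: "compact_space (mtopology_of W)" and K: "0 \<le> K"
    and FW: "\<And>i x. x \<in> mspace (X i) \<Longrightarrow> F i x \<in> mspace W"
    and FK: "\<And>i x y. x \<in> mspace (X i) \<Longrightarrow> y \<in> mspace (X i) \<Longrightarrow> mdist W (F i x) (F i y) \<le> K * mdist (X i) x y"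
    and D: "countable D" "D \<subseteq> mspace Y" "\<And>q e. q \<in> mspace Y \<Longrightarrow> e > 0 \<Longrightarrow> \<exists>x\<in>D. mdist Y x q < e"
    and near: "\<And>q e. q \<in> mspace Y \<Longrightarrow> e > 0 \<Longrightarrow> \<forall>\<^sub>F i in sequentially. \<exists>p\<in>mspace (X i). mdist Z (\<phi> i p) (\<psi> q) < e"
  obtains r :: "nat \<Rightarrow> nat" and G where "strict_mono r" "G \<in> mspace Y \<rightarrow> mspace W"
    "\<forall>x\<in>mspace Y. \<forall>y\<in>mspace Y. mdist W (G x) (G y) \<le> K * mdist Y x y"
    "\<forall>p q. (\<forall>i. p i \<in> mspace (X (r i))) \<and> q \<in> mspace Y \<and> (\<lambda>i. mdist Z (\<phi> (r i) (p i)) (\<psi> q)) \<longlonglongrightarrow> 0 \<longrightarrow>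
       (\<lambda>i. mdist W (F (r i) (p i)) (G q)) \<longlonglongrightarrow> 0"
proof -
  have "\<exists>p. (\<forall>\<^sub>F i in sequentially. p i \<in> mspace (X i)) \<and> (\<lambda>i. mdist Z (\<phi> i (p i)) (\<psi> q)) \<longlonglongrightarrow> 0"
    if "q \<in> mspace Y" for q
    by (rule eventually_near_imp_sequence[OF mdist_nonneg near[OF that]])
  then have "\<forall>q. \<exists>p. q \<in> mspace Y \<longrightarrow> (\<forall>\<^sub>F i in sequentially. p i \<in> mspace (X i)) \<and> (\<lambda>i. mdist Z (\<phi> i (p i)) (\<psi> q)) \<longlonglongrightarrow> 0"
    by simp
  from choice[OF this] obtain P where P0: "\<forall>q. q \<in> mspace Y \<longrightarrow> (\<forall>\<^sub>F i in sequentially. P q i \<in> mspace (X i)) \<and>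
      (\<lambda>i. mdist Z (\<phi> i (P q i)) (\<psi> q)) \<longlonglongrightarrow> 0" by (rule exE)
  have P: "\<forall>\<^sub>F i in sequentially. P q i \<in> mspace (X i)" "(\<lambda>i. mdist Z (\<phi> i (P q i)) (\<psi> q)) \<longlonglongrightarrow> 0" if "q \<in> mspace Y" for q
    using P0 that by blast+
  \<comment> \<open>The comparison of values along two sequences that drives the whole argument.\<close>
  have compare: "mdist W (F i p) (F i p') \<le> K * (mdist Z (\<phi> i p) (\<psi> q) + mdist Y q q' + mdist Z (\<phi> i p') (\<psi> q'))"
    if "p \<in> mspace (X i)" "p' \<in> mspace (X i)" "q \<in> mspace Y" "q' \<in> mspace Y" for i p p' q q'
  proof -
    have z: "\<phi> i p \<in> mspace Z" "\<phi> i p' \<in> mspace Z" "\<psi> q \<in> mspace Z" "\<psi> q' \<in> mspace Z"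
      using that isometric_embeddingD(1)[OF \<phi>] isometric_embeddingD(1)[OF \<psi>] by auto
    have "mdist (X i) p p' = mdist Z (\<phi> i p) (\<phi> i p')"
      using isometric_embeddingD(2)[OF \<phi>] that by simp
    also have "\<dots> \<le> mdist Z (\<phi> i p) (\<psi> q) + (mdist Z (\<psi> q) (\<psi> q') + mdist Z (\<psi> q') (\<phi> i p'))"
      using mdist_triangle[OF z(1,3,2)] mdist_triangle[OF z(3,4,2)] by linarith
    finally have "mdist (X i) p p' \<le> mdist Z (\<phi> i p) (\<psi> q) + mdist Y q q' + mdist Z (\<phi> i p') (\<psi> q')"
      using isometric_embeddingD(2)[OF \<psi>] that by (simp add: mdist_commute[of Z "\<psi> q'"])
    then show ?thesis using FK[OF that(1,2)] K by (meson mult_left_mono order_trans)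
  qed
  obtain r :: "nat \<Rightarrow> nat" where r: "strict_mono r"
    and rD: "\<And>x. x \<in> D \<Longrightarrow> \<exists>l\<in>mspace W. (\<lambda>i. mdist W (F (r i) (P x (r i))) l) \<longlonglongrightarrow> 0"
  proof (cases "D = {}")
    case True
    show ?thesis by (rule that[of id]) (auto simp: True strict_mono_def)
  next
    case False
    define x where "x = from_nat_into D"
    have xD: "x n \<in> D" for n unfolding x_def by (rule from_nat_into[OF False])
    define Q where "Q n s \<longleftrightarrow> (\<exists>l\<in>mspace W. (\<lambda>i. mdist W (F (s i) (P (x n) (s i))) l) \<longlonglongrightarrow> 0)" for n and s :: "nat \<Rightarrow> nat"
    interpret subseqs Q
    proof
      fix n and s :: "nat \<Rightarrow> nat" assume s: "strict_mono s"
      have "x n \<in> mspace Y" using xD D(2) by blast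
      then have "\<forall>\<^sub>F i in sequentially. P (x n) (s i) \<in> mspace (X (s i))"
        using P(1) eventually_subseq[OF s] by blast
      then have "\<forall>\<^sub>F i in sequentially. F (s i) (P (x n) (s i)) \<in> mspace W"
        by eventually_elim (rule FW)
      from compact_metric_convergent_subsequence[OF W this]
      show "\<exists>r'. strict_mono r' \<and> Q n (s \<circ> r')" by (auto simp: Q_def)
    qed
    have Qd: "Q k diagseq" for k
    proof -
      have "Q k (diagseq \<circ> ((+) (Suc k)))"
      proof (rule diagseq_holds)
        fix r s n assume rr: "strict_mono (r :: nat \<Rightarrow> nat)" and "Q n s"
        then obtain l where l: "l \<in> mspace W" "(\<lambda>i. mdist W (F (s i) (P (x n) (s i))) l) \<longlonglongrightarrow> 0"
          by (auto simp: Q_def)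
        from LIMSEQ_subseq_LIMSEQ[OF l(2) rr] l(1) show "Q n (s \<circ> r)" by (auto simp: Q_def comp_def)
      qed
      then have "Q k (\<lambda>i. diagseq (i + Suc k))" by (simp only: comp_def add.commute[of "Suc k"])
      then obtain l where l: "l \<in> mspace W"
        "(\<lambda>i. mdist W (F (diagseq (i + Suc k)) (P (x k) (diagseq (i + Suc k)))) l) \<longlonglongrightarrow> 0"
        unfolding Q_def[of k "\<lambda>i. diagseq (i + Suc k)"] by blast
      from LIMSEQ_offset[OF l(2)] l(1) show ?thesis unfolding Q_def[of k diagseq] by blast
    qed
    show ?thesis
    proof (rule that[OF subseq_diagseq])
      fix y assume "y \<in> D"
      then obtain n where "y = x n" using from_nat_into_surj[OF D(1)] by (metis x_def)
      then show "\<exists>l\<in>mspace W. (\<lambda>i. mdist W (F (diagseq i) (P y (diagseq i))) l) \<longlonglongrightarrow> 0"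
        using Qd[of n] unfolding Q_def[of n diagseq] by simp
    qed
  qed
  define a where "a q i = mdist Z (\<phi> (r i) (P q (r i))) (\<psi> q)" for q i
  define u where "u q i = F (r i) (P q (r i))" for q i
  have PX: "\<forall>\<^sub>F i in sequentially. P q (r i) \<in> mspace (X (r i))" and a0: "a q \<longlonglongrightarrow> 0"
    if "q \<in> mspace Y" for q
    using eventually_subseq[OF r P(1)[OF that]] LIMSEQ_subseq_LIMSEQ[OF P(2)[OF that] r]
    by (auto simp: comp_def a_def[abs_def])
  have uW: "\<forall>\<^sub>F i in sequentially. u q i \<in> mspace W" if "q \<in> mspace Y" for q
    using PX[OF that] by eventually_elim (simp add: u_def FW)
  have u_compare: "\<forall>\<^sub>F i in sequentially. mdist W (u q i) (u q' i) \<le> K * (a q i + mdist Y q q' + a q' i)"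
    if "q \<in> mspace Y" "q' \<in> mspace Y" for q q'
    using PX[OF that(1)] PX[OF that(2)]
    by eventually_elim (unfold u_def a_def, rule compare[OF _ _ that])
  have lim: "\<exists>l\<in>mspace W. (\<lambda>i. mdist W (u q i) l) \<longlonglongrightarrow> 0" if q: "q \<in> mspace Y" for q
  proof (rule mdist_limit_of_cauchy[OF W uW[OF q]])
    fix e :: real assume e: "e > 0"
    \<comment> \<open>Small enough that K times it is below e/4; adding 1 covers the case of K being zero.\<close>
    define \<eta> where "\<eta> = e / (4 * (K + 1))"
    have \<eta>: "\<eta> > 0" using e K by (simp add: \<eta>_def)
    have K\<eta>: "K * \<eta> < e / 4"
    proof -
      have "K * \<eta> < (K + 1) * \<eta>" using \<eta> by simp
      also have "\<dots> = e / 4" using K by (simp add: \<eta>_def field_simps)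
      finally show ?thesis .
    qed
    obtain x where x: "x \<in> D" "mdist Y x q < \<eta>" using D(3)[OF q \<eta>] by blast
    then have xY: "x \<in> mspace Y" using D(2) by blast
    obtain l where l: "l \<in> mspace W" "(\<lambda>i. mdist W (u x i) l) \<longlonglongrightarrow> 0"
      using rD[OF x(1)] unfolding u_def by blast
    have "(\<lambda>i. K * (a q i + mdist Y q x + a x i)) \<longlonglongrightarrow> K * (0 + mdist Y q x + 0)"
      by (intro tendsto_intros a0 q xY)
    moreover have "K * (0 + mdist Y q x + 0) < e / 4"
    proof -
      have "K * mdist Y q x \<le> K * \<eta>"
        using x(2) K by (intro mult_left_mono) (auto simp: mdist_commute)
      then show ?thesis using K\<eta> by simp
    qed
    ultimately have ev1: "\<forall>\<^sub>F i in sequentially. K * (a q i + mdist Y q x + a x i) < e / 4"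
      by (rule order_tendstoD(2))
    have "e / 4 > 0" using e by simp
    then have ev2: "\<forall>\<^sub>F i in sequentially. mdist W (u x i) l < e / 4"
      by (rule order_tendstoD(2)[OF l(2)])
    have "\<forall>\<^sub>F i in sequentially. u q i \<in> mspace W \<and> mdist W (u q i) l < e / 2"
      using ev1 ev2 u_compare[OF q xY] uW[OF q] uW[OF xY]
    proof eventually_elim
      case (elim i)
      then show ?case using mdist_triangle[OF elim(4,5) l(1)] by linarith
    qed
    then obtain N where N: "\<And>i. i \<ge> N \<Longrightarrow> u q i \<in> mspace W \<and> mdist W (u q i) l < e / 2"
      by (auto simp: eventually_sequentially)
    have "mdist W (u q n) (u q n') < e" if "N \<le> n" "N \<le> n'" for n n'
    proof -
      have w: "u q n \<in> mspace W" "u q n' \<in> mspace W" using N that by auto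
      show ?thesis using N[OF that(1)] N[OF that(2)] mdist_triangle[OF w(1) l(1) w(2)]
        by (simp add: mdist_commute[of W l])
    qed
    then show "\<exists>N. \<forall>n n'. N \<le> n \<longrightarrow> N \<le> n' \<longrightarrow> mdist W (u q n) (u q n') < e"
      by blast
  qed
  have "\<forall>q. \<exists>l. q \<in> mspace Y \<longrightarrow> l \<in> mspace W \<and> (\<lambda>i. mdist W (u q i) l) \<longlonglongrightarrow> 0"
    using lim by blast
  from choice[OF this] obtain G where "\<forall>q. q \<in> mspace Y \<longrightarrow> G q \<in> mspace W \<and> (\<lambda>i. mdist W (u q i) (G q)) \<longlonglongrightarrow> 0"
    by (rule exE)
  then have G: "G q \<in> mspace W" "(\<lambda>i. mdist W (u q i) (G q)) \<longlonglongrightarrow> 0" if "q \<in> mspace Y" for q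
    using that by blast+
  have "G \<in> mspace Y \<rightarrow> mspace W" using G(1) by blast
  moreover have "\<forall>x\<in>mspace Y. \<forall>y\<in>mspace Y. mdist W (G x) (G y) \<le> K * mdist Y x y"
  proof (intro ballI)
    fix x y assume x: "x \<in> mspace Y" and y: "y \<in> mspace Y"
    let ?b = "\<lambda>i. mdist W (u x i) (G x) + K * (a x i + mdist Y x y + a y i) + mdist W (u y i) (G y)"
    have "?b \<longlonglongrightarrow> 0 + K * (0 + mdist Y x y + 0) + 0"
      by (intro tendsto_intros a0 G(2) x y)
    then have "mdist W (G x) (G y) \<le> 0 + K * (0 + mdist Y x y + 0) + 0"
    proof (rule LIMSEQ_le_const)
      have "\<forall>\<^sub>F i in sequentially. mdist W (G x) (G y) \<le> ?b i"
        using u_compare[OF x y] uW[OF x] uW[OF y]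
      proof eventually_elim
        case (elim i)
        then show ?case
          using mdist_triangle[OF G(1)[OF x] elim(2) G(1)[OF y]] mdist_triangle[OF elim(2,3) G(1)[OF y]]
          by (simp add: mdist_commute[of W "G x"])
      qed
      then show "\<exists>N. \<forall>n\<ge>N. mdist W (G x) (G y) \<le> ?b n"
        by (simp add: eventually_sequentially)
    qed
    then show "mdist W (G x) (G y) \<le> K * mdist Y x y" by simp
  qed
  moreover have "\<forall>p q. (\<forall>i. p i \<in> mspace (X (r i))) \<and> q \<in> mspace Y \<and> (\<lambda>i. mdist Z (\<phi> (r i) (p i)) (\<psi> q)) \<longlonglongrightarrow> 0 \<longrightarrow>
       (\<lambda>i. mdist W (F (r i) (p i)) (G q)) \<longlonglongrightarrow> 0"
  proof (intro allI impI, elim conjE)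
    fix p q assume p: "\<forall>i. p i \<in> mspace (X (r i))" and q: "q \<in> mspace Y"
      and pq: "(\<lambda>i. mdist Z (\<phi> (r i) (p i)) (\<psi> q)) \<longlonglongrightarrow> 0"
    let ?b = "\<lambda>i. K * (mdist Z (\<phi> (r i) (p i)) (\<psi> q) + mdist Y q q + a q i) + mdist W (u q i) (G q)"
    show "(\<lambda>i. mdist W (F (r i) (p i)) (G q)) \<longlonglongrightarrow> 0"
    proof (rule tendsto_sandwich[OF _ _ tendsto_const])
      have "?b \<longlonglongrightarrow> K * (0 + mdist Y q q + 0) + 0"
        by (intro tendsto_intros pq a0 G(2) q)
      then show "?b \<longlonglongrightarrow> 0" using q by simp
      show "\<forall>\<^sub>F i in sequentially. mdist W (F (r i) (p i)) (G q) \<le> ?b i"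
        using PX[OF q]
      proof eventually_elim
        case (elim i)
        have w: "F (r i) (p i) \<in> mspace W" "u q i \<in> mspace W" using elim p FW by (auto simp: u_def)
        show ?case using compare[OF spec[OF p, of i] elim q q] mdist_triangle[OF w G(1)[OF q]]
          unfolding u_def a_def by linarith
      qed
    qed simp
  qed
  ultimately show ?thesis using that[OF r] by blast
qed

section \<open>Intrinsic flat convergence in a common space\<close>

text \<open>
  Choose almost optimal spaces for each index and glue them along the copies of \<open>Y\<close>. The push-forwards
  of \<open>S\<close> become one current, and flat distances do not increase. The first \<open>N\<close> indices are dropped
  because for them the distance may be infinite, in which case there may be no common space at all.
\<close>

lemma intrinsic_flat_realization:
  fixes Xbar :: "nat \<Rightarrow> 'a metric" and T :: "nat \<Rightarrow> 'a current" and Y :: "'b metric" and S :: "'b current"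
  assumes Y: "mcomplete_of Y" and S: "metric_current m Y S"
    and lim: "(\<lambda>i. intrinsic_flat_dist TYPE('z) m (Xbar i) (T i) Y S) \<longlonglongrightarrow> 0"
  obtains N and Z :: "(nat \<times> 'z) metric" and \<phi> \<psi> where "mcomplete_of Z"
    "\<And>i. isometric_embedding (Xbar (i + N)) Z (\<phi> i)" "isometric_embedding Y Z \<psi>"
    "(\<lambda>i. flat_dist m Z (pushforward (\<phi> i) (T (i + N))) (pushforward \<psi> S)) \<longlonglongrightarrow> 0"
proof -
  let ?d = "\<lambda>i. intrinsic_flat_dist TYPE('z) m (Xbar i) (T i) Y S"
  have "\<forall>\<^sub>F i in sequentially. ?d i < 1" using lim by (rule order_tendstoD) simp
  then obtain N where N: "\<And>i. i \<ge> N \<Longrightarrow> ?d i < 1"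
    by (auto simp: eventually_sequentially)
  have "\<exists>A :: 'z metric. \<exists>f1 f2. mcomplete_of A \<and> isometric_embedding (Xbar (i + N)) A f1 \<and> isometric_embedding Y A f2 \<and>
      flat_dist m A (pushforward f1 (T (i + N))) (pushforward f2 S) < ?d (i + N) + ennreal (1 / real (Suc i))" for i
  proof -
    have "?d (i + N) < \<infinity>" using less_trans[OF N[of "i + N"] ennreal_one_less_top] by simp
    then have "?d (i + N) + 0 < ?d (i + N) + ennreal (1 / real (Suc i))"
      by (subst ennreal_add_left_cancel_less) simp
    then have "?d (i + N) < ?d (i + N) + ennreal (1 / real (Suc i))" by simp
    then show ?thesis unfolding intrinsic_flat_dist_def[of _ _ "Xbar (i + N)"] INF_less_iff
      by (auto simp: intrinsic_flat_dist_def)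
  qed
  then obtain A :: "nat \<Rightarrow> 'z metric" and f1 f2 where A: "\<And>i. mcomplete_of (A i)"
    and f1: "\<And>i. isometric_embedding (Xbar (i + N)) (A i) (f1 i)" and f2: "\<And>i. isometric_embedding Y (A i) (f2 i)"
    and fl: "\<And>i. flat_dist m (A i) (pushforward (f1 i) (T (i + N))) (pushforward (f2 i) S) < ?d (i + N) + ennreal (1 / real (Suc i))"
    by metis
  obtain Z :: "(nat \<times> 'z) metric" and \<iota> where Z: "mcomplete_of Z" and \<iota>: "\<And>i. isometric_embedding (A i) Z (\<iota> i)"
    and com: "\<And>i j a. a \<in> mspace Y \<Longrightarrow> \<iota> i (f2 i a) = \<iota> j (f2 j a)"
    by (rule glue_along_common_subspace[where Y = A and \<psi> = f2, OF Y A f2]) (rule that)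
  define \<phi> where "\<phi> i = \<iota> i \<circ> f1 i" for i
  define \<psi> where "\<psi> = \<iota> 0 \<circ> f2 0"
  have \<psi>: "isometric_embedding Y Z \<psi>"
    unfolding \<psi>_def by (rule isometric_embedding_compose[OF f2 \<iota>])
  note cd = metric_current_facts(3)[OF S]
  have le: "flat_dist m Z (pushforward (\<phi> i) (T (i + N))) (pushforward \<psi> S) \<le> ?d (i + N) + ennreal (1 / real (Suc i))" for i
  proof -
    have "pushforward (\<iota> i) (pushforward (f2 i) S) f \<pi> = pushforward \<psi> S f \<pi>" if f: "adm m Z f \<pi>" for f \<pi>
    proof -
      have e: "isometric_embedding Y Z (\<iota> i \<circ> f2 i)"
        by (rule isometric_embedding_compose[OF f2 \<iota>])
      have l: "length \<pi> = m" using f by (simp add: adm_def)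
      have "S (f \<circ> (\<iota> i \<circ> f2 i)) (map (\<lambda>p. p \<circ> (\<iota> i \<circ> f2 i)) \<pi>) = S (f \<circ> \<psi>) (map (\<lambda>p. p \<circ> \<psi>) \<pi>)"
        by (rule carrier_determinedD[OF cd adm_compose_isometric[OF e f] adm_compose_isometric[OF \<psi> f]])
           (use com[of _ i 0] l in \<open>simp_all add: \<psi>_def\<close>)
      then show ?thesis by (simp add: pushforward_def comp_assoc comp_def)
    qed
    then have "flat_dist m Z (pushforward (\<phi> i) (T (i + N))) (pushforward \<psi> S) =
        flat_dist m Z (pushforward (\<phi> i) (T (i + N))) (pushforward (\<iota> i) (pushforward (f2 i) S))"
      by (intro flat_dist_cong) simp
    moreover have "pushforward (\<phi> i) (T (i + N)) = pushforward (\<iota> i) (pushforward (f1 i) (T (i + N)))"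
      by (simp add: \<phi>_def pushforward_def fun_eq_iff comp_assoc comp_def)
    ultimately have "flat_dist m Z (pushforward (\<phi> i) (T (i + N))) (pushforward \<psi> S) \<le>
        flat_dist m (A i) (pushforward (f1 i) (T (i + N))) (pushforward (f2 i) S)"
      using flat_dist_pushforward[OF \<iota> A] by simp
    then show ?thesis using fl[of i] by (meson less_imp_le order_trans)
  qed
  show ?thesis
  proof (rule that[OF Z _ \<psi>])
    show "isometric_embedding (Xbar (i + N)) Z (\<phi> i)" for i
      unfolding \<phi>_def by (rule isometric_embedding_compose[OF f1 \<iota>])
    have "(\<lambda>i. ?d (i + N) + ennreal (1 / real (Suc i))) \<longlonglongrightarrow> 0 + ennreal 0"
      using LIMSEQ_ignore_initial_segment[OF lim, of N] LIMSEQ_inverse_real_of_nat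
      by (intro tendsto_add tendsto_ennrealI) (simp_all add: inverse_eq_divide)
    then have u: "(\<lambda>i. ?d (i + N) + ennreal (1 / real (Suc i))) \<longlonglongrightarrow> 0" by simp
    show "(\<lambda>i. flat_dist m Z (pushforward (\<phi> i) (T (i + N))) (pushforward \<psi> S)) \<longlonglongrightarrow> 0"
      by (rule tendsto_sandwich[OF _ always_eventually[OF allI[OF le]] tendsto_const u]) simp
  qed
qed

lemma isometric_embedding_from_completion:
  assumes "metric_completion_of X Xbar" "isometric_embedding Xbar Z \<phi>"
  shows "isometric_embedding X Z \<phi>"
  using assms by (auto simp: metric_completion_of_def isometric_embedding_def Pi_iff subset_iff)

theorem theorem6p1:
  fixes K :: real and m :: nat
    and X Xbar :: "nat \<Rightarrow> 'a metric" and T :: "nat \<Rightarrow> 'a current"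
    and Xinf Xbarinf :: "'b metric" and Tinf :: "'b current"
    and W :: "'w metric" and F :: "nat \<Rightarrow> 'a \<Rightarrow> 'w"
  assumes "K > 0"
    and "\<And>i. integral_current_space m (X i) (Xbar i) (T i)"
    and "integral_current_space m Xinf Xbarinf Tinf"
    and "(\<lambda>i. intrinsic_flat_dist TYPE('z) m (Xbar i) (T i) Xbarinf Tinf) \<longlonglongrightarrow> 0"
    and "compact_space (mtopology_of W)"
    and "\<And>i. Lipschitz_continuous_map (X i) W (F i)"
    and "\<And>i. Lip (X i) W (F i) \<le> K"
  shows "\<exists>(r :: nat \<Rightarrow> nat) (Finf :: 'b \<Rightarrow> 'w) (Z :: (nat \<times> 'z) metric)
            (\<phi> :: nat \<Rightarrow> 'a \<Rightarrow> nat \<times> 'z) (\<phi>inf :: 'b \<Rightarrow> nat \<times> 'z).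
      strict_mono r \<and>
      Lipschitz_continuous_map Xinf W Finf \<and> Lip Xinf W Finf \<le> K \<and>
      mcomplete_of Z \<and>
      (\<forall>i. isometric_embedding (Xbar (r i)) Z (\<phi> i)) \<and>
      isometric_embedding Xbarinf Z \<phi>inf \<and>
      (\<lambda>i. flat_dist m Z (pushforward (\<phi> i) (T (r i))) (pushforward \<phi>inf Tinf)) \<longlonglongrightarrow> 0 \<and>
      (\<forall>p q. (\<forall>i. p i \<in> mspace (X (r i))) \<and> q \<in> mspace Xinf \<and>
             (\<lambda>i. mdist Z (\<phi> i (p i)) (\<phi>inf q)) \<longlonglongrightarrow> 0 \<longrightarrow>
             (\<lambda>i. mdist W (F (r i) (p i)) (Finf q)) \<longlonglongrightarrow> 0)"
proof -
  note XT = assms(2) and Tinf = assms(3)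
  have comp: "metric_completion_of (X i) (Xbar i)" and mcT: "metric_current m (Xbar i) (T i)" for i
    using XT[of i] by (auto simp: integral_current_space_def integral_current_def integer_rectifiable_def)
  have compinf: "metric_completion_of Xinf Xbarinf" and mcTinf: "metric_current m Xbarinf Tinf"
    and setinf: "current_set m Xbarinf Tinf = mspace Xinf"
    using Tinf by (auto simp: integral_current_space_def integral_current_def integer_rectifiable_def)
  have "mcomplete_of Xbarinf" using compinf by (simp add: metric_completion_of_def)
  obtain N and Z :: "(nat \<times> 'z) metric" and \<phi> \<psi> where Z: "mcomplete_of Z"
    and \<phi>: "\<And>i. isometric_embedding (Xbar (i + N)) Z (\<phi> i)" and \<psi>: "isometric_embedding Xbarinf Z \<psi>"
    and lim: "(\<lambda>i. flat_dist m Z (pushforward (\<phi> i) (T (i + N))) (pushforward \<psi> Tinf)) \<longlonglongrightarrow> 0"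
    by (rule intrinsic_flat_realization[OF \<open>mcomplete_of Xbarinf\<close> mcTinf assms(4)]) (rule that)
  \<comment> \<open>The hypothesis that the set of the limit current is the whole limit space enters here and in
    the choice of D.\<close>
  have near: "\<forall>\<^sub>F i in sequentially. \<exists>p\<in>mspace (X (i + N)). mdist Z (\<phi> i p) (\<psi> q) < e"
    if "q \<in> mspace Xinf" "e > 0" for q e
    by (rule flat_limit_support_approximated[OF comp mcT mcTinf \<phi> \<psi> lim _ that(2)]) (simp add: setinf that)
  obtain D where D: "countable D" "D \<subseteq> mspace Xinf"
    and D_dense_bar: "\<And>q e. q \<in> mspace Xinf \<Longrightarrow> e > 0 \<Longrightarrow> \<exists>x\<in>D. mdist Xbarinf x q < e"
    by (rule current_set_separable[OF metric_current_facts(6)[OF mcTinf], unfolded setinf]) (rule that)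
  have D_dense: "\<exists>x\<in>D. mdist Xinf x q < e" if "q \<in> mspace Xinf" "e > 0" for q e
    using D_dense_bar[OF that] D(2) that(1) compinf by (auto simp: metric_completion_of_def subset_iff)
  have FK: "mdist W (F i x) (F i y) \<le> K * mdist (X i) x y" if "x \<in> mspace (X i)" "y \<in> mspace (X i)" for i x y
    using mdist_le_Lip[OF assms(6) that] mult_right_mono[OF assms(7)[of i] mdist_nonneg[of "X i" x y]]
      by linarith
  have FW: "F i x \<in> mspace W" if "x \<in> mspace (X i)" for i x
    using Lipschitz_continuous_map_image[OF assms(6)] that by blast
  have \<phi>X: "isometric_embedding (X (i + N)) Z (\<phi> i)" for i
    by (rule isometric_embedding_from_completion[OF comp \<phi>])
  have \<psi>X: "isometric_embedding Xinf Z \<psi>"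
    by (rule isometric_embedding_from_completion[OF compinf \<psi>])
  have K0: "0 \<le> K" using assms(1) by simp
  obtain r and G where r: "strict_mono r" and GW: "G \<in> mspace Xinf \<rightarrow> mspace W"
    and GK: "\<forall>x\<in>mspace Xinf. \<forall>y\<in>mspace Xinf. mdist W (G x) (G y) \<le> K * mdist Xinf x y"
    and conv: "\<forall>p q. (\<forall>i. p i \<in> mspace (X (r i + N))) \<and> q \<in> mspace Xinf \<and>
        (\<lambda>i. mdist Z (\<phi> (r i) (p i)) (\<psi> q)) \<longlonglongrightarrow> 0 \<longrightarrow> (\<lambda>i. mdist W (F (r i + N) (p i)) (G q)) \<longlonglongrightarrow> 0"
    by (rule arzela_ascoli_varying_domains[where X = "\<lambda>i. X (i + N)" and F = "\<lambda>i. F (i + N)",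
          OF \<phi>X \<psi>X assms(5) K0 FW FK D D_dense near])
  show ?thesis
  proof (rule exI[of _ "\<lambda>i. r i + N"], rule exI[of _ G], rule exI[of _ Z], rule exI[of _ "\<lambda>i. \<phi> (r i)"],
      rule exI[of _ \<psi>], intro conjI)
    show "strict_mono (\<lambda>i. r i + N)" using r by (simp add: strict_mono_def)
    show "Lipschitz_continuous_map Xinf W G"
      unfolding Lipschitz_continuous_map_iff_nonneg using GW GK K0 by blast
    show "Lip Xinf W G \<le> K" using GK by (intro Lip_le[OF K0]) blast
    show "mcomplete_of Z" by (rule Z)
    show "\<forall>i. isometric_embedding (Xbar (r i + N)) Z (\<phi> (r i))" using \<phi> by blast
    show "isometric_embedding Xbarinf Z \<psi>" by (rule \<psi>)
    show "(\<lambda>i. flat_dist m Z (pushforward (\<phi> (r i)) (T (r i + N))) (pushforward \<psi> Tinf)) \<longlonglongrightarrow> 0"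
      using LIMSEQ_subseq_LIMSEQ[OF lim r] by (simp add: comp_def)
    show "\<forall>p q. (\<forall>i. p i \<in> mspace (X (r i + N))) \<and> q \<in> mspace Xinf \<and>
        (\<lambda>i. mdist Z (\<phi> (r i) (p i)) (\<psi> q)) \<longlonglongrightarrow> 0 \<longrightarrow> (\<lambda>i. mdist W (F (r i + N) (p i)) (G q)) \<longlonglongrightarrow> 0" by (rule conv)
  qed
qed

end
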